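(* Let $\diamondsuit\in\{\square,\mathrm{v},\mathrm{h}\}$, $n\ge1$, $Z=z_1+\cdots+z_n$ and $Z^*=z_1^{-1}+\cdots+z_n^{-1}$. Then, as formal Laurent series in $z_1,\dots,z_n$ with operator coefficients, $$B^\diamondsuit(Z)=R(Z)\,\Omega[-f_\diamondsuit[Z]]\,\Omega[ZX]\,\Omega[-(Z+Z^* )X]^\perp .$$
   Context: $\Lambda$ is the ring of symmetric functions in $X=x_1+x_2+\cdots$ (rational coefficients, extended by auxiliary indeterminates as needed), with the scalar product for which Schur functions are orthonormal. Plethystic notation: $P[A]$ is obtained from $P\in\Lambda$ by expressing $P$ in power sums and replacing $p_k$ by $p_k[A]$, where $p_k[A]$ raises every indeterminate in $A$ to the $k$-th power and $p_k[A-B]=p_k[A]-p_k[B]$; $\Omega[A]=\exp(\sum_{k\ge1}p_k[A]/k)$, so that $\Omega[A-B]=\prod_{b\in B}(1-b)/\prod_{a\in A}(1-a)$ when $A,B$ are sums of monomials. $P^\perp$ is the operator on $\Lambda$ adjoint to multiplication by $P$ (skewing is always in the $X$ variables); in particular $\Omega[XA]^\perp P[X]=P[X+A]$. A product such as $\Omega[ZX]\,\Omega[\cdots]^\perp$ means: skew first, then multiply. The symbols: $\square$ (single cell), $\mathrm{h}$ (horizontal domino), $\mathrm{v}$ (vertical domino). Put $f_\square=s_1+s_{(1^2)}$, $f_{\mathrm{h}}=s_2$, $f_{\mathrm{v}}=s_{(1^2)}$, so $\Omega[-f_{\mathrm v}[Z]]=\prod_{i<j}(1-z_iz_j)$, $\Omega[-f_{\mathrm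 h}[Z]]=\prod_{i\le j}(1-z_iz_j)$, $\Omega[-f_\square[Z]]=\prod_i(1-z_i)\prod_{i<j}(1-z_iz_j)$. Also $R(Z)=\prod_{1\le i<j\le n}(1-z_jz_i^{-1})$. Bernstein's operators $B_r\in\mathrm{End}(\Lambda)$ ($r\in\mathbb{Z}$) are defined by $\sum_{r\in\mathbb{Z}}B_rz^r=\Omega[zX]\,\Omega[-z^{-1}X]^\perp$. For $\nu\in\mathbb{Z}^n$ put $B_\nu=B_{\nu_1}\circ\cdots\circ B_{\nu_n}$, $B^\diamondsuit_\nu=\Omega[-f_\diamondsuit]^\perp\circ B_\nu\circ\Omega[f_\diamondsuit]^\perp$, and $B^\diamondsuit(Z)=\sum_{\nu\in\mathbb{Z}^n}z^\nu B^\diamondsuit_\nu$. *)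

theory Defs
  imports
    "HOL-Library.Poly_Mapping"
    "Jordan_Normal_Form.Determinant"
begin

section \<open>Formal power series in countably many variables\<close>

text \<open>
  A monomial in \<open>x\<^sub>0, x\<^sub>1, \<dots>\<close> is a finitely supported exponent vector; a series is an arbitrary
  function from monomials to coefficients.
\<close>

abbreviation lookup where "lookup \<equiv> Poly_Mapping.lookup"
abbreviation keys where "keys \<equiv> Poly_Mapping.keys"

type_synonym xmon = "nat \<Rightarrow>\<^sub>0 nat"

typedef 'c xseries = "UNIV :: (xmon \<Rightarrow> 'c) set"
  morphisms xcoeff XSeries ..

lemma xcoeff_XSeries [simp]: "xcoeff (XSeries f) = f"
  by (simp add: XSeries_inverse)

lemma xseries_eqI: "(\<And>m. xcoeff f m = xcoeff g m) \<Longrightarrow> f = g"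
  by (metis ext xcoeff_inject)

lemma finite_splittings [simp]:
  fixes m :: xmon
  shows "finite {(a, b). a + b = m}"
proof -
  let ?F = "{f :: nat \<Rightarrow> nat. \<forall>i. (i \<in> keys m \<longrightarrow> f i \<in> {..Max (range (lookup m))})
                                \<and> (i \<notin> keys m \<longrightarrow> f i = 0)}"
  have fin: "finite (range (lookup m))"
  proof (rule finite_subset)
    show "range (lookup m) \<subseteq> insert 0 (lookup m ` keys m)"
      by (auto simp: in_keys_iff)
  qed auto
  have F: "finite ?F"
    by (rule finite_set_of_finite_funs) auto
  have bound: "lookup a \<in> ?F" if "a + b = m" for a b :: xmon
  proof -
    have le: "lookup a i \<le> lookup m i" for i
      using that by (auto simp: lookup_add)
    moreover have "lookup m i \<le> Max (range (lookup m))" for i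
      using fin by simp
    ultimately have "lookup a i \<le> Max (range (lookup m))" for i
      using le_trans by blast
    moreover have "lookup a i = 0" if "i \<notin> keys m" for i
      using le[of i] that by (simp add: in_keys_iff)
    ultimately show ?thesis
      by simp
  qed
  have "inj_on (\<lambda>(a, b). lookup a) {(a, b). a + b = m}"
  proof (rule inj_onI)
    fix p q :: "xmon \<times> xmon"
    assume "p \<in> {(a, b). a + b = m}" "q \<in> {(a, b). a + b = m}"
      "(case p of (a, b) \<Rightarrow> lookup a) = (case q of (a, b) \<Rightarrow> lookup a)"
    then have "fst p + snd p = fst q + snd q" "fst p = fst q"
      by (auto simp: lookup_inject)
    then show "p = q"
      by (simp add: prod_eq_iff)
  qed
  moreover have "(\<lambda>(a, b). lookup a) ` {(a, b). a + b = m} \<subseteq> ?F"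
    using bound by fastforce
  ultimately show ?thesis
    using F by (meson finite_imageD finite_subset)
qed

instantiation xseries :: (comm_ring_1) comm_ring_1
begin

definition "0 = XSeries (\<lambda>_. 0)"
definition "1 = XSeries (\<lambda>m. if m = 0 then 1 else 0)"
definition "f + g = XSeries (\<lambda>m. xcoeff f m + xcoeff g m)"
definition "f - g = XSeries (\<lambda>m. xcoeff f m - xcoeff g m)"
definition "- f = XSeries (\<lambda>m. - xcoeff f m)"
definition "f * g = XSeries (\<lambda>m. \<Sum>(a, b) | a + b = m. xcoeff f a * xcoeff g b)"

instance
proof
  fix f g h :: "'a xseries"
  show "f * g * h = f * (g * h)"
  proof (rule xseries_eqI)
    fix m
    let ?S = "\<lambda>m. {(a, b). a + b = (m :: xmon)}"
    have "xcoeff (f * g * h) m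
        = (\<Sum>p\<in>?S m. \<Sum>q\<in>?S (fst p). xcoeff f (fst q) * xcoeff g (snd q) * xcoeff h (snd p))"
      by (simp add: times_xseries_def case_prod_unfold sum_distrib_right)
    also have "\<dots> = (\<Sum>(p, q)\<in>(SIGMA p:?S m. ?S (fst p)).
                     xcoeff f (fst q) * xcoeff g (snd q) * xcoeff h (snd p))"
      by (rule sum.Sigma) auto
    also have "\<dots> = (\<Sum>(p, q)\<in>(SIGMA p:?S m. ?S (snd p)).
                     xcoeff f (fst p) * (xcoeff g (fst q) * xcoeff h (snd q)))"
      by (rule sum.reindex_bij_witness
          [where i = "\<lambda>(p, q). ((fst p + fst q, snd q), (fst p, fst q))"
             and j = "\<lambda>(p, q). ((fst q, snd q + snd p), (snd q, snd p))"])
         (auto simp: add.assoc mult.assoc)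
    also have "\<dots> = (\<Sum>p\<in>?S m. \<Sum>q\<in>?S (snd p). xcoeff f (fst p) * (xcoeff g (fst q) * xcoeff h (snd q)))"
      by (rule sum.Sigma [symmetric]) auto
    also have "\<dots> = xcoeff (f * (g * h)) m"
      by (simp add: times_xseries_def case_prod_unfold sum_distrib_left)
    finally show "xcoeff (f * g * h) m = xcoeff (f * (g * h)) m" .
  qed
  show "f * g = g * f"
  proof (rule xseries_eqI)
    fix m
    show "xcoeff (f * g) m = xcoeff (g * f) m"
      unfolding times_xseries_def xcoeff_XSeries
      by (rule sum.reindex_bij_witness
          [where i = "\<lambda>(a, b). (b, a)" and j = "\<lambda>(a, b). (b, a)"])
         (auto simp: add.commute mult.commute)
  qed
  show "1 * f = f"
  proof (rule xseries_eqI)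
    fix m
    have "xcoeff (1 * f) m = (\<Sum>p\<in>{(a, b). a + b = m}. if p = (0, m) then xcoeff f m else 0)"
      unfolding times_xseries_def xcoeff_XSeries one_xseries_def
      by (rule sum.cong) (auto split: if_splits)
    also have "\<dots> = xcoeff f m"
      by (subst sum.delta) auto
    finally show "xcoeff (1 * f) m = xcoeff f m" .
  qed
  show "(f + g) * h = f * h + g * h"
    by (rule xseries_eqI)
       (simp add: times_xseries_def plus_xseries_def case_prod_unfold distrib_right sum.distrib)
  show "f + g + h = f + (g + h)" "f + g = g + f" "0 + f = f" "- f + f = 0" "f - g = f + - g"
    by (auto intro!: xseries_eqI
        simp: plus_xseries_def minus_xseries_def uminus_xseries_def zero_xseries_def
              add.assoc add.commute)
  have "xcoeff (0 :: 'a xseries) 0 \<noteq> xcoeff 1 0"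
    by (simp add: zero_xseries_def one_xseries_def)
  then show "(0 :: 'a xseries) \<noteq> 1"
    by metis
qed

end

definition xconst :: "'c::zero \<Rightarrow> 'c xseries"
  where "xconst c = XSeries (\<lambda>m. if m = 0 then c else 0)"

definition xdeg :: "xmon \<Rightarrow> nat"
  where "xdeg m = (\<Sum>i\<in>keys m. lookup m i)"


section \<open>Symmetric functions\<close>

text \<open>
  All computations take place in the power series in \<open>x\<^sub>0, x\<^sub>1, \<dots>\<close> over the Laurent polynomials
  with rational coefficients in auxiliary indeterminates \<open>z\<^sub>i\<close>.
\<close>

type_synonym zmon = "nat \<Rightarrow>\<^sub>0 int"
type_synonym laurent = "zmon \<Rightarrow>\<^sub>0 rat"
type_synonym ser = "laurent xseries"

definition symmetric_series :: "ser \<Rightarrow> bool"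
  where "symmetric_series F \<longleftrightarrow> (\<forall>\<pi> m. bij \<pi> \<longrightarrow> xcoeff F (Poly_Mapping.map_key \<pi> m) = xcoeff F m)"

definition bounded_degree :: "ser \<Rightarrow> bool"
  where "bounded_degree F \<longleftrightarrow> (\<exists>d. \<forall>m. xcoeff F m \<noteq> 0 \<longrightarrow> xdeg m \<le> d)"

text \<open>
  \<open>LambdaZ\<close> is the ring of symmetric functions with coefficients extended by the \<open>z\<^sub>i\<close>;
  \<open>Lambda\<close> is the ring of symmetric functions with rational coefficients, embedded in it.
\<close>

definition LambdaZ :: "ser set"
  where "LambdaZ = {F. symmetric_series F \<and> bounded_degree F}"

definition Lambda :: "ser set"
  where "Lambda = {F \<in> LambdaZ. \<forall>m. keys (xcoeff F m) \<subseteq> {0}}"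

text \<open>The alphabet $X = x_0 + x_1 + \cdots$; \<open>ratc\<close> embeds the rational constants.\<close>

definition alphX :: ser
  where "alphX = XSeries (\<lambda>m. if \<exists>i. m = Poly_Mapping.single i 1 then 1 else 0)"

definition ratc :: "rat \<Rightarrow> ser"
  where "ratc c = xconst (Poly_Mapping.single 0 c)"

definition complete_hom :: "int \<Rightarrow> ser"
  where "complete_hom k = XSeries (\<lambda>m. if int (xdeg m) = k then 1 else 0)"

definition is_partition :: "nat list \<Rightarrow> bool"
  where "is_partition la \<longleftrightarrow> sorted_wrt (\<ge>) la \<and> 0 \<notin> set la"

text \<open>
  The Jacobi--Trudi determinant $\det(h_{\lambda_i - i + j})$; negative indices give \<open>0\<close>.
\<close>

definition schur :: "nat list \<Rightarrow> ser"
  where "schur la = det (mat (length la) (length la)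
           (\<lambda>(i, j). complete_hom (int (la ! i) - int i + int j)))"

text \<open>
  The coordinates of a symmetric series (possibly of unbounded degree) in the Schur functions.
  The sum is finite because \<open>schur la\<close> is homogeneous of degree \<open>sum_list la\<close>.
\<close>

definition is_schur_expansion :: "ser \<Rightarrow> (nat list \<Rightarrow> laurent) \<Rightarrow> bool"
  where "is_schur_expansion F a \<longleftrightarrow>
    (\<forall>la. \<not> is_partition la \<longrightarrow> a la = 0) \<and>
    (\<forall>m. xcoeff F m = (\<Sum>la | is_partition la \<and> sum_list la = xdeg m. a la * xcoeff (schur la) m))"

definition schur_coeff :: "ser \<Rightarrow> nat list \<Rightarrow> laurent"
  where "schur_coeff F = (THE a. is_schur_expansion F a)"

text \<open>
  The bilinear scalar product for which Schur functions are orthonormal. Only one of the two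
  arguments has to be of bounded degree.
\<close>

definition hall :: "ser \<Rightarrow> ser \<Rightarrow> laurent"
  where "hall P Q = (\<Sum>la | schur_coeff P la * schur_coeff Q la \<noteq> 0.
                         schur_coeff P la * schur_coeff Q la)"

text \<open>
  The adjoint of multiplication by \<open>P\<close>. Here \<open>P\<close> may have unbounded degree, as for \<open>\<Omega>[XA]\<close>.
\<close>

definition skew :: "ser \<Rightarrow> ser \<Rightarrow> ser"
  where "skew P Q = (THE T. T \<in> LambdaZ \<and> (\<forall>S\<in>LambdaZ. hall T S = hall Q (P * S)))"


section \<open>Plethysm\<close>

text \<open>
  \<open>p_at k A\<close> is $p_k[A]$: each monomial in the \<open>x\<^sub>i\<close> and the \<open>z\<^sub>i\<close> is raised to the \<open>k\<close>-th power,
  rational coefficients are kept. For \<open>k \<ge> 1\<close> the sum over \<open>m'\<close> has at most one term.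
\<close>

definition zpower :: "nat \<Rightarrow> laurent \<Rightarrow> laurent"
  where "zpower k c = (\<Sum>a\<in>keys c.
           Poly_Mapping.single (Poly_Mapping.map (\<lambda>e. int k * e) a) (lookup c a))"

definition p_at :: "nat \<Rightarrow> ser \<Rightarrow> ser"
  where "p_at k A = XSeries (\<lambda>m.
           \<Sum>m' | Poly_Mapping.map (\<lambda>e. k * e) m' = m. zpower k (xcoeff A m'))"

text \<open>
  \<open>power_sum_poly F A\<close> is the polynomial \<open>F\<close> with rational coefficients evaluated at
  $p_1[A], p_2[A], \dots$
\<close>

definition power_sum_poly :: "((nat \<Rightarrow>\<^sub>0 nat) \<Rightarrow>\<^sub>0 rat) \<Rightarrow> ser \<Rightarrow> ser"
  where "power_sum_poly F A = (\<Sum>t\<in>keys F. ratc (lookup F t) * (\<Prod>k\<in>keys t. p_at k A ^ lookup t k))"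

definition plethysm :: "ser \<Rightarrow> ser \<Rightarrow> ser"
  where "plethysm P A = (THE Q. \<exists>F. (\<forall>t\<in>keys F. 0 \<notin> keys t) \<and>
           P = power_sum_poly F alphX \<and> Q = power_sum_poly F A)"

text \<open>
  $\Omega[A] = \exp(\sum_{k\ge1} p_k[A]/k)$, where the infinite sums are meant formally: every
  coefficient (in the \<open>x\<^sub>i\<close> and \<open>z\<^sub>i\<close>) of the truncations is eventually constant.
\<close>

definition Omega_trunc :: "nat \<Rightarrow> ser \<Rightarrow> ser"
  where "Omega_trunc N A =
    (\<Sum>r\<le>N. ratc (1 / fact r) * (\<Sum>k=1..N. ratc (1 / of_nat k) * p_at k A) ^ r)"

definition Omega :: "ser \<Rightarrow> ser"
  where "Omega A = (THE F. \<forall>m a. \<forall>\<^sub>F N in sequentially.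
           lookup (xcoeff (Omega_trunc N A) m) a = lookup (xcoeff F m) a)"


section \<open>Bernstein operators and their deformations\<close>

definition zmonom :: "zmon \<Rightarrow> ser"
  where "zmonom a = xconst (Poly_Mapping.single a 1)"

definition zpow :: "nat \<Rightarrow> int \<Rightarrow> ser"
  where "zpow i e = zmonom (Poly_Mapping.single i e)"

definition alphZ :: "nat \<Rightarrow> ser"
  where "alphZ n = (\<Sum>i=1..n. zpow i 1)"

definition alphZstar :: "nat \<Rightarrow> ser"
  where "alphZstar n = (\<Sum>i=1..n. zpow i (- 1))"

definition R_factor :: "nat \<Rightarrow> ser"
  where "R_factor n = (\<Prod>(i, j) | 1 \<le> i \<and> i < j \<and> j \<le> n. 1 - zpow j 1 * zpow i (- 1))"

text \<open>
  A formal Laurent series in the \<open>z\<^sub>i\<close> with operator coefficients is a function from \<open>zmon\<close> to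
  operators. An operator into series involving the \<open>z\<^sub>i\<close> yields such a Laurent series by
  extracting coefficients.
\<close>

definition zcoeff :: "zmon \<Rightarrow> ser \<Rightarrow> ser"
  where "zcoeff a F = XSeries (\<lambda>m. Poly_Mapping.single 0 (lookup (xcoeff F m) a))"

definition op_coeff :: "(ser \<Rightarrow> ser) \<Rightarrow> zmon \<Rightarrow> ser \<Rightarrow> ser"
  where "op_coeff T a P = zcoeff a (T P)"

definition bernstein :: "int \<Rightarrow> ser \<Rightarrow> ser"
  where "bernstein r = op_coeff
           (\<lambda>P. Omega (zpow 1 1 * alphX) * skew (Omega (- (zpow 1 (- 1) * alphX))) P)
           (Poly_Mapping.single 1 r)"

text \<open>\<open>bernstein_comp n \<nu>\<close> is $B_{\nu_1} \circ \cdots \circ B_{\nu_n}$.\<close>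

definition bernstein_comp :: "nat \<Rightarrow> zmon \<Rightarrow> ser \<Rightarrow> ser"
  where "bernstein_comp n \<nu> = foldr (\<lambda>i F. bernstein (lookup \<nu> i) \<circ> F) [1..<Suc n] id"

datatype symbol = Cell | Vdom | Hdom

fun f_sym :: "symbol \<Rightarrow> ser" where
  "f_sym Cell = schur [1] + schur [1, 1]"
| "f_sym Hdom = schur [2]"
| "f_sym Vdom = schur [1, 1]"

definition deformed_bernstein :: "symbol \<Rightarrow> nat \<Rightarrow> zmon \<Rightarrow> ser \<Rightarrow> ser"
  where "deformed_bernstein s n \<nu> =
    skew (Omega (- f_sym s)) \<circ> bernstein_comp n \<nu> \<circ> skew (Omega (f_sym s))"

text \<open>The generating series over \<open>\<nu> \<in> \<int>\<^sup>n\<close>, where \<open>\<int>\<^sup>n\<close> is the set of \<open>\<nu>\<close> supported in \<open>{1..n}\<close>.\<close>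

definition deformed_bernstein_series :: "symbol \<Rightarrow> nat \<Rightarrow> zmon \<Rightarrow> ser \<Rightarrow> ser"
  where "deformed_bernstein_series s n \<nu> =
    (if keys \<nu> \<subseteq> {1..n} then deformed_bernstein s n \<nu> else (\<lambda>_. 0))"

end

theory Submission
  imports Defs
    "HOL-Computational_Algebra.Formal_Power_Series"
    "Jordan_Normal_Form.Char_Poly"
begin

text \<open>
  If $P[X + t] = P[X]\,K(t)\,\Omega[-tX]$ with \<open>K\<close> free of \<open>X\<close>, then adjointness of the product
  and the coproduct gives $P^\perp\,\Omega[tX] = K(t)\,\Omega[tX]\,\Omega[-tX]^\perp P^\perp$. The series
  $\Omega[-f]$ satisfies the hypothesis because $f[X + t] = f[X] + tX + f[t]$, and so do all its
  multiples by $\Omega[-(Z + Z^*)X]$, with factors $(1 - tz_i)(1 - tz_i^{-1})$ in \<open>K\<close>. Hence moving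
  $\Omega[-f]^\perp$ through the Bernstein operators, one at a time, produces exactly the factors of
  $R(Z)\,\Omega[-f[Z]]$ and turns each $\Omega[-z_i^{-1}X]^\perp$ into
  $\Omega[-(z_i + z_i^{-1})X]^\perp$; finally $\Omega[-f]^\perp$ cancels against $\Omega[f]^\perp$.

  For this one needs that $h_k^\perp$ extracts the coefficient of $t^k$ in $F[X + t]$. Since the scalar
  product is defined by orthonormality of the Jacobi--Trudi determinants, it rests on the formula
  $s_\lambda a_\delta = a_{\lambda+\delta}$, which computes Schur coordinates, and on the symmetry
  of the coefficient of $x^\beta$ in $h_\gamma$.
\<close>

text \<open>The notions \<open>schur_coeff\<close>, \<open>skew\<close>, \<open>plethysm\<close> and
  \<open>Omega\<close> are definite descriptions, so each value has to be shown to exist and to be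
  unique before anything can be computed. The substitution of X + t for X is made concrete by
  peeling off \<open>x_0\<close>: for symmetric F the part of F at \<open>x_0^k\<close>, with the
  other variables renumbered, is the coefficient of t^k in F[X + t]. An identity between two series
  thus becomes a comparison of their expansions in \<open>x_0\<close>. A series of unbounded degree
  under a skewing operator is cut off at the degree of the argument. The limits in
  \<open>Omega\<close> are taken coefficientwise, which is too weak for products of Laurent series;
  they are controlled by a weight for which all alphabets in question are positive. In the induction
  on n the operator with index \<nu>_n acts first. Its indeterminate occurs neither in the argument,
  which has rational coefficients, nor in the part of the formula built from the earlier
  indeterminates, so extracting its powers commutes with both.\<close>

abbreviation "single \<equiv> Poly_Mapping.single"
abbreviation "hc \<equiv> complete_hom"

section \<open>Series and their coefficients\<close>

lemma xcoeff_simps [simp]: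
  fixes F G :: "'c::comm_ring_1 xseries"
  shows "xcoeff 0 m = (0 :: 'c)"
    and "xcoeff (F + G) m = xcoeff F m + xcoeff G m"
    and "xcoeff (F - G) m = xcoeff F m - xcoeff G m"
    and "xcoeff (- F) m = - xcoeff F m"
  by (simp_all add: zero_xseries_def plus_xseries_def minus_xseries_def uminus_xseries_def)

lemma xcoeff_one: "xcoeff (1 :: 'c::comm_ring_1 xseries) m = (if m = 0 then 1 else 0)"
  by (simp add: one_xseries_def)

lemma xcoeff_mult:
  fixes F G :: "'c::comm_ring_1 xseries"
  shows "xcoeff (F * G) m = (\<Sum>(a, b) | a + b = m. xcoeff F a * xcoeff G b)"
  by (simp add: times_xseries_def)

lemma xcoeff_mult_nonzero:
  fixes F G :: "'c::comm_ring_1 xseries"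
  assumes "xcoeff (F * G) m \<noteq> 0"
  obtains a b where "m = a + b" "xcoeff F a \<noteq> 0" "xcoeff G b \<noteq> 0"
proof -
  have "\<exists>p\<in>{(a, b). a + b = m}. xcoeff F (fst p) * xcoeff G (snd p) \<noteq> 0"
    using assms unfolding xcoeff_mult by (metis (mono_tags, lifting) case_prod_unfold sum.neutral)
  then show ?thesis using that by fastforce
qed

lemma xcoeff_sum [simp]:
  "xcoeff (\<Sum>i\<in>I. F i) m = (\<Sum>i\<in>I. xcoeff (F i :: 'c::comm_ring_1 xseries) m)"
  by (induction I rule: infinite_finite_induct) auto

lemma xcoeff_xconst: "xcoeff (xconst c) m = (if m = 0 then c else 0)"
  by (simp add: xconst_def)

lemma xcoeff_xconst_mult [simp]:
  fixes F :: "'c::comm_ring_1 xseries"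
  shows "xcoeff (xconst c * F) m = c * xcoeff F m"
proof -
  have "xcoeff (xconst c * F) m =
      (\<Sum>p\<in>{(a, b). a + b = m}. if p = (0, m) then c * xcoeff F m else 0)"
    unfolding xcoeff_mult by (rule sum.cong) (auto simp: xcoeff_xconst split: if_splits)
  also have "\<dots> = c * xcoeff F m"
    by (subst sum.delta) auto
  finally show ?thesis .
qed

lemma xconst_hom:
  fixes c d :: "'c::comm_ring_1"
  shows "xconst 0 = (0 :: 'c xseries)" "xconst 1 = (1 :: 'c xseries)"
    "xconst (c + d) = xconst c + xconst d" "xconst (c - d) = xconst c - xconst d"
    "xconst (- c) = - xconst c" "xconst (c * d) = xconst c * xconst d"
  by (auto intro!: xseries_eqI simp: xcoeff_xconst xcoeff_one)

lemma xconst_power: "xconst (c ^ k) = xconst (c :: 'c::comm_ring_1) ^ k"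
  by (induction k) (simp_all add: xconst_hom)

lemma xconst_sum: "xconst (\<Sum>i\<in>I. c i) = (\<Sum>i\<in>I. xconst (c i :: 'c::comm_ring_1))"
  by (induction I rule: infinite_finite_induct) (auto simp: xconst_hom)

lemma xdeg_eq_sum: "finite A \<Longrightarrow> keys m \<subseteq> A \<Longrightarrow> xdeg m = (\<Sum>i\<in>A. lookup m i)"
  unfolding xdeg_def by (rule sum.mono_neutral_left) (auto simp: in_keys_iff)

lemma xdeg_zero [simp]: "xdeg 0 = 0"
  by (simp add: xdeg_def)

lemma xdeg_add [simp]: "xdeg (a + b) = xdeg a + xdeg b"
proof -
  have "xdeg (a + b) = (\<Sum>i\<in>keys a \<union> keys b. lookup (a + b) i)"
    using keys_add[of a b] by (intro xdeg_eq_sum) auto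
  also have "\<dots> = xdeg a + xdeg b"
    by (simp add: lookup_add sum.distrib xdeg_eq_sum[of "keys a \<union> keys b"])
  finally show ?thesis .
qed

lemma xdeg_eq_0_iff [simp]: "xdeg m = 0 \<longleftrightarrow> m = 0"
proof
  assume "xdeg m = 0"
  then show "m = 0"
    unfolding xdeg_def by (auto simp: in_keys_iff intro!: poly_mapping_eqI)
qed simp


section \<open>Peeling off the first variable\<close>

definition xcons :: "nat \<Rightarrow> xmon \<Rightarrow> xmon"
  where "xcons k m = Abs_poly_mapping (\<lambda>i. case i of 0 \<Rightarrow> k | Suc j \<Rightarrow> lookup m j)"

definition xtail :: "xmon \<Rightarrow> xmon"
  where "xtail m = Abs_poly_mapping (\<lambda>i. lookup m (Suc i))"

lemma lookup_xcons: "lookup (xcons k m) i = (case i of 0 \<Rightarrow> k | Suc j \<Rightarrow> lookup m j)"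
proof -
  have "{i. (case i of 0 \<Rightarrow> k | Suc j \<Rightarrow> lookup m j) \<noteq> 0} \<subseteq> insert 0 (Suc ` keys m)"
  proof
    fix i assume "i \<in> {i. (case i of 0 \<Rightarrow> k | Suc j \<Rightarrow> lookup m j) \<noteq> 0}"
    then show "i \<in> insert 0 (Suc ` keys m)"
      by (cases i) (auto simp: in_keys_iff)
  qed
  then have "finite {i. (case i of 0 \<Rightarrow> k | Suc j \<Rightarrow> lookup m j) \<noteq> 0}"
    by (rule finite_subset) auto
  then show ?thesis
    by (simp add: xcons_def)
qed

lemma lookup_xcons_simps [simp]:
  "lookup (xcons k m) 0 = k" "lookup (xcons k m) (Suc i) = lookup m i"
  by (simp_all add: lookup_xcons)

lemma lookup_xtail [simp]: "lookup (xtail m) i = lookup m (Suc i)"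
proof -
  have "inj Suc" by simp
  moreover have "Suc ` {i. lookup m (Suc i) \<noteq> 0} \<subseteq> keys m"
    by (auto simp: in_keys_iff)
  ultimately have "finite {i. lookup m (Suc i) \<noteq> 0}"
    by (metis finite_imageD finite_keys finite_subset inj_on_subset subset_UNIV)
  then show ?thesis
    by (simp add: xtail_def)
qed

lemma xcons_lookup_xtail [simp]: "xcons (lookup m 0) (xtail m) = m"
  by (rule poly_mapping_eqI) (simp add: lookup_xcons split: nat.splits)

lemma xtail_xcons [simp]: "xtail (xcons k m) = m"
  by (rule poly_mapping_eqI) simp

lemma xcons_cases: obtains k m' where "m = xcons k m'"
  by (metis xcons_lookup_xtail)

lemma xcons_eq_iff [simp]: "xcons k m = xcons k' m' \<longleftrightarrow> k = k' \<and> m = m'"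
  by (metis lookup_xcons_simps(1) xtail_xcons)

lemma xcons_0_0 [simp]: "xcons 0 0 = 0"
  by (rule poly_mapping_eqI) (simp add: lookup_xcons split: nat.splits)

lemma xcons_eq_0_iff [simp]: "xcons k m = 0 \<longleftrightarrow> k = 0 \<and> m = 0"
  by (metis xcons_0_0 xcons_eq_iff)

lemma xcons_add: "xcons k m + xcons l m' = xcons (k + l) (m + m')"
  by (rule poly_mapping_eqI) (simp add: lookup_xcons lookup_add split: nat.splits)

lemma keys_xcons: "keys (xcons k m) = (if k = 0 then {} else {0}) \<union> Suc ` keys m"
proof -
  have "i \<in> keys (xcons k m) \<longleftrightarrow> i \<in> (if k = 0 then {} else {0}) \<union> Suc ` keys m" for i
    by (cases i) (auto simp: in_keys_iff)
  then show ?thesis by blast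
qed

lemma xdeg_xcons [simp]: "xdeg (xcons k m) = k + xdeg m"
proof -
  have "xdeg (xcons k m) = (\<Sum>i\<in>insert 0 (Suc ` keys m). lookup (xcons k m) i)"
    by (rule xdeg_eq_sum) (auto simp: keys_xcons)
  also have "\<dots> = k + xdeg m"
    by (subst sum.insert) (auto simp: xdeg_def sum.reindex)
  finally show ?thesis .
qed

text \<open>Removing the first variable lowers a bound on the support by one, so finitely many
  removals reach the monomial 1.\<close>

lemma xmon_induct [case_names zero xcons]:
  assumes "P 0" "\<And>k m. P m \<Longrightarrow> P (xcons k m)"
  shows "P m"
proof -
  have "P m" if "keys m \<subseteq> {..<n}" for n m
    using that
  proof (induction n arbitrary: m)
    case 0
    then show ?case using assms(1) by simp
  next
    case (Suc n)
    obtain k m' where m: "m = xcons k m'" by (rule xcons_cases)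
    then have "keys m' \<subseteq> {..<n}"
      using Suc.prems by (auto simp: keys_xcons)
    then show ?case
      using Suc.IH assms(2) m by blast
  qed
  moreover obtain n where "keys m \<subseteq> {..<n}"
    using finite_nat_iff_bounded[of "keys m"] by auto
  ultimately show ?thesis by blast
qed

definition D :: "nat \<Rightarrow> 'c xseries \<Rightarrow> 'c xseries"
  where "D k F = XSeries (\<lambda>m. xcoeff F (xcons k m))"

lemma xcoeff_D [simp]: "xcoeff (D k F) m = xcoeff F (xcons k m)"
  by (simp add: D_def)

lemma D_simps [simp]:
  fixes F G :: "'c::comm_ring_1 xseries"
  shows "D k (0 :: 'c xseries) = 0" "D k (F + G) = D k F + D k G" "D k (F - G) = D k F - D k G"
    "D k (- F) = - D k F" "D k (xconst c * F) = xconst c * D k F"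
  by (auto intro!: xseries_eqI)

lemma D_xconst: "D k (xconst c) = (if k = 0 then xconst c else 0 :: 'c::comm_ring_1 xseries)"
  by (auto intro!: xseries_eqI simp: xcoeff_xconst)

lemma D_one: "D k (1 :: 'c::comm_ring_1 xseries) = (if k = 0 then 1 else 0)"
  using D_xconst[of k "1 :: 'c"] by (simp add: xconst_hom)

text \<open>The power k of \<open>x_0\<close> is split between the two factors independently of the
  remaining variables. This Cauchy product is what makes \<open>toh\<close> multiplicative.\<close>

lemma D_mult:
  fixes F G :: "'c::comm_ring_1 xseries"
  shows "D k (F * G) = (\<Sum>i\<le>k. D i F * D (k - i) G)"
proof (rule xseries_eqI)
  fix m
  let ?S = "\<lambda>m. {(a, b). a + b = (m :: xmon)}"
  have "xcoeff (D k (F * G)) m = (\<Sum>p\<in>?S (xcons k m). xcoeff F (fst p) * xcoeff G (snd p))"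
    by (simp add: xcoeff_mult case_prod_unfold)
  also have "\<dots> = (\<Sum>(i, p)\<in>{..k} \<times> ?S m. xcoeff F (xcons i (fst p)) * xcoeff G (xcons (k - i) (snd p)))"
  proof (rule sum.reindex_bij_witness
        [where i = "\<lambda>(i, p). (xcons i (fst p), xcons (k - i) (snd p))"
           and j = "\<lambda>p. (lookup (fst p) 0, xtail (fst p), xtail (snd p))"])
    fix p assume p: "p \<in> ?S (xcons k m)"
    obtain i a j b where ab: "p = (xcons i a, xcons j b)"
      by (metis prod.exhaust xcons_cases)
    with p have "i + j = k" "a + b = m"
      by (auto simp: xcons_add)
    with ab show "(case (lookup (fst p) 0, xtail (fst p), xtail (snd p)) of
        (i, p) \<Rightarrow> (xcons i (fst p), xcons (k - i) (snd p))) = p"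
      "(lookup (fst p) 0, xtail (fst p), xtail (snd p)) \<in> {..k} \<times> ?S m"
      "(case (lookup (fst p) 0, xtail (fst p), xtail (snd p)) of
        (i, p) \<Rightarrow> xcoeff F (xcons i (fst p)) * xcoeff G (xcons (k - i) (snd p)))
        = xcoeff F (fst p) * xcoeff G (snd p)"
      by auto
  qed (auto simp: xcons_add)
  also have "\<dots> = (\<Sum>i\<le>k. \<Sum>p\<in>?S m. xcoeff F (xcons i (fst p)) * xcoeff G (xcons (k - i) (snd p)))"
    by (subst sum.cartesian_product) simp
  also have "\<dots> = xcoeff (\<Sum>i\<le>k. D i F * D (k - i) G) m"
    by (simp add: xcoeff_mult case_prod_unfold)
  finally show "xcoeff (D k (F * G)) m = xcoeff (\<Sum>i\<le>k. D i F * D (k - i) G) m" .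
qed

text \<open>\<open>toh F\<close> is $F[X + t]$.\<close>

definition toh :: "'c::comm_ring_1 xseries \<Rightarrow> 'c xseries fps"
  where "toh F = Abs_fps (\<lambda>k. D k F)"

lemma toh_nth [simp]: "fps_nth (toh F) k = D k F"
  by (simp add: toh_def)

lemma toh_hom:
  fixes F G :: "'c::comm_ring_1 xseries"
  shows "toh (0 :: 'c xseries) = 0" "toh (1 :: 'c xseries) = 1" "toh (F + G) = toh F + toh G"
    "toh (F - G) = toh F - toh G" "toh (- F) = - toh F" "toh (F * G) = toh F * toh G"
    "toh (xconst c) = fps_const (xconst c)"
  by (auto intro!: fps_ext simp: D_one D_mult D_xconst fps_mult_nth atLeast0AtMost)

text \<open>Induction on the monomial, one variable at a time. Positive powers of \<open>x_0\<close>
  are compared through \<open>D k\<close>; the power 0 has to lead back to the series itself, which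
  is the role of \<open>D 0 F = F\<close>, satisfied by every symmetric series.\<close>

lemma D_eqI:
  assumes "\<And>k. k > 0 \<Longrightarrow> D k F = D k G" "D 0 F = F" "D 0 G = G" "xcoeff F 0 = xcoeff G 0"
  shows "F = G"
proof (rule xseries_eqI)
  fix m show "xcoeff F m = xcoeff G m"
  proof (induction m rule: xmon_induct)
    case zero
    then show ?case by (fact assms(4))
  next
    case (xcons k m)
    then show ?case
      by (cases "k = 0") (metis assms(1-3) neq0_conv xcoeff_D)+
  qed
qed


section \<open>Symmetric series\<close>

abbreviation "map_key \<equiv> Poly_Mapping.map_key"

lemma xdeg_map_key: "bij \<pi> \<Longrightarrow> xdeg (map_key \<pi> m) = xdeg m"
proof -
  assume "bij \<pi>"
  then have inj: "inj \<pi>" and surj: "surj \<pi>" by (auto simp: bij_def)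
  have "keys (map_key \<pi> m) = \<pi> -` keys m"
    using inj by (rule keys_map_key)
  moreover have "bij_betw \<pi> (\<pi> -` keys m) (keys m)"
    using inj surj by (auto simp: bij_betw_def inj_on_def)
  ultimately show ?thesis
    unfolding xdeg_def by (simp add: sum.reindex_bij_betw[symmetric] map_key.rep_eq[OF inj])
qed

lemma map_key_inv:
  assumes "bij \<pi>"
  shows "map_key \<pi> (map_key (inv_into UNIV \<pi>) m) = m"
    and "map_key (inv_into UNIV \<pi>) (map_key \<pi> m) = m"
proof -
  have i: "inj \<pi>" "inj (inv_into UNIV \<pi>)" "surj \<pi>"
    using assms bij_imp_bij_inv[OF assms] by (auto simp: bij_def)
  show "map_key \<pi> (map_key (inv_into UNIV \<pi>) m) = m"
    by (rule poly_mapping_eqI) (simp add: map_key.rep_eq i inv_f_f)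
  show "map_key (inv_into UNIV \<pi>) (map_key \<pi> m) = m"
    by (rule poly_mapping_eqI) (simp add: map_key.rep_eq i surj_f_inv_f)
qed

lemma symmetric_seriesD:
  "symmetric_series F \<Longrightarrow> bij \<pi> \<Longrightarrow> xcoeff F (map_key \<pi> m) = xcoeff F m"
  by (simp add: symmetric_series_def)

lemma symmetric_series_xconst [simp]: "symmetric_series (xconst c)"
proof -
  have "map_key \<pi> m = 0 \<longleftrightarrow> m = (0 :: xmon)" if "bij \<pi>" for \<pi> :: "nat \<Rightarrow> nat" and m
    using xdeg_map_key[OF that, of m] by (simp flip: xdeg_eq_0_iff)
  then show ?thesis
    unfolding symmetric_series_def xcoeff_xconst by simp
qed

lemma symmetric_series_0 [simp]: "symmetric_series 0"
  and symmetric_series_1 [simp]: "symmetric_series 1"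
  using symmetric_series_xconst[of 0] symmetric_series_xconst[of 1] unfolding xconst_hom by auto

lemma symmetric_series_add [simp]:
    "symmetric_series F \<Longrightarrow> symmetric_series G \<Longrightarrow> symmetric_series (F + G)"
  and symmetric_series_diff [simp]:
    "symmetric_series F \<Longrightarrow> symmetric_series G \<Longrightarrow> symmetric_series (F - G)"
  and symmetric_series_uminus [simp]:
    "symmetric_series F \<Longrightarrow> symmetric_series (- F)"
  by (auto simp: symmetric_series_def)

lemma symmetric_series_mult [simp]:
  assumes "symmetric_series F" "symmetric_series G"
  shows "symmetric_series (F * G)"
  unfolding symmetric_series_def
proof (intro allI impI)
  fix \<pi> :: "nat \<Rightarrow> nat" and m :: xmon
  assume pi: "bij \<pi>"
  let ?h = "map_key \<pi>" and ?g = "map_key (inv_into UNIV \<pi>)"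
  have inj: "inj \<pi>" "inj (inv_into UNIV \<pi>)"
    using pi bij_imp_bij_inv[OF pi] by (auto simp: bij_def)
  have hg: "?h (?g a) = a" "?g (?h a) = a" for a :: xmon
    by (simp_all add: map_key_inv pi)
  show "xcoeff (F * G) (?h m) = xcoeff (F * G) m"
    unfolding xcoeff_mult
    by (rule sum.reindex_bij_witness
        [where i = "\<lambda>(a, b). (?h a, ?h b)" and j = "\<lambda>(a, b). (?g a, ?g b)"])
       (auto simp: hg map_key_plus[OF inj(1), symmetric] map_key_plus[OF inj(2), symmetric]
          symmetric_seriesD[OF assms(1) bij_imp_bij_inv[OF pi]]
          symmetric_seriesD[OF assms(2) bij_imp_bij_inv[OF pi]])
qed

lemma symmetric_series_sum [simp]:
  "(\<And>i. i \<in> I \<Longrightarrow> symmetric_series (F i)) \<Longrightarrow> symmetric_series (\<Sum>i\<in>I. F i)"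
  by (induction I rule: infinite_finite_induct) auto

lemma symmetric_series_prod [simp]:
  "(\<And>i. i \<in> I \<Longrightarrow> symmetric_series (F i)) \<Longrightarrow> symmetric_series (\<Prod>i\<in>I. F i)"
  by (induction I rule: infinite_finite_induct) auto

lemma symmetric_series_power [simp]: "symmetric_series F \<Longrightarrow> symmetric_series (F ^ k)"
  by (induction k) auto

text \<open>Lets a permutation act on the variables after \<open>x_0\<close> while
  \<open>x_0\<close> stays fixed; hence peeling off \<open>x_0\<close> preserves symmetry.\<close>

lemma bij_case_nat:
  assumes "bij \<pi>"
  shows "bij (case_nat 0 (\<lambda>j. Suc (\<pi> j)))"
proof (rule o_bij)
  have "\<pi> (inv_into UNIV \<pi> j) = j" "inv_into UNIV \<pi> (\<pi> j) = j" for j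
    using assms by (simp_all add: bij_is_inj bij_is_surj surj_f_inv_f inv_f_f)
  then show "case_nat 0 (\<lambda>j. Suc (\<pi> j)) \<circ> case_nat 0 (\<lambda>j. Suc (inv_into UNIV \<pi> j)) = id"
    "case_nat 0 (\<lambda>j. Suc (inv_into UNIV \<pi> j)) \<circ> case_nat 0 (\<lambda>j. Suc (\<pi> j)) = id"
    by (simp_all add: fun_eq_iff split: nat.split)
qed

lemma symmetric_series_D [simp]:
  assumes "symmetric_series F"
  shows "symmetric_series (D k F)"
  unfolding symmetric_series_def
proof (intro allI impI)
  fix \<pi> :: "nat \<Rightarrow> nat" and m :: xmon
  assume pi: "bij \<pi>"
  have "xcons k (map_key \<pi> m)
      = map_key (case_nat 0 (\<lambda>j. Suc (\<pi> j))) (xcons k m)"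
    using pi bij_case_nat[OF pi]
    by (intro poly_mapping_eqI) (auto simp: map_key.rep_eq bij_is_inj lookup_xcons split: nat.splits)
  then show "xcoeff (D k F) (map_key \<pi> m) = xcoeff (D k F) m"
    using symmetric_seriesD[OF assms bij_case_nat[OF pi]] by simp
qed

lemma symmetric_series_degreeI:
  assumes "\<And>m. xcoeff F m = f (xdeg m)"
  shows "symmetric_series F"
  by (simp add: symmetric_series_def assms xdeg_map_key)

definition deg_le :: "nat \<Rightarrow> ser \<Rightarrow> bool"
  where "deg_le d F \<longleftrightarrow> (\<forall>m. xcoeff F m \<noteq> 0 \<longrightarrow> xdeg m \<le> d)"

lemma bounded_degree_iff: "bounded_degree F \<longleftrightarrow> (\<exists>d. deg_le d F)"
  by (simp add: bounded_degree_def deg_le_def)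

lemma deg_le_mono: "deg_le d F \<Longrightarrow> d \<le> e \<Longrightarrow> deg_le e F"
  by (force simp: deg_le_def)

lemma deg_le_0 [simp]: "deg_le d 0"
  and deg_le_xconst [simp]: "deg_le d (xconst c)"
  by (auto simp: deg_le_def xcoeff_xconst)

lemma deg_le_1 [simp]: "deg_le d 1"
  using deg_le_xconst[of d 1] by (simp add: xconst_hom)

lemma deg_le_add: "deg_le d F \<Longrightarrow> deg_le d G \<Longrightarrow> deg_le d (F + G)"
  unfolding deg_le_def xcoeff_simps by (metis add.right_neutral)

lemma deg_le_uminus: "deg_le d F \<Longrightarrow> deg_le d (- F)"
  by (simp add: deg_le_def)

lemma deg_le_mult:
  assumes "deg_le d F" "deg_le e G"
  shows "deg_le (d + e) (F * G)"
  unfolding deg_le_def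
proof (intro allI impI)
  fix m assume "xcoeff (F * G) m \<noteq> 0"
  then obtain a b where "m = a + b" "xcoeff F a \<noteq> 0" "xcoeff G b \<noteq> 0"
    by (rule xcoeff_mult_nonzero)
  then show "xdeg m \<le> d + e"
    using assms by (simp add: deg_le_def add_mono)
qed

lemma deg_le_D: "deg_le d F \<Longrightarrow> deg_le d (D k F)"
  by (fastforce simp: deg_le_def)

lemma D_eq_0_deg_le: "deg_le d F \<Longrightarrow> d < k \<Longrightarrow> D k F = 0"
  by (rule xseries_eqI) (fastforce simp: deg_le_def)

definition bdeg :: "ser \<Rightarrow> bool" where "bdeg F \<longleftrightarrow> (\<exists>d. deg_le d F)"

lemma bdeg_simps [simp]:
  "bdeg 0" "bdeg 1" "bdeg (xconst c)" "bdeg F \<Longrightarrow> bdeg (D k F)" "bdeg F \<Longrightarrow> bdeg (- F)"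
  by (auto simp: bdeg_def deg_le_D deg_le_uminus intro: deg_le_D deg_le_uminus)

lemma bdeg_add [simp]: "bdeg F \<Longrightarrow> bdeg G \<Longrightarrow> bdeg (F + G)"
proof -
  assume "bdeg F" "bdeg G"
  then obtain d e where "deg_le d F" "deg_le e G" by (auto simp: bdeg_def)
  then have "deg_le (max d e) (F + G)"
    by (intro deg_le_add) (auto elim: deg_le_mono)
  then show "bdeg (F + G)" by (auto simp: bdeg_def)
qed

lemma bdeg_diff [simp]: "bdeg F \<Longrightarrow> bdeg G \<Longrightarrow> bdeg (F - G)"
  using bdeg_add[of F "- G"] by simp

lemma bdeg_mult [simp]: "bdeg F \<Longrightarrow> bdeg G \<Longrightarrow> bdeg (F * G)"
  unfolding bdeg_def using deg_le_mult by blast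

lemma bdeg_sum [simp]: "(\<And>i. i \<in> I \<Longrightarrow> bdeg (F i)) \<Longrightarrow> bdeg (\<Sum>i\<in>I. F i)"
  by (induction I rule: infinite_finite_induct) auto

lemma bdeg_prod [simp]: "(\<And>i. i \<in> I \<Longrightarrow> bdeg (F i)) \<Longrightarrow> bdeg (\<Prod>i\<in>I. F i)"
  by (induction I rule: infinite_finite_induct) auto

lemma bdeg_power [simp]: "bdeg F \<Longrightarrow> bdeg (F ^ k)"
  by (induction k) auto

lemma LambdaZ_iff: "F \<in> LambdaZ \<longleftrightarrow> symmetric_series F \<and> bdeg F"
  by (simp add: LambdaZ_def bounded_degree_iff bdeg_def)

lemma LambdaZ_closed [simp]:
  "0 \<in> LambdaZ" "1 \<in> LambdaZ" "xconst c \<in> LambdaZ"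
  "F \<in> LambdaZ \<Longrightarrow> - F \<in> LambdaZ" "F \<in> LambdaZ \<Longrightarrow> D k F \<in> LambdaZ"
  "F \<in> LambdaZ \<Longrightarrow> G \<in> LambdaZ \<Longrightarrow> F + G \<in> LambdaZ"
  "F \<in> LambdaZ \<Longrightarrow> G \<in> LambdaZ \<Longrightarrow> F - G \<in> LambdaZ"
  "F \<in> LambdaZ \<Longrightarrow> G \<in> LambdaZ \<Longrightarrow> F * G \<in> LambdaZ"
  by (auto simp: LambdaZ_iff)

lemma LambdaZ_sum [simp]: "(\<And>i. i \<in> I \<Longrightarrow> F i \<in> LambdaZ) \<Longrightarrow> (\<Sum>i\<in>I. F i) \<in> LambdaZ"
  by (auto simp: LambdaZ_iff)

lemma LambdaZ_symmetric [simp]: "F \<in> LambdaZ \<Longrightarrow> symmetric_series F"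
  by (simp add: LambdaZ_iff)

text \<open>Agreement in all degrees up to \<open>d\<close> is expressed by \<open>deg_gt d (F - G)\<close>.\<close>

definition deg_gt :: "nat \<Rightarrow> ser \<Rightarrow> bool"
  where "deg_gt d F \<longleftrightarrow> (\<forall>m. xdeg m \<le> d \<longrightarrow> xcoeff F m = 0)"

definition xtrunc :: "nat \<Rightarrow> ser \<Rightarrow> ser"
  where "xtrunc d F = XSeries (\<lambda>m. if xdeg m \<le> d then xcoeff F m else 0)"

lemma xtrunc_LambdaZ [simp]: "symmetric_series F \<Longrightarrow> xtrunc d F \<in> LambdaZ"
  by (auto simp: LambdaZ_iff bdeg_def deg_le_def xtrunc_def symmetric_series_def xdeg_map_key)

lemma deg_gt_xtrunc: "deg_gt d (F - xtrunc d F)"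
  by (simp add: deg_gt_def xtrunc_def)

lemma deg_gt_mult:
  assumes "deg_gt d F"
  shows "deg_gt d (F * G)" "deg_gt d (G * F)"
proof -
  show "deg_gt d (F * G)"
    unfolding deg_gt_def
  proof (intro allI impI)
    fix m assume m: "xdeg m \<le> d"
    show "xcoeff (F * G) m = 0"
      unfolding xcoeff_mult
    proof (rule sum.neutral, clarify)
      fix a b assume "m = a + b"
      then show "xcoeff F a * xcoeff G b = 0"
        using m assms by (simp add: deg_gt_def)
    qed
  qed
  then show "deg_gt d (G * F)" by (simp add: mult.commute)
qed

text \<open>With infinitely many variables, every monomial misses some \<open>x_n\<close>. A cyclic
  permutation brings this absent variable to position 0 and turns m into \<open>xcons 0 m\<close>.
  In plethystic terms this is F[X + 0] = F.\<close>

lemma symmetric_series_D0 [simp]: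
  assumes "symmetric_series F"
  shows "D 0 F = F"
proof (rule xseries_eqI)
  fix m :: xmon
  obtain n where n: "keys m \<subseteq> {..<n}"
    using finite_nat_iff_bounded[of "keys m"] by auto
  define \<pi> where "\<pi> i = (if i = 0 then n else if i \<le> n then i - 1 else i)" for i
  have "bij \<pi>"
    by (rule o_bij[of "\<lambda>i. if i = n then 0 else if i < n then i + 1 else i"])
       (auto simp: \<pi>_def fun_eq_iff)
  moreover have "map_key \<pi> m = xcons 0 m"
  proof (rule poly_mapping_eqI)
    fix i
    have "lookup m n = 0" "\<And>j. j \<ge> n \<Longrightarrow> lookup m j = 0"
      using n by (auto simp: in_keys_iff subset_iff) 
    then show "lookup (map_key \<pi> m) i = lookup (xcons 0 m) i"
      using \<open>bij \<pi>\<close> by (auto simp: map_key.rep_eq bij_is_inj \<pi>_def lookup_xcons split: nat.splits)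
  qed
  ultimately show "xcoeff (D 0 F) m = xcoeff F m"
    using symmetric_seriesD[OF assms, of \<pi> m] by simp
qed

lemma xcoeff_complete_hom [simp]:
  "xcoeff (hc k) m = (if int (xdeg m) = k then 1 else 0)"
  by (simp add: complete_hom_def)

lemma complete_hom_LambdaZ [simp]: "hc k \<in> LambdaZ"
proof -
  have "deg_le (nat k) (hc k)"
    by (auto simp: deg_le_def split: if_splits)
  moreover have "symmetric_series (hc k)"
    by (rule symmetric_series_degreeI[where f = "\<lambda>d. if int d = k then 1 else 0"]) simp
  ultimately show ?thesis
    by (auto simp: LambdaZ_iff bdeg_def)
qed

lemma complete_hom_simps [simp]: "hc 0 = 1" "k < 0 \<Longrightarrow> hc k = 0"
  by (auto intro!: xseries_eqI simp: xcoeff_one)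

lemma D_complete_hom [simp]: "D j (hc k) = hc (k - int j)"
  by (rule xseries_eqI) (auto simp: algebra_simps)


section \<open>Coordinates with respect to the Schur functions\<close>

definition xmonom :: "xmon \<Rightarrow> ser"
  where "xmonom a = XSeries (\<lambda>m. if m = a then 1 else 0)"

lemma xcoeff_xmonom [simp]: "xcoeff (xmonom a) m = (if m = a then 1 else 0)"
  by (simp add: xmonom_def)

lemma xcoeff_xmonom_mult: "xcoeff (xmonom a * F) (a + b) = xcoeff F b"
proof -
  have "xcoeff (xmonom a * F) (a + b) =
      (\<Sum>p\<in>{(c, d). c + d = a + b}. if p = (a, b) then xcoeff F b else 0)"
    unfolding xcoeff_mult by (rule sum.cong) (auto split: if_splits)
  also have "\<dots> = xcoeff F b"
    by (subst sum.delta) auto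
  finally show ?thesis .
qed

lemma xcoeff_xmonom_mult_0:
  assumes "\<And>b. m \<noteq> a + b"
  shows "xcoeff (xmonom a * F) m = 0"
  unfolding xcoeff_mult
proof (rule sum.neutral, clarify)
  fix c d assume "m = c + d"
  with assms have "c \<noteq> a" by auto
  then show "xcoeff (xmonom a) c * xcoeff F d = 0" by simp
qed

lemma xmonom_add: "xmonom (a + b) = xmonom a * xmonom b"
proof (rule xseries_eqI)
  fix m
  show "xcoeff (xmonom (a + b)) m = xcoeff (xmonom a * xmonom b) m"
  proof (cases "\<exists>c. m = a + c")
    case True
    then obtain c where "m = a + c" by blast
    then show ?thesis by (simp add: xcoeff_xmonom_mult)
  next
    case False
    then show ?thesis using xcoeff_xmonom_mult_0[of m a] by auto
  qed
qed

lemma xmonom_0: "xmonom 0 = 1"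
  by (rule xseries_eqI) (simp add: xcoeff_one)

lemma xmonom_sum: "xmonom (\<Sum>i\<in>I. g i) = (\<Prod>i\<in>I. xmonom (g i))"
  by (induction I rule: infinite_finite_induct) (auto simp: xmonom_0 xmonom_add)

lemma xcoeff_of_int_mult [simp]: "xcoeff (of_int z * F) m = of_int z * xcoeff (F :: ser) m"
proof -
  have nat: "xcoeff (of_nat k * F) m = of_nat k * xcoeff F m" for k
    by (induction k) (simp_all add: algebra_simps)
  show ?thesis
    by (cases z rule: int_cases2) (simp_all add: nat)
qed

definition xm :: "nat \<Rightarrow> (nat \<Rightarrow> nat) \<Rightarrow> xmon"
  where "xm n f = (\<Sum>i<n. single i (f i))"

lemma lookup_xm [simp]: "lookup (xm n f) i = (if i < n then f i else 0)"
proof -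
  have "lookup (xm n f) i = (\<Sum>j<n. if j = i then f j else 0)"
    unfolding xm_def lookup_sum by (rule sum.cong) (auto simp: lookup_single)
  then show ?thesis by simp
qed

lemma keys_xm: "keys (xm n f) \<subseteq> {..<n}"
  by (auto simp: in_keys_iff split: if_splits)

lemma xdeg_xm: "xdeg (xm n f) = (\<Sum>i<n. f i)"
  by (subst xdeg_eq_sum[of "{..<n}"]) (auto simp: keys_xm intro!: sum.cong)

section \<open>Alternants and the functional for Schur coordinates\<close>

text \<open>The alternant \<open>a_(\<alpha>+\<delta>)\<close> with \<delta> = (n-1, ..., 1, 0);
  \<alpha> = 0 gives the Vandermonde determinant \<open>a_\<delta>\<close>.\<close>

definition alt :: "nat \<Rightarrow> (nat \<Rightarrow> nat) \<Rightarrow> ser"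
  where "alt n \<alpha> = det (mat n n (\<lambda>(i, j). xmonom (single i (\<alpha> j + (n - 1 - j)))))"

lemma alt_expand:
  "alt n \<alpha> = (\<Sum>p | p permutes {0..<n}. signof p * xmonom (xm n (\<lambda>i. \<alpha> (p i) + (n - 1 - p i))))"
proof -
  have "p i < n" if "p permutes {0..<n}" "i < n" for p i
    using permutes_in_image[OF that(1), of i] that(2) by simp
  then show ?thesis
    unfolding alt_def det_def xm_def xmonom_sum
    by (auto simp: atLeast0LessThan intro!: sum.cong prod.cong)
qed

text \<open>
  The coefficient functional that reads off the coordinate at \<open>s\<^sub>\<alpha>\<close>, by the bialternant formula
  \<open>s\<^sub>\<alpha> \<cdot> a\<^sub>\<delta> = a\<^sub>\<alpha>\<^sub>+\<^sub>\<delta>\<close> in \<open>n\<close> variables.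
\<close>

definition phi :: "nat \<Rightarrow> (nat \<Rightarrow> nat) \<Rightarrow> ser \<Rightarrow> laurent"
  where "phi n \<alpha> F = xcoeff (alt n (\<lambda>_. 0) * F) (xm n (\<lambda>i. \<alpha> i + (n - 1 - i)))"

text \<open>Each term of the Vandermonde determinant is a signed monomial and only shifts
  coefficients: \<alpha> + \<delta> minus the permuted \<delta> has entries
  \<open>\<alpha> i + p i - i\<close>, and nothing is contributed if an entry would be negative. The
  result has the shape of the Jacobi-Trudi expansion with monomials in place of products of complete
  functions, which \<open>scoef_hl\<close> exploits.\<close>

lemma phi_expand:
  "phi n \<alpha> F = (\<Sum>p | p permutes {0..<n}. signof p *
     (if \<forall>i<n. i \<le> \<alpha> i + p i then xcoeff F (xm n (\<lambda>i. \<alpha> i + p i - i)) else 0))"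
proof -
  let ?b = "xm n (\<lambda>i. \<alpha> i + (n - 1 - i))"
  have "xcoeff (xmonom (xm n (\<lambda>i. n - 1 - p i)) * F) ?b =
      (if \<forall>i<n. i \<le> \<alpha> i + p i then xcoeff F (xm n (\<lambda>i. \<alpha> i + p i - i)) else 0)"
    if p: "p permutes {0..<n}" for p
  proof -
    have pn: "p i < n" if "i < n" for i
      using permutes_in_image[OF p, of i] that by simp
    show ?thesis
    proof (cases "\<forall>i<n. i \<le> \<alpha> i + p i")
      case True
      have "?b = xm n (\<lambda>i. n - 1 - p i) + xm n (\<lambda>i. \<alpha> i + p i - i)"
      proof (rule poly_mapping_eqI)
        fix i show "lookup ?b i = lookup (xm n (\<lambda>i. n - 1 - p i) + xm n (\<lambda>i. \<alpha> i + p i - i)) i"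
          using True pn[of i] by (auto simp: lookup_add)
      qed
      then show ?thesis
        using True by (simp add: xcoeff_xmonom_mult)
    next
      case False
      then obtain i where i: "i < n" "\<alpha> i + p i < i" by auto
      have neq: "?b \<noteq> xm n (\<lambda>i. n - 1 - p i) + c" for c
      proof
        assume "?b = xm n (\<lambda>i. n - 1 - p i) + c"
        then have "lookup ?b i = n - 1 - p i + lookup c i"
          using i by (simp add: lookup_add)
        then show False using i pn[of i] by simp
      qed
      show ?thesis
        unfolding xcoeff_xmonom_mult_0[OF neq] using False by auto
    qed
  qed
  note coef = this
  have "phi n \<alpha> F = (\<Sum>p | p permutes {0..<n}. signof p * xcoeff (xmonom (xm n (\<lambda>i. n - 1 - p i)) * F) ?b)"
    unfolding phi_def alt_expand by (simp add: sum_distrib_right mult.assoc)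
  also have "\<dots> = (\<Sum>p | p permutes {0..<n}. signof p *
     (if \<forall>i<n. i \<le> \<alpha> i + p i then xcoeff F (xm n (\<lambda>i. \<alpha> i + p i - i)) else 0))"
    by (intro sum.cong refl arg_cong2[where f = "(*)"] coef) simp
  finally show ?thesis .
qed

lemma phi_linear:
  "phi n \<alpha> 0 = 0" "phi n \<alpha> (F + G) = phi n \<alpha> F + phi n \<alpha> G" "phi n \<alpha> (F - G) = phi n \<alpha> F - phi n \<alpha> G"
  "phi n \<alpha> (xconst c * F) = c * phi n \<alpha> F"
proof -
  have "xcoeff (A * (xconst c * F)) m = c * xcoeff (A * F) m" for A m
    using xcoeff_xconst_mult[of c "A * F" m] by (simp add: mult.left_commute)
  then show "phi n \<alpha> (xconst c * F) = c * phi n \<alpha> F"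
    by (simp add: phi_def)
qed (simp_all add: phi_def algebra_simps)

lemma phi_sum: "phi n \<alpha> (\<Sum>i\<in>I. F i) = (\<Sum>i\<in>I. phi n \<alpha> (F i))"
  by (induction I rule: infinite_finite_induct) (auto simp: phi_linear)

lemma sum_permuted_shift:
  assumes p: "p permutes {0..<n}" and le: "\<forall>i<n. i \<le> \<alpha> i + p i"
  shows "(\<Sum>i<n. \<alpha> i + p i - i) = (\<Sum>i<n. \<alpha> i :: nat)"
proof -
  have "(\<Sum>i<n. p i) = (\<Sum>i<n. i)"
    using sum.permute[OF p, of "\<lambda>i. i"] by (simp add: atLeast0LessThan comp_def)
  moreover have "(\<Sum>i<n. \<alpha> i + p i - i) + (\<Sum>i<n. i) = (\<Sum>i<n. \<alpha> i + p i)"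
    unfolding sum.distrib[symmetric] using le by (intro sum.cong) auto
  ultimately show ?thesis
    by (simp add: sum.distrib)
qed

lemma phi_cong:
  assumes "\<And>m. xdeg m = (\<Sum>i<n. \<alpha> i) \<Longrightarrow> xcoeff F m = xcoeff G m"
  shows "phi n \<alpha> F = phi n \<alpha> G"
  unfolding phi_expand
  by (intro sum.cong refl arg_cong2[where f = "(*)"])
     (auto simp: xdeg_xm sum_permuted_shift intro!: assms)

section \<open>Restriction to the first n variables\<close>

definition restr :: "nat \<Rightarrow> ser \<Rightarrow> ser"
  where "restr n F = XSeries (\<lambda>m. if keys m \<subseteq> {..<n} then xcoeff F m else 0)"

lemma xcoeff_restr [simp]: "xcoeff (restr n F) m = (if keys m \<subseteq> {..<n} then xcoeff F m else 0)"
  by (simp add: restr_def)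

lemma keys_add_xmon: "keys (a + b :: xmon) = keys a \<union> keys b"
  by (auto simp: in_keys_iff lookup_add)

interpretation restr: comm_ring_hom "restr n" for n
proof
  fix F G :: ser
  show "restr n (F + G) = restr n F + restr n G" "restr n 0 = 0" "restr n 1 = 1"
    by (auto intro!: xseries_eqI simp: xcoeff_one)
  show "restr n (F * G) = restr n F * restr n G"
  proof (rule xseries_eqI)
    fix m
    have "xcoeff (restr n F) a * xcoeff (restr n G) b =
        (if keys m \<subseteq> {..<n} then xcoeff F a * xcoeff G b else 0)" if "a + b = m" for a b
      using that keys_add_xmon[of a b] by auto
    then have "xcoeff (restr n F * restr n G) m =
        (\<Sum>(a, b) | a + b = m. if keys m \<subseteq> {..<n} then xcoeff F a * xcoeff G b else 0)"
      unfolding xcoeff_mult by (intro sum.cong) auto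
    then show "xcoeff (restr n (F * G)) m = xcoeff (restr n F * restr n G) m"
      by (cases "keys m \<subseteq> {..<n}") (simp_all add: xcoeff_mult case_prod_unfold)
  qed
qed

lemma restr_restr [simp]: "restr n (restr n F) = restr n F"
  by (rule xseries_eqI) simp

text \<open>The target exponent lies in the first n variables, and so do the parts of all its
  splittings; coefficients of F elsewhere never enter.\<close>

lemma phi_restr: "phi n \<alpha> (restr n F) = phi n \<alpha> F"
proof -
  have "xcoeff (A * F) m = xcoeff (A * restr n F) m" if "keys m \<subseteq> {..<n}" for A m
  proof -
    have "xcoeff (restr n (A * F)) m = xcoeff (restr n (A * restr n F)) m"
      by (simp add: restr.hom_mult)
    then show ?thesis using that by simp
  qed
  then show ?thesis
    by (simp add: phi_def keys_xm)
qed

section \<open>The bialternant formula\<close>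

text \<open>The generating series of the complete functions in the variables indexed by S, that is,
  the product of the 1/(1 - x_i t).\<close>

definition hS :: "nat set \<Rightarrow> ser fps"
  where "hS S = Abs_fps (\<lambda>l. XSeries (\<lambda>m. if keys m \<subseteq> S \<and> xdeg m = l then 1 else 0))"

lemma xcoeff_hS [simp]: "xcoeff (fps_nth (hS S) l) m = (if keys m \<subseteq> S \<and> xdeg m = l then 1 else 0)"
  by (simp add: hS_def)

abbreviation xvar :: "nat \<Rightarrow> ser" where "xvar i \<equiv> xmonom (single i 1)"

lemma xdeg_single [simp]: "xdeg (single i k) = k"
  by (auto simp: xdeg_def)

text \<open>Subtracting \<open>x_i t\<close> times the series removes exactly the monomials
  divisible by \<open>x_i\<close>.\<close>

lemma hS_remove:
  assumes "i \<in> S"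
  shows "(1 - fps_const (xvar i) * fps_X) * hS S = hS (S - {i})"
proof (rule fps_ext)
  fix l
  have "xcoeff (xvar i * fps_nth (hS S) k) m =
      (if i \<in> keys m \<and> keys m \<subseteq> S \<and> xdeg m = Suc k then 1 else 0)" for k m
  proof (cases "i \<in> keys m")
    case True
    then have l1: "lookup m i \<ge> 1" by (simp add: in_keys_iff)
    define b where "b = m - single i 1"
    have m: "m = single i 1 + b"
      by (rule poly_mapping_eqI)
         (use l1 in \<open>auto simp: b_def lookup_add lookup_minus lookup_single when_def\<close>)
    have "keys m = insert i (keys b)"
      unfolding m keys_add_xmon by simp
    moreover have "xdeg m = Suc (xdeg b)"
      unfolding m by simp
    moreover have "xcoeff (xvar i * fps_nth (hS S) k) m = xcoeff (fps_nth (hS S) k) b"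
      unfolding m by (rule xcoeff_xmonom_mult)
    ultimately show ?thesis
      using assms by auto
  next
    case False
    have "m \<noteq> single i 1 + b" for b
      using False by (auto simp: keys_add_xmon)
    from xcoeff_xmonom_mult_0[OF this] show ?thesis
      using False by simp
  qed
  then show "fps_nth ((1 - fps_const (xvar i) * fps_X) * hS S) l = fps_nth (hS (S - {i})) l"
    by (cases l) (auto intro!: xseries_eqI simp: algebra_simps fps_X_mult_nth mult.assoc)
qed

lemma hS_remove_prod:
  assumes "finite T" "T \<subseteq> S"
  shows "(\<Prod>i\<in>T. 1 - fps_const (xvar i) * fps_X) * hS S = hS (S - T)"
  using assms
proof (induction T)
  case (insert i T)
  have "(\<Prod>j\<in>insert i T. 1 - fps_const (xvar j) * fps_X) * hS S
      = (1 - fps_const (xvar i) * fps_X) * hS (S - T)"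
    using insert by (simp add: mult.assoc)
  also have "\<dots> = hS (S - T - {i})"
    using insert by (intro hS_remove) auto
  also have "S - T - {i} = S - insert i T" by auto
  finally show ?case .
qed simp

lemma fps_nth_prod_linear_eq_0:
  fixes c :: "'a \<Rightarrow> 'b::comm_ring_1"
  assumes "finite T" "card T < j"
  shows "fps_nth (\<Prod>i\<in>T. 1 - fps_const (c i) * fps_X) j = 0"
  using assms
proof (induction T arbitrary: j)
  case (insert i T)
  then obtain k where k: "j = Suc k" "card T < k" by (cases j) auto
  have "fps_nth ((1 - fps_const (c i) * fps_X) * (\<Prod>j\<in>T. 1 - fps_const (c j) * fps_X)) j = 0"
    using insert.IH[of j] insert.IH[of k] k
    by (simp add: left_diff_distrib fps_X_mult_nth mult.assoc)
  then show ?case using insert by simp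
qed simp

definition schurN :: "nat \<Rightarrow> (nat \<Rightarrow> nat) \<Rightarrow> ser"
  where "schurN n \<alpha> = det (mat n n (\<lambda>(i, j). hc (int (\<alpha> i) - int i + int j)))"

lemma restr_complete_hom: "restr n (hc (int l)) = fps_nth (hS {..<n}) l"
  by (rule xseries_eqI) auto

text \<open>Let \<open>E k\<close> be the product of the 1 - x_i t over i < n other than k. Its
  product with the generating series of the complete functions in n variables is 1/(1 - x_k t). Read
  coefficientwise, the Jacobi-Trudi matrix H times the matrix M of coefficients of the
  \<open>E k\<close> is the matrix of powers \<open>x_k^(\<alpha>_i + n-1-i)\<close>, so det H det M
  is the alternant. For \<alpha> = 0 the matrix H is unitriangular, which identifies det M as the
  Vandermonde determinant.\<close>

lemma schurN_times_alt: "restr n (schurN n \<alpha>) * alt n (\<lambda>_. 0) = alt n \<alpha>"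
proof -
  define E where "E k = (\<Prod>i\<in>{..<n} - {k}. 1 - fps_const (xvar i) * fps_X)" for k
  define H where "H \<alpha> = mat n n (\<lambda>(i, j). restr n (hc (int (\<alpha> i) - int i + int j)))"
    for \<alpha> :: "nat \<Rightarrow> nat"
  define M where "M = mat n n (\<lambda>(j, k). fps_nth (E k) (n - 1 - j))"
  have carr: "H \<alpha> \<in> carrier_mat n n" "M \<in> carrier_mat n n" for \<alpha>
    by (simp_all add: H_def M_def)
  have E0: "fps_nth (E k) j = 0" if "k < n" "j \<ge> n" for j k
    unfolding E_def by (rule fps_nth_prod_linear_eq_0) (use that in auto)
  have EH: "E k * hS {..<n} = hS {k}" if "k < n" for k
    unfolding E_def by (subst hS_remove_prod) (use that in \<open>auto intro!: arg_cong[of _ _ hS]\<close>)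
  have hk: "fps_nth (hS {k}) l = xmonom (single k l)" for k l
  proof (rule xseries_eqI)
    fix m
    have "keys m \<subseteq> {k} \<and> xdeg m = l \<longleftrightarrow> m = single k l"
    proof
      assume m: "keys m \<subseteq> {k} \<and> xdeg m = l"
      then have "xdeg m = lookup m k"
        by (subst xdeg_eq_sum[of "{k}"]) auto
      show "m = single k l"
      proof (rule poly_mapping_eqI)
        fix i show "lookup m i = lookup (single k l) i"
          using m \<open>xdeg m = lookup m k\<close> by (cases "i = k") (auto simp: in_keys_iff lookup_single)
      qed
    qed (auto simp: xdeg_single)
    then show "xcoeff (fps_nth (hS {k}) l) m = xcoeff (xmonom (single k l)) m"
      by simp
  qed
  have entry: "(\<Sum>j<n. restr n (hc (int (\<alpha> i) - int i + int j)) * fps_nth (E k) (n - 1 - j))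
      = xmonom (single k (\<alpha> i + (n - 1 - i)))" if "i < n" "k < n" for i k \<alpha>
  proof -
    let ?l = "\<alpha> i + (n - 1 - i)"
    let ?f = "\<lambda>j. fps_nth (E k) j * restr n (hc (int ?l - int j))"
    have "(\<Sum>j<n. restr n (hc (int (\<alpha> i) - int i + int j)) * fps_nth (E k) (n - 1 - j))
        = (\<Sum>j<n. ?f (n - Suc j))"
      using that by (intro sum.cong) (auto simp: algebra_simps of_nat_diff)
    also have "\<dots> = (\<Sum>j<n. ?f j)"
      by (rule sum.nat_diff_reindex)
    \<comment> \<open>\<open>E k\<close> has degree below n in t, and complete functions of negative
      index vanish, so the range of summation may be exchanged for that of a Cauchy product.\<close>
    also have "\<dots> = (\<Sum>j\<in>{..<n} \<union> {..?l}. ?f j)"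
      by (rule sum.mono_neutral_left) (auto simp: E0 that)
    also have "\<dots> = (\<Sum>j\<le>?l. ?f j)"
      by (rule sum.mono_neutral_right) auto
    also have "\<dots> = (\<Sum>j\<le>?l. fps_nth (E k) j * fps_nth (hS {..<n}) (?l - j))"
    proof (rule sum.cong[OF refl])
      fix j assume "j \<in> {..?l}"
      then have "int ?l - int j = int (?l - j)" by simp
      then show "?f j = fps_nth (E k) j * fps_nth (hS {..<n}) (?l - j)"
        by (simp only: restr_complete_hom)
    qed
    also have "\<dots> = fps_nth (E k * hS {..<n}) ?l"
      by (simp add: fps_mult_nth atLeast0AtMost)
    also have "\<dots> = xmonom (single k ?l)"
      by (simp add: EH hk that)
    finally show ?thesis .
  qed
  have HM: "det (H \<alpha>) * det M = alt n \<alpha>" for \<alpha>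
  proof -
    let ?A = "transpose_mat (mat n n (\<lambda>(i, j). xmonom (single i (\<alpha> j + (n - 1 - j)))))"
    have "H \<alpha> * M = ?A"
    proof (rule eq_matI)
      fix i k assume "i < dim_row ?A"
        "k < dim_col (?A)"
      then have ik: "i < n" "k < n" by simp_all
      then have "(H \<alpha> * M) $$ (i, k) =
          (\<Sum>j<n. restr n (hc (int (\<alpha> i) - int i + int j)) * fps_nth (E k) (n - 1 - j))"
        by (simp add: H_def M_def scalar_prod_def atLeast0LessThan)
      also note entry[OF ik]
      finally show "(H \<alpha> * M) $$ (i, k) =
          ?A $$ (i, k)"
        using ik by simp
    qed (simp_all add: H_def M_def)
    then have "det (H \<alpha>) * det M =
        det (?A)"
      using det_mult[OF carr, of \<alpha>] by simp
    also have "\<dots> = alt n \<alpha>"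
      unfolding alt_def by (rule det_transpose[OF mat_carrier])
    finally show ?thesis .
  qed
  have H1: "det (H (\<lambda>_. 0)) = 1"
  proof -
    have "det (H (\<lambda>_. 0)) = prod_list (diag_mat (H (\<lambda>_. 0)))"
      by (rule det_upper_triangular[OF _ carr(1)]) (auto simp: upper_triangular_def H_def)
    also have "\<dots> = 1"
      by (simp add: prod_list_diag_prod H_def)
    finally show ?thesis .
  qed
  have "restr n (schurN n \<alpha>) = det (H \<alpha>)"
    unfolding schurN_def restr.hom_det[symmetric]
    by (rule arg_cong[of _ _ det]) (auto simp: H_def intro!: eq_matI)
  moreover have "det M = alt n (\<lambda>_. 0)"
    using HM[of "\<lambda>_. 0"] H1 by simp
  ultimately show ?thesis
    using HM[of \<alpha>] by simp
qed

lemma permutes_strict_mono_id: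
  fixes p :: "nat \<Rightarrow> nat"
  assumes p: "p permutes {0..<n}" and mono: "\<And>i j. i < j \<Longrightarrow> j < n \<Longrightarrow> p i < p j"
  shows "p = id"
proof (rule permutes_natset_ge[OF p], rule ballI)
  fix i assume "i \<in> {0..<n}"
  then show "i \<le> p i"
  proof (induction i)
    case (Suc i)
    then show ?case using mono[of i "Suc i"] by simp
  qed simp
qed

text \<open>The bialternant formula turns the left-hand side into a coefficient of an alternant.
  Both \<alpha> + \<delta> and \<beta> + \<delta> are strictly decreasing, so a permutation carrying
  one to the other is increasing, hence the identity.\<close>

lemma phi_schurN:
  assumes a: "\<And>i j. i \<le> j \<Longrightarrow> j < n \<Longrightarrow> \<alpha> j \<le> \<alpha> i" and b: "\<And>i j. i \<le> j \<Longrightarrow> j < n \<Longrightarrow> \<beta> j \<le> \<beta> i"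
  shows "phi n \<beta> (schurN n \<alpha>) = (if \<forall>i<n. \<alpha> i = \<beta> i then 1 else 0)"
proof -
  let ?b = "xm n (\<lambda>i. \<beta> i + (n - 1 - i))"
  have "phi n \<beta> (schurN n \<alpha>) = phi n \<beta> (restr n (schurN n \<alpha>))"
    by (rule phi_restr[symmetric])
  also have "\<dots> = xcoeff (alt n \<alpha>) ?b"
    unfolding phi_def using schurN_times_alt[of n \<alpha>] by (simp add: mult.commute)
  also have "\<dots> = (\<Sum>p | p permutes {0..<n}.
      signof p * (if ?b = xm n (\<lambda>i. \<alpha> (p i) + (n - 1 - p i)) then 1 else 0))"
    unfolding alt_expand by simp
  also have "\<dots> = (\<Sum>p | p permutes {0..<n}. if p = id then (if \<forall>i<n. \<alpha> i = \<beta> i then 1 else 0) else 0)"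
  proof (rule sum.cong[OF refl])
    fix p assume "p \<in> {p. p permutes {0..<n}}"
    then have p: "p permutes {0..<n}" by simp
    have pn: "p i < n" if "i < n" for i
      using permutes_in_image[OF p, of i] that by simp
    have eq: "?b = xm n (\<lambda>i. \<alpha> (p i) + (n - 1 - p i)) \<longleftrightarrow>
        (\<forall>i<n. \<beta> i + (n - 1 - i) = \<alpha> (p i) + (n - 1 - p i))"
      by (auto simp: poly_mapping_eq_iff fun_eq_iff)
    have id: "p = id" if h: "\<forall>i<n. \<beta> i + (n - 1 - i) = \<alpha> (p i) + (n - 1 - p i)"
    proof (rule permutes_strict_mono_id[OF p])
      fix i j :: nat assume ij: "i < j" "j < n"
      have "\<beta> j + (n - 1 - j) < \<beta> i + (n - 1 - i)"
        using b[of i j] ij by simp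
      then have lt: "\<alpha> (p j) + (n - 1 - p j) < \<alpha> (p i) + (n - 1 - p i)"
        using h ij by simp
      show "p i < p j"
      proof (rule ccontr)
        assume "\<not> p i < p j"
        then show False
          using lt a[of "p j" "p i"] pn[of i] pn[of j] ij by simp
      qed
    qed
    show "signof p * (if ?b = xm n (\<lambda>i. \<alpha> (p i) + (n - 1 - p i)) then 1 else 0)
        = (if p = id then (if \<forall>i<n. \<alpha> i = \<beta> i then 1 else 0) else (0::laurent))"
    proof (cases "p = id")
      case True
      then have "(\<forall>i<n. \<beta> i + (n - 1 - i) = \<alpha> (p i) + (n - 1 - p i)) \<longleftrightarrow> (\<forall>i<n. \<alpha> i = \<beta> i)"
        by auto
      then show ?thesis unfolding eq using True by simp
    next
      case False
      then show ?thesis unfolding eq using id by auto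
    qed
  qed
  also have "\<dots> = (if \<forall>i<n. \<alpha> i = \<beta> i then 1 else 0)"
    by (subst sum.delta) (auto simp: finite_permutations permutes_id)
  finally show ?thesis .
qed

text \<open>The weight \<open>\<Sum> i m\<^sub>i\<close>, whose minimum over an orbit is attained at the decreasing monomial.\<close>

definition xweight :: "xmon \<Rightarrow> nat"
  where "xweight m = (\<Sum>i\<in>keys m. i * lookup m i)"

lemma xweight_eq_sum: "finite A \<Longrightarrow> keys m \<subseteq> A \<Longrightarrow> xweight m = (\<Sum>i\<in>A. i * lookup m i)"
  unfolding xweight_def by (rule sum.mono_neutral_left) (auto simp: in_keys_iff)

text \<open>Rearrangement: the weight changes by the sum of i p(i) minus the sum of i^2, which is
  negative because the sum of (i - p(i))^2 is positive and p permutes the squares.\<close>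

lemma xweight_permuted:
  assumes p: "p permutes {0..<n}" "p \<noteq> id" and le: "\<forall>i<n. i \<le> \<alpha> i + p i"
  shows "xweight (xm n (\<lambda>i. \<alpha> i + p i - i)) < xweight (xm n \<alpha>)"
proof -
  have w: "int (xweight (xm n f)) = (\<Sum>i<n. int i * int (f i))" for f
    by (subst xweight_eq_sum[of "{..<n}"]) (auto simp: keys_xm intro!: sum.cong)
  have "\<exists>i<n. p i \<noteq> i"
    using p by (metis atLeastLessThan_iff eq_id_iff permutes_not_in)
  then obtain i where i: "i < n" "p i \<noteq> i" by auto
  have "0 < (\<Sum>i<n. (int i - int (p i))\<^sup>2)"
    by (rule sum_pos2[of _ i]) (use i in auto)
  also have "\<dots> = (\<Sum>i<n. (int i)\<^sup>2) + (\<Sum>i<n. (int (p i))\<^sup>2) - 2 * (\<Sum>i<n. int i * int (p i))"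
    by (simp add: power2_diff sum.distrib sum_subtractf sum_distrib_left algebra_simps)
  also have "(\<Sum>i<n. (int (p i))\<^sup>2) = (\<Sum>i<n. (int i)\<^sup>2)"
    using sum.permute[OF p(1), of "\<lambda>i. (int i)\<^sup>2"] by (simp add: atLeast0LessThan comp_def)
  finally have "(\<Sum>i<n. int i * int (p i)) < (\<Sum>i<n. (int i)\<^sup>2)" by simp
  moreover have "(\<Sum>i<n. int i * int (\<alpha> i + p i - i)) =
      (\<Sum>i<n. int i * int (\<alpha> i) + int i * int (p i) - (int i)\<^sup>2)"
    using le by (intro sum.cong) (auto simp: of_nat_diff algebra_simps power2_eq_square)
  ultimately have "int (xweight (xm n (\<lambda>i. \<alpha> i + p i - i))) < int (xweight (xm n \<alpha>))"
    unfolding w by (simp add: sum.distrib sum_subtractf)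
  then show ?thesis by simp
qed

section \<open>Partitions as exponent vectors\<close>

definition pad :: "nat list \<Rightarrow> nat \<Rightarrow> nat"
  where "pad la i = (if i < length la then la ! i else 0)"

lemma pad_antimono: "is_partition la \<Longrightarrow> i \<le> j \<Longrightarrow> pad la j \<le> pad la i"
  by (cases "i = j") (auto simp: is_partition_def pad_def sorted_wrt_iff_nth_less)

lemma pad_inject:
  assumes la: "is_partition la" "is_partition mu" and n: "length la \<le> n" "length mu \<le> n"
    and eq: "\<forall>i<n. pad la i = pad mu i"
  shows "la = mu"
proof -
  have pos: "pad k i > 0 \<longleftrightarrow> i < length k" if "is_partition k" for k i
    using that by (auto simp: is_partition_def pad_def) (metis nth_mem gr0I)
  have len: "length la = length mu"
  proof (rule antisym; rule ccontr)
    assume "\<not> length la \<le> length mu"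
    then show False using pos[OF la(1), of "length mu"] pos[OF la(2), of "length mu"] eq n by auto
  next
    assume "\<not> length mu \<le> length la"
    then show False using pos[OF la(1), of "length la"] pos[OF la(2), of "length la"] eq n by auto
  qed
  show ?thesis
  proof (rule nth_equalityI[OF len])
    fix i assume "i < length la"
    with eq n len show "la ! i = mu ! i"
      by (auto simp: pad_def dest!: spec[of _ i])
  qed
qed

text \<open>The added last row is (0, ..., 0, 1), since complete functions of negative index vanish.
  Padding a partition with zeros thus leaves the Jacobi-Trudi determinant unchanged.\<close>

lemma schurN_Suc:
  assumes "\<alpha> n = 0"
  shows "schurN (Suc n) \<alpha> = schurN n \<alpha>"
proof -
  let ?A = "mat (Suc n) (Suc n) (\<lambda>(i, j). hc (int (\<alpha> i) - int i + int j))"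
  have "det ?A = (\<Sum>j<Suc n. ?A $$ (n, j) * cofactor ?A n j)"
    by (rule laplace_expansion_row) auto
  also have "\<dots> = (\<Sum>j<Suc n. if j = n then cofactor ?A n n else 0)"
    using assms by (intro sum.cong) auto
  also have "\<dots> = det (mat_delete ?A n n)"
    by (simp add: cofactor_def)
  also have "mat_delete ?A n n = mat n n (\<lambda>(i, j). hc (int (\<alpha> i) - int i + int j))"
    by (rule eq_matI) (auto simp: mat_delete_def)
  finally show ?thesis by (simp add: schurN_def)
qed

lemma schur_eq_schurN:
  assumes "length la \<le> n"
  shows "schur la = schurN n (pad la)"
  using assms
proof (induction n rule: dec_induct)
  case base
  show ?case
    unfolding schur_def schurN_def by (rule arg_cong[of _ _ det]) (auto simp: pad_def intro!: eq_matI)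
next
  case (step n)
  then have "pad la n = 0" by (simp add: pad_def)
  from schurN_Suc[where \<alpha> = "pad la" and n = n, OF this] show ?case using step.IH by simp
qed

lemma length_le_sum_list: "is_partition la \<Longrightarrow> length la \<le> sum_list la"
proof (induction la)
  case (Cons a la)
  then have "is_partition la" "a \<ge> 1" by (auto simp: is_partition_def)
  with Cons show ?case by auto
qed simp

lemma phi_schur:
  assumes "is_partition la" "is_partition mu" "length la \<le> n" "length mu \<le> n"
  shows "phi n (pad mu) (schur la) = (if la = mu then 1 else 0)"
  using phi_schurN[of n "pad la" "pad mu"] assms pad_antimono pad_inject[OF assms]
  by (auto simp: schur_eq_schurN)

section \<open>Homogeneity of Schur functions\<close>

text \<open>The degree is an integer because Jacobi-Trudi entries may have negative index; such an
  entry is 0 and counts as homogeneous of that degree.\<close>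

definition homog :: "int \<Rightarrow> ser \<Rightarrow> bool"
  where "homog d F \<longleftrightarrow> (\<forall>m. xcoeff F m \<noteq> 0 \<longrightarrow> int (xdeg m) = d)"

lemma homog_mult:
  assumes "homog d F" "homog e G"
  shows "homog (d + e) (F * G)"
  unfolding homog_def
proof (intro allI impI)
  fix m assume "xcoeff (F * G) m \<noteq> 0"
  then obtain a b where "m = a + b" "xcoeff F a \<noteq> 0" "xcoeff G b \<noteq> 0"
    by (rule xcoeff_mult_nonzero)
  then show "int (xdeg m) = d + e"
    using assms by (auto simp: homog_def)
qed

lemma homog_prod: "finite I \<Longrightarrow> (\<And>i. i \<in> I \<Longrightarrow> homog (d i) (F i)) \<Longrightarrow> homog (\<Sum>i\<in>I. d i) (\<Prod>i\<in>I. F i)"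
proof (induction I rule: finite_induct)
  case empty
  then show ?case by (simp add: homog_def xcoeff_one)
qed (simp add: homog_mult)

lemma homog_sum: "(\<And>i. i \<in> I \<Longrightarrow> homog d (F i)) \<Longrightarrow> homog d (\<Sum>i\<in>I. F i)"
  unfolding homog_def xcoeff_sum by (metis (no_types, lifting) sum.neutral)

lemma schurN_expand:
  "schurN n \<alpha> = (\<Sum>p | p permutes {0..<n}. signof p * (\<Prod>i<n. hc (int (\<alpha> i) - int i + int (p i))))"
proof -
  have "p i < n" if "p permutes {0..<n}" "i < n" for p i
    using permutes_in_image[OF that(1), of i] that(2) by simp
  then show ?thesis
    unfolding schurN_def det_def
    by (auto simp: atLeast0LessThan intro!: sum.cong prod.cong)
qed

lemma sum_list_eq_pad: "length la \<le> n \<Longrightarrow> sum_list la = (\<Sum>i<n. pad la i)"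
proof -
  assume "length la \<le> n"
  have "sum_list la = (\<Sum>i<length la. pad la i)"
    by (simp add: sum_list_sum_nth atLeast0LessThan pad_def)
  also have "\<dots> = (\<Sum>i<n. pad la i)"
    by (rule sum.mono_neutral_left) (use \<open>length la \<le> n\<close> in \<open>auto simp: pad_def\<close>)
  finally show ?thesis .
qed

lemma homog_schurN: "homog (\<Sum>i<n. int (\<alpha> i)) (schurN n \<alpha>)"
  unfolding schurN_expand
proof (rule homog_sum)
  fix p assume "p \<in> {p. p permutes {0..<n}}"
  then have p: "p permutes {0..<n}" by simp
  have "homog (\<Sum>i<n. int (\<alpha> i) - int i + int (p i))
      (\<Prod>i<n. hc (int (\<alpha> i) - int i + int (p i)))"
    by (rule homog_prod) (auto simp: homog_def split: if_splits)
  also have "(\<Sum>i<n. int (\<alpha> i) - int i + int (p i)) = (\<Sum>i<n. int (\<alpha> i))"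
    using sum.permute[OF p, of int]
    by (simp add: atLeast0LessThan comp_def sum.distrib sum_subtractf)
  finally show "homog (\<Sum>i<n. int (\<alpha> i))
      (signof p * (\<Prod>i<n. hc (int (\<alpha> i) - int i + int (p i))))"
    by (auto simp: homog_def)
qed

lemma xcoeff_schur_neq_0: "xcoeff (schur la) m \<noteq> 0 \<Longrightarrow> xdeg m = sum_list la"
  using homog_schurN[where n = "length la" and \<alpha> = "pad la"]
  unfolding homog_def schur_eq_schurN[OF order.refl] sum_list_eq_pad[OF order.refl]
  by (metis of_nat_eq_iff of_nat_sum)

lemma symmetric_series_of_int [simp]: "symmetric_series F \<Longrightarrow> symmetric_series (of_int z * F)"
  by (simp add: symmetric_series_def)

lemma schur_LambdaZ [simp]: "schur la \<in> LambdaZ"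
proof -
  have "symmetric_series (schur la)"
    unfolding schur_eq_schurN[OF order.refl] schurN_expand by simp
  moreover have "deg_le (sum_list la) (schur la)"
    by (auto simp: deg_le_def dest: xcoeff_schur_neq_0)
  ultimately show ?thesis
    by (auto simp: LambdaZ_iff bdeg_def)
qed

section \<open>Triangularity of the coordinate functionals\<close>

lemma map_key_transpose_decreases:
  assumes "lookup m i < lookup m (Suc i)"
  shows "xweight (map_key (Transposition.transpose i (Suc i)) m) < xweight m"
proof -
  let ?t = "Transposition.transpose i (Suc i)"
  let ?m = "map_key ?t m"
  define A where "A = (keys m \<union> keys ?m) - {i, Suc i}"
  have l: "lookup ?m j = lookup m (?t j)" for j
    by (simp add: map_key.rep_eq)
  have fin: "finite A" by (simp add: A_def)
  have w: "xweight k = i * lookup k i + Suc i * lookup k (Suc i) + (\<Sum>j\<in>A. j * lookup k j)"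
    if "keys k \<subseteq> keys m \<union> keys ?m" for k
  proof -
    have "keys k \<subseteq> insert i (insert (Suc i) A)" "i \<notin> A" "Suc i \<notin> A"
      using that by (auto simp: A_def)
    then show ?thesis
      using xweight_eq_sum[of "insert i (insert (Suc i) A)" k] fin by simp
  qed
  have "(\<Sum>j\<in>A. j * lookup ?m j) = (\<Sum>j\<in>A. j * lookup m j)"
    by (rule sum.cong) (auto simp: l A_def Transposition.transpose_def)
  moreover have "lookup ?m i = lookup m (Suc i)" "lookup ?m (Suc i) = lookup m i"
    by (simp_all add: l)
  ultimately show ?thesis
    using w[of m] w[of ?m] assms by simp
qed

lemma decreasing_xmon_partition:
  assumes "\<And>i. lookup m (Suc i) \<le> lookup m i"
  obtains la where "is_partition la" "sum_list la = xdeg m" "lookup m = pad la"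
proof -
  have anti: "lookup m j \<le> lookup m i" if "i \<le> j" for i j
    using lift_Suc_antimono_le[of "lookup m", OF assms that] .
  obtain n where n: "keys m \<subseteq> {..<n}"
    using finite_nat_iff_bounded[of "keys m"] by auto
  define l where "l = (LEAST i. lookup m i = 0)"
  have "lookup m n = 0" using n by (auto simp: in_keys_iff)
  then have l0: "lookup m l = 0" unfolding l_def by (rule LeastI)
  have ge: "lookup m i = 0" if "i \<ge> l" for i
    using anti[OF that] l0 by simp
  have lt: "lookup m i \<noteq> 0" if "i < l" for i
    using that not_less_Least unfolding l_def by blast
  define la where "la = map (lookup m) [0..<l]"
  have "is_partition la"
    using anti by (auto simp: is_partition_def la_def sorted_wrt_iff_nth_less dest!: lt)
  moreover have pad: "lookup m = pad la"
    using ge by (auto simp: fun_eq_iff pad_def la_def)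
  moreover have "sum_list la = xdeg m"
  proof -
    have "xdeg m = (\<Sum>i<l. lookup m i)"
    proof (rule xdeg_eq_sum)
      show "keys m \<subseteq> {..<l}"
        using ge by (metis in_keys_iff leI lessThan_iff subsetI)
    qed simp
    then show ?thesis
      by (simp add: la_def sum_list_sum_nth atLeast0LessThan)
  qed
  ultimately show ?thesis using that by blast
qed

text \<open>A monomial of minimal weight among those of degree d in F has decreasing exponents by
  symmetry, so it is given by a partition. In \<open>phi_expand\<close> at this partition every
  permutation other than the identity leads to a monomial of smaller weight, which does not occur in
  F. The functional therefore returns the coefficient itself, contradicting its vanishing.\<close>

lemma symmetric_eq_0I:
  assumes sym: "symmetric_series F" and phi: "\<And>la. is_partition la \<Longrightarrow> sum_list la = d \<Longrightarrow> phi d (pad la) F = 0"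
    and m: "xdeg m = d"
  shows "xcoeff F m = 0"
proof (rule ccontr)
  assume "xcoeff F m \<noteq> 0"
  let ?P = "\<lambda>m. xdeg m = d \<and> xcoeff F m \<noteq> 0"
  define k where "k = arg_min xweight ?P"
  have k: "?P k" and min: "\<And>k'. ?P k' \<Longrightarrow> xweight k \<le> xweight k'"
    using arg_min_nat_lemma[of ?P m xweight] m \<open>xcoeff F m \<noteq> 0\<close> by (auto simp: k_def)
  have dec: "lookup k (Suc i) \<le> lookup k i" for i
  proof (rule ccontr)
    let ?t = "Transposition.transpose i (Suc i)"
    assume "\<not> lookup k (Suc i) \<le> lookup k i"
    then have "xweight (map_key ?t k) < xweight k"
      by (intro map_key_transpose_decreases) simp
    moreover have "?P (map_key ?t k)"
      using k by (simp add: xdeg_map_key symmetric_seriesD[OF sym])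
    ultimately show False using min[of "map_key ?t k"] by linarith
  qed
  then obtain la where la: "is_partition la" "sum_list la = xdeg k" "lookup k = pad la"
    using decreasing_xmon_partition by blast
  have len: "length la \<le> d"
    using length_le_sum_list[OF la(1)] la(2) k by simp
  have kx: "k = xm d (pad la)"
    using len by (intro poly_mapping_eqI) (auto simp: la(3) pad_def)
  have "phi d (pad la) F = (\<Sum>p | p permutes {0..<d}. if p = id then xcoeff F k else 0)"
    unfolding phi_expand
  proof (rule sum.cong[OF refl])
    fix p assume "p \<in> {p. p permutes {0..<d}}"
    then have p: "p permutes {0..<d}" by simp
    show "signof p * (if \<forall>i<d. i \<le> pad la i + p i then xcoeff F (xm d (\<lambda>i. pad la i + p i - i)) else 0)
        = (if p = id then xcoeff F k else 0)"
    proof (cases "p = id")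
      case True
      then show ?thesis by (simp add: kx)
    next
      case False
      have "xcoeff F (xm d (\<lambda>i. pad la i + p i - i)) = 0" if le: "\<forall>i<d. i \<le> pad la i + p i"
      proof (rule ccontr)
        assume "xcoeff F (xm d (\<lambda>i. pad la i + p i - i)) \<noteq> 0"
        moreover have "xdeg (xm d (\<lambda>i. pad la i + p i - i)) = d"
          using k kx sum_permuted_shift[OF p le] by (simp add: xdeg_xm)
        ultimately have "xweight k \<le> xweight (xm d (\<lambda>i. pad la i + p i - i))"
          by (intro min) simp
        then show False
          using xweight_permuted[OF p False le] kx by simp
      qed
      then show ?thesis using False by simp
    qed
  qed
  also have "\<dots> = xcoeff F k"
    by (subst sum.delta) (auto simp: finite_permutations permutes_id)
  finally show False
    using phi[OF la(1)] la(2) k by simp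
qed

section \<open>The Schur expansion\<close>

abbreviation parts :: "nat \<Rightarrow> nat list set"
  where "parts d \<equiv> {la. is_partition la \<and> sum_list la = d}"

lemma finite_parts [simp]: "finite (parts d)"
proof (rule finite_subset)
  have "length la \<le> d \<and> set la \<subseteq> {..d}" if "is_partition la" "sum_list la = d" for la
    using that length_le_sum_list[of la] by (auto simp: member_le_sum_list)
  then show "parts d \<subseteq> {la. set la \<subseteq> {..d} \<and> length la \<le> d}" by auto
  show "finite {la. set la \<subseteq> {..d} \<and> length la \<le> d}"
    by (rule finite_lists_length_le) simp
qed

text \<open>The explicit candidate for \<open>schur_coeff\<close>. As many variables as the size of
  the partition always suffice, since a partition has at most that many parts.\<close>

definition scoef :: "ser \<Rightarrow> nat list \<Rightarrow> laurent"
  where "scoef F la = (if is_partition la then phi (sum_list la) (pad la) F else 0)"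

lemma scoef_linear:
  "scoef 0 la = 0" "scoef (F + G) la = scoef F la + scoef G la"
  "scoef (F - G) la = scoef F la - scoef G la" "scoef (xconst c * F) la = c * scoef F la"
  by (simp_all add: scoef_def phi_linear)

lemma scoef_sum: "scoef (\<Sum>i\<in>I. F i) la = (\<Sum>i\<in>I. scoef (F i) la)"
  by (simp add: scoef_def phi_sum)

lemma scoef_cong:
  assumes "\<And>m. xdeg m = sum_list la \<Longrightarrow> xcoeff F m = xcoeff G m"
  shows "scoef F la = scoef G la"
proof (cases "is_partition la")
  case True
  then have "(\<Sum>i<sum_list la. pad la i) = sum_list la"
    using sum_list_eq_pad[OF length_le_sum_list] by metis
  then show ?thesis
    using assms by (auto simp: scoef_def intro!: phi_cong)
qed (simp add: scoef_def)

lemma scoef_schur: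
  assumes "is_partition la"
  shows "scoef (schur la) mu = (if la = mu then 1 else 0)"
proof (cases "is_partition mu \<and> sum_list la = sum_list mu")
  case True
  then show ?thesis
    using phi_schur[OF assms, of mu "sum_list mu"] length_le_sum_list[of mu] length_le_sum_list[OF assms]
    by (simp add: scoef_def)
next
  case False
  have "scoef (schur la) mu = scoef 0 mu" if "sum_list la \<noteq> sum_list mu"
    by (rule scoef_cong) (metis that xcoeff_schur_neq_0 xcoeff_simps(1))
  then show ?thesis
    using False assms by (auto simp: scoef_def phi_linear)
qed

theorem schur_expansion:
  assumes "symmetric_series F"
  shows "xcoeff F m = (\<Sum>la\<in>parts (xdeg m). scoef F la * xcoeff (schur la) m)"
proof -
  let ?d = "xdeg m"
  \<comment> \<open>Only the partitions of the degree of m are subtracted, so the sum is finite even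
    when F has unbounded degree; vanishing is claimed in this degree alone.\<close>
  let ?G = "\<Sum>la\<in>parts ?d. xconst (scoef F la) * schur la"
  have "xcoeff (F - ?G) m = 0"
  proof (rule symmetric_eq_0I[of _ ?d])
    show "symmetric_series (F - ?G)"
      using assms by simp
    fix mu assume mu: "is_partition mu" "sum_list mu = ?d"
    have "scoef ?G mu = (\<Sum>la\<in>parts ?d. if la = mu then scoef F la else 0)"
      unfolding scoef_sum scoef_linear by (rule sum.cong) (auto simp: scoef_schur)
    then have "scoef (F - ?G) mu = 0"
      using mu by (simp add: scoef_linear)
    then show "phi ?d (pad mu) (F - ?G) = 0"
      using mu by (simp add: scoef_def)
  qed simp
  then show ?thesis by simp
qed

text \<open>Existence comes from \<open>schur_expansion\<close>, uniqueness from applying the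
  functionals one degree at a time. Together they resolve the definite description in
  \<open>schur_coeff\<close>.\<close>

lemma is_schur_expansion_iff:
  assumes "symmetric_series F"
  shows "is_schur_expansion F a \<longleftrightarrow> a = scoef F"
proof
  assume a: "is_schur_expansion F a"
  show "a = scoef F"
  proof
    fix mu
    show "a mu = scoef F mu"
    proof (cases "is_partition mu")
      case True
      let ?d = "sum_list mu"
      have "scoef F mu = scoef (\<Sum>la\<in>parts ?d. xconst (a la) * schur la) mu"
        using a by (intro scoef_cong) (auto simp: is_schur_expansion_def)
      also have "\<dots> = (\<Sum>la\<in>parts ?d. if la = mu then a la else 0)"
        unfolding scoef_sum scoef_linear by (rule sum.cong) (auto simp: scoef_schur)
      finally show ?thesis using True by simp
    qed (use a in \<open>simp add: is_schur_expansion_def scoef_def\<close>)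
  qed
next
  assume "a = scoef F"
  then show "is_schur_expansion F a"
    using schur_expansion[OF assms] by (auto simp: is_schur_expansion_def scoef_def)
qed

lemma schur_coeff_eq: "symmetric_series F \<Longrightarrow> schur_coeff F = scoef F"
  unfolding schur_coeff_def by (rule the_equality) (auto simp: is_schur_expansion_iff)


section \<open>The scalar product and skewing\<close>

text \<open>Indices are arbitrary compositions, zeros included, rather than partitions: peeling off
  a variable or a factor is then list recursion without sorting.\<close>

definition hl :: "nat list \<Rightarrow> ser"
  where "hl b = prod_list (map (\<lambda>k. hc (int k)) b)"

definition ml :: "nat list \<Rightarrow> xmon"
  where "ml b = foldr xcons b 0"

lemma hl_simps [simp]: "hl [] = 1" "hl (k # b) = hc (int k) * hl b"
  by (simp_all add: hl_def)

lemma ml_simps [simp]: "ml [] = 0" "ml (k # b) = xcons k (ml b)"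
  by (simp_all add: ml_def)

lemma ml_surj: obtains b where "m = ml b"
proof -
  have "\<exists>b. m = ml b"
  proof (induction m rule: xmon_induct)
    case zero
    show ?case by (rule exI[of _ "[]"]) simp
  next
    case (xcons k m)
    then obtain b where "m = ml b" by blast
    then show ?case by (intro exI[of _ "k # b"]) simp
  qed
  then show ?thesis using that by blast
qed

lemma lookup_ml: "lookup (ml b) i = (if i < length b then b ! i else 0)"
  by (induction b arbitrary: i) (auto simp: lookup_xcons nth_Cons split: nat.splits)

lemma ml_map_upt: "ml (map f [0..<n]) = xm n f"
  by (rule poly_mapping_eqI) (simp add: lookup_ml)

lemma hl_map_upt: "hl (map f [0..<n]) = (\<Prod>i<n. hc (int (f i)))"
proof (induction n)
  case (Suc n)
  then show ?case by (simp add: hl_def mult.commute)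
qed simp

lemma hl_LambdaZ [simp]: "hl b \<in> LambdaZ"
  by (induction b) auto

lemma homog_hl: "homog (int (sum_list b)) (hl b)"
proof (induction b)
  case (Cons k b)
  have "homog (int k) (hc (int k))"
    by (simp add: homog_def)
  then show ?case using homog_mult[OF _ Cons] by simp
qed (simp add: homog_def xcoeff_one)

lemma xdeg_ml: "xdeg (ml b) = sum_list b"
  by (induction b) auto

text \<open>
  \<open>spread k f c\<close> is the sum of \<open>f (c - J)\<close> over all vectors \<open>J \<le> c\<close> of weight \<open>k\<close>. Both \<open>h\<^sub>k\<close> acting
  on coefficients and \<open>D k\<close> acting on products of complete symmetric functions have this form,
  whence \<open>[x\<^sup>b] h\<^sub>c = [x\<^sup>c] h\<^sub>b\<close>.
\<close>

fun spread :: "nat \<Rightarrow> (nat list \<Rightarrow> 'a::comm_monoid_add) \<Rightarrow> nat list \<Rightarrow> 'a" where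
  "spread k f [] = (if k = 0 then f [] else 0)"
| "spread k f (l # c) = (\<Sum>j\<le>min k l. spread (k - j) (\<lambda>c'. f ((l - j) # c')) c)"

lemma spread_mult_left: "spread k (\<lambda>c. (a :: 'a::semiring_0) * f c) b = a * spread k f b"
  by (induction b arbitrary: k f) (auto simp: sum_distrib_left)

lemma spread_xcoeff: "xcoeff (spread k f b :: ser) m = spread k (\<lambda>c. xcoeff (f c) m) b"
  by (induction b arbitrary: k f) auto

lemma D_hl: "D k (hl c) = spread k hl c"
proof (induction c arbitrary: k)
  case Nil
  then show ?case by (simp add: D_one)
next
  case (Cons l c)
  have "D k (hl (l # c)) = (\<Sum>j\<le>k. hc (int l - int j) * spread (k - j) hl c)"
    by (simp add: D_mult Cons)
  also have "\<dots> = (\<Sum>j\<le>min k l. hc (int l - int j) * spread (k - j) hl c)"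
  proof (rule sum.mono_neutral_right)
    show "\<forall>j\<in>{..k} - {..min k l}. hc (int l - int j) * spread (k - j) hl c = 0"
    proof
      fix j assume "j \<in> {..k} - {..min k l}"
      then have "int l - int j < 0" by auto
      then show "hc (int l - int j) * spread (k - j) hl c = 0" by simp
    qed
  qed auto
  also have "\<dots> = spread k hl (l # c)"
    by (auto intro!: sum.cong simp: spread_mult_left of_nat_diff)
  finally show ?case .
qed

lemma xcoeff_mult_0: "xcoeff (F * G :: ser) 0 = xcoeff F 0 * xcoeff G 0"
proof -
  have "{(a, b). a + b = (0 :: xmon)} = {(0, 0)}"
    by (auto simp flip: xdeg_eq_0_iff)
  then show ?thesis by (simp add: xcoeff_mult)
qed

lemma xcoeff_complete_hom_mult:
  "xcoeff (hc (int l) * G) (ml b) = spread l (\<lambda>c. xcoeff G (ml c)) b"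
proof (induction b arbitrary: l G)
  case Nil
  then show ?case by (simp add: xcoeff_mult_0)
next
  case (Cons k b)
  have "xcoeff (hc (int l) * G) (ml (k # b)) = xcoeff (D k (hc (int l) * G)) (ml b)"
    by simp
  also have "\<dots> = (\<Sum>j\<le>k. xcoeff (hc (int l - int j) * D (k - j) G) (ml b))"
    by (simp only: D_mult xcoeff_sum D_complete_hom)
  also have "\<dots> = (\<Sum>j\<le>min l k. xcoeff (hc (int l - int j) * D (k - j) G) (ml b))"
  proof (rule sum.mono_neutral_right)
    show "\<forall>j\<in>{..k} - {..min l k}. xcoeff (hc (int l - int j) * D (k - j) G) (ml b) = 0"
    proof
      fix j assume "j \<in> {..k} - {..min l k}"
      then have "int l - int j < 0" by auto
      then show "xcoeff (hc (int l - int j) * D (k - j) G) (ml b) = 0" by simp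
    qed
  qed auto
  also have "\<dots> = spread l (\<lambda>c. xcoeff G (ml c)) (k # b)"
    by (auto intro!: sum.cong simp: Cons simp flip: of_nat_diff)
  finally show ?case .
qed

text \<open>Both sides count matrices of nonnegative integers with row sums c and column sums b. In
  the induction, peeling off the first variable from \<open>hl c\<close> and multiplying
  \<open>hl b\<close> by a further complete function are the same operation
  \<open>spread k\<close>.\<close>

lemma xcoeff_hl_commute: "xcoeff (hl c) (ml b) = xcoeff (hl b) (ml c)"
proof (induction b arbitrary: c)
  case Nil
  have "xcoeff (hl c) 0 = (if ml c = 0 then 1 else 0)"
    by (induction c) (auto simp: xcoeff_mult_0 xcoeff_one)
  then show ?case by (simp add: xcoeff_one)
next
  case (Cons k b)
  have "xcoeff (hl c) (ml (k # b)) = xcoeff (D k (hl c)) (ml b)" by simp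
  also have "\<dots> = spread k (\<lambda>c'. xcoeff (hl c') (ml b)) c"
    by (simp only: D_hl spread_xcoeff)
  also have "\<dots> = spread k (\<lambda>c'. xcoeff (hl b) (ml c')) c"
    by (simp only: Cons)
  also have "\<dots> = xcoeff (hl (k # b)) (ml c)"
    by (simp add: xcoeff_complete_hom_mult)
  finally show ?case .
qed

lemma prod_complete_hom:
  "(\<Prod>i<n. hc (int (\<alpha> i) - int i + int (p i))) =
    (if \<forall>i<n. i \<le> \<alpha> i + p i then hl (map (\<lambda>i. \<alpha> i + p i - i) [0..<n]) else 0)"
proof (cases "\<forall>i<n. i \<le> \<alpha> i + p i")
  case True
  then show ?thesis
    unfolding hl_map_upt by (auto intro!: prod.cong simp: of_nat_diff algebra_simps)
next
  case False
  then obtain i where "i < n" "int (\<alpha> i) - int i + int (p i) < 0" by auto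
  then have "(\<Prod>i<n. hc (int (\<alpha> i) - int i + int (p i))) = 0"
    by (intro prod_zero) (auto intro!: bexI[of _ i])
  then show ?thesis using False by auto
qed

text \<open>The symmetry \<open>xcoeff_hl_commute\<close> turns the permutation expansion of the
  functional at \<open>hl b\<close> term by term into the Jacobi-Trudi expansion read at
  \<open>ml b\<close>. This is the bridge from orthonormality of Schur functions to coefficients of
  monomials.\<close>

lemma scoef_hl:
  assumes "is_partition la"
  shows "scoef (hl b) la = xcoeff (schur la) (ml b)"
proof -
  let ?n = "sum_list la"
  have "xcoeff (schur la) (ml b) = (\<Sum>p | p permutes {0..<?n}. signof p *
     (if \<forall>i<?n. i \<le> pad la i + p i then xcoeff (hl (map (\<lambda>i. pad la i + p i - i) [0..<?n])) (ml b) else 0))"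
    unfolding schur_eq_schurN[OF length_le_sum_list[OF assms]] schurN_expand prod_complete_hom
    by (auto intro!: sum.cong)
  also have "\<dots> = phi ?n (pad la) (hl b)"
    unfolding phi_expand xcoeff_hl_commute[of _ b] ml_map_upt ..
  finally show ?thesis using assms by (simp add: scoef_def)
qed

section \<open>The scalar product\<close>

abbreviation parts_le :: "nat \<Rightarrow> nat list set"
  where "parts_le d \<equiv> {la. is_partition la \<and> sum_list la \<le> d}"

lemma finite_parts_le [simp]: "finite (parts_le d)"
proof -
  have "parts_le d = (\<Union>e\<le>d. parts e)" by auto
  then show ?thesis by simp
qed

lemma LambdaZ_deg: assumes "F \<in> LambdaZ" obtains d where "deg_le d F"
  using assms by (auto simp: LambdaZ_iff bdeg_def)

lemma scoef_deg_le: "deg_le d F \<Longrightarrow> d < sum_list la \<Longrightarrow> scoef F la = 0"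
  using scoef_cong[of la F 0] by (force simp: scoef_linear deg_le_def)

lemma schur_expansion_deg_le:
  assumes "symmetric_series F" "deg_le d F"
  shows "F = (\<Sum>la\<in>parts_le d. xconst (scoef F la) * schur la)"
proof (rule xseries_eqI)
  fix m
  have "xcoeff (\<Sum>la\<in>parts_le d. xconst (scoef F la) * schur la) m =
      (\<Sum>la\<in>parts_le d. scoef F la * xcoeff (schur la) m)" by simp
  also have "\<dots> = (\<Sum>la\<in>parts_le d \<union> parts (xdeg m). scoef F la * xcoeff (schur la) m)"
    by (rule sum.mono_neutral_left) (auto, metis assms(2) leI scoef_deg_le)
  also have "\<dots> = (\<Sum>la\<in>parts (xdeg m). scoef F la * xcoeff (schur la) m)"
    by (rule sum.mono_neutral_right) (auto dest: xcoeff_schur_neq_0)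
  also have "\<dots> = xcoeff F m"
    using schur_expansion[OF assms(1)] by simp
  finally show "xcoeff F m = xcoeff (\<Sum>la\<in>parts_le d. xconst (scoef F la) * schur la) m" by simp
qed

lemma hall_commute: "hall P Q = hall Q P"
  by (simp add: hall_def mult.commute)

lemma hall_eq_sum:
  assumes "symmetric_series P" "symmetric_series Q" "deg_le d P \<or> deg_le d Q"
  shows "hall P Q = (\<Sum>la\<in>parts_le d. scoef P la * scoef Q la)"
  unfolding hall_def schur_coeff_eq[OF assms(1)] schur_coeff_eq[OF assms(2)]
proof (rule sum.mono_neutral_left)
  show "{la. scoef P la * scoef Q la \<noteq> 0} \<subseteq> parts_le d"
  proof clarify
    fix la assume nz: "scoef P la * scoef Q la \<noteq> 0"
    then have "is_partition la" by (auto simp: scoef_def split: if_splits)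
    moreover have "sum_list la \<le> d"
    proof (rule ccontr)
      assume "\<not> sum_list la \<le> d"
      then have "scoef P la = 0 \<or> scoef Q la = 0"
        using assms(3) scoef_deg_le[of d P la] scoef_deg_le[of d Q la] by auto
      then show False using nz by auto
    qed
    ultimately show "is_partition la \<and> sum_list la \<le> d" ..
  qed
qed auto

lemma hall_add:
  assumes "P \<in> LambdaZ" "symmetric_series Q" "symmetric_series R"
  shows "hall P (Q + R) = hall P Q + hall P R"
proof -
  obtain d where "deg_le d P" using LambdaZ_deg[OF assms(1)] .
  then show ?thesis
    using assms by (simp add: hall_eq_sum[where d = d] scoef_linear sum.distrib distrib_left)
qed

lemma hall_scale:
  assumes "P \<in> LambdaZ" "symmetric_series Q"
  shows "hall P (xconst c * Q) = c * hall P Q"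
proof -
  obtain d where "deg_le d P" using LambdaZ_deg[OF assms(1)] .
  then show ?thesis
    using assms
    by (simp add: hall_eq_sum[where d = d] scoef_linear sum_distrib_left mult.left_commute)
qed

lemma hall_0: "P \<in> LambdaZ \<Longrightarrow> hall P 0 = 0"
  using hall_scale[of P 0 0] by (simp add: xconst_hom)

lemma hall_diff:
  assumes "P \<in> LambdaZ" "symmetric_series Q" "symmetric_series R"
  shows "hall P (Q - R) = hall P Q - hall P R"
  using hall_add[of P "Q - R" R] assms by simp

lemmas hall_linear = hall_add hall_scale hall_0 hall_diff

lemma hall_deg_gt:
  assumes "P \<in> LambdaZ" "symmetric_series Q" "deg_le d P" "deg_gt d Q"
  shows "hall P Q = 0"
proof -
  have "scoef Q la = scoef 0 la" if "la \<in> parts_le d" for la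
    by (rule scoef_cong) (use that assms(4) in \<open>auto simp: deg_gt_def\<close>)
  then show ?thesis
    using assms by (simp add: hall_eq_sum[where d = d] scoef_linear)
qed

lemma hall_cong_deg:
  assumes "P \<in> LambdaZ" "symmetric_series Q" "symmetric_series R" "deg_le d P" "deg_gt d (Q - R)"
  shows "hall P Q = hall P R"
  using hall_deg_gt[OF assms(1) _ assms(4,5)] hall_diff[OF assms(1-3)] assms by simp

text \<open>Expand Q in Schur functions and apply \<open>scoef_hl\<close>: complete functions are
  dual to monomials, and pairing with them recovers all coefficients of Q.\<close>

lemma hall_hl:
  assumes "Q \<in> LambdaZ"
  shows "hall Q (hl b) = xcoeff Q (ml b)"
proof -
  obtain d where d: "deg_le d Q" using LambdaZ_deg[OF assms] .
  have "hall Q (hl b) = (\<Sum>la\<in>parts_le d. scoef Q la * xcoeff (schur la) (ml b))"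
    using assms d by (auto simp: hall_eq_sum[where d = d] scoef_hl intro!: sum.cong)
  also have "\<dots> = xcoeff (\<Sum>la\<in>parts_le d. xconst (scoef Q la) * schur la) (ml b)"
    by simp
  also have "\<dots> = xcoeff Q (ml b)"
    using schur_expansion_deg_le[OF _ d] assms by simp
  finally show ?thesis .
qed

text \<open>Jacobi-Trudi writes every Schur function as an integral combination of the
  \<open>hl b\<close>, and the Schur expansion of an element of bounded degree is finite; so the
  \<open>hl b\<close> span over the Laurent polynomials.\<close>

lemma LambdaZ_induct [consumes 1, case_names add scale hl]:
  assumes "F \<in> LambdaZ"
    and add: "\<And>F G. F \<in> LambdaZ \<Longrightarrow> G \<in> LambdaZ \<Longrightarrow> Pr F \<Longrightarrow> Pr G \<Longrightarrow> Pr (F + G)"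
    and scale: "\<And>c F. F \<in> LambdaZ \<Longrightarrow> Pr F \<Longrightarrow> Pr (xconst c * F)"
    and hl: "\<And>b. Pr (hl b)"
  shows "Pr F"
proof -
  have zero: "Pr 0" using scale[of 1 0] hl[of "[]"] by (simp add: xconst_hom)
  have sum: "Pr (\<Sum>i\<in>I. G i)" if "\<And>i. i \<in> I \<Longrightarrow> G i \<in> LambdaZ \<and> Pr (G i)" for I and G :: "'i \<Rightarrow> ser"
    using that by (induction I rule: infinite_finite_induct) (auto simp: zero add)
  have int: "of_int z * G = xconst (of_int z) * (G :: ser)" for z G
    by (rule xseries_eqI) simp
  have schur: "Pr (schur la)" for la
    unfolding schur_eq_schurN[OF order.refl] schurN_expand prod_complete_hom int
    by (rule sum) (auto simp: zero intro!: scale hl)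
  obtain d where "deg_le d F" using LambdaZ_deg[OF assms(1)] .
  then have "F = (\<Sum>la\<in>parts_le d. xconst (scoef F la) * schur la)"
    using assms(1) by (intro schur_expansion_deg_le) auto
  moreover have "Pr (\<Sum>la\<in>parts_le d. xconst (scoef F la) * schur la)"
    by (rule sum) (auto intro!: scale schur)
  ultimately show ?thesis by simp
qed

lemma hall_nondegenerate:
  assumes "T \<in> LambdaZ" "T' \<in> LambdaZ" "\<And>S. S \<in> LambdaZ \<Longrightarrow> hall T S = hall T' S"
  shows "T = T'"
proof (rule xseries_eqI)
  fix m
  obtain b where "m = ml b" by (rule ml_surj)
  then show "xcoeff T m = xcoeff T' m"
    using assms(3)[of "hl b"] assms(1,2) by (simp add: hall_hl)
qed

text \<open>On S = \<open>hl b\<close> both sides are the coefficient of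
  \<open>xcons k (ml b)\<close> in Q, by \<open>hall_hl\<close>. So peeling off \<open>x_0^k\<close>
  is adjoint to multiplication by the k-th complete function.\<close>

lemma hall_complete_hom_mult:
  assumes "Q \<in> LambdaZ" "symmetric_series S"
  shows "hall Q (hc (int k) * S) = hall (D k Q) S"
proof -
  have main: "hall Q (hc (int k) * S) = hall (D k Q) S" if "S \<in> LambdaZ" for S
    using that
  proof (induction S rule: LambdaZ_induct)
    case (add F G)
    then show ?case using assms(1) by (simp add: hall_linear distrib_left)
  next
    case (scale c F)
    then show ?case
      using assms(1) by (simp add: hall_linear mult.left_commute[of _ "xconst c"])
  next
    case (hl b)
    show ?case
      using hall_hl[OF assms(1), of "k # b"] hall_hl[of "D k Q" b] assms(1) by simp
  qed
  obtain d where d: "deg_le d Q" using LambdaZ_deg[OF assms(1)] .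
  \<comment> \<open>Only degrees up to d matter in the pairing with Q, so S of unbounded degree may
    be truncated.\<close>
  let ?S = "xtrunc d S"
  have "hall Q (hc (int k) * S) = hall Q (hc (int k) * ?S)"
    using assms d deg_gt_mult(2)[OF deg_gt_xtrunc, of d "hc (int k)" S]
    by (intro hall_cong_deg[where d = d]) (auto simp: right_diff_distrib)
  also have "\<dots> = hall (D k Q) ?S"
    using assms by (intro main) simp
  also have "\<dots> = hall (D k Q) S"
    using assms d hall_cong_deg[where d = d, of "D k Q" S ?S] by (simp add: deg_gt_xtrunc deg_le_D)
  finally show ?thesis .
qed

lemma hall_complete_hom_mult':
  assumes "Q \<in> LambdaZ" "symmetric_series S"
  shows "hall (hc (int k) * Q) S = hall Q (D k S)"
proof -
  obtain d where d: "deg_le d Q" using LambdaZ_deg[OF assms(1)] .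
  obtain e where e: "deg_le e (hc (int k) * Q)"
    using LambdaZ_deg[of "hc (int k) * Q"] assms(1) by auto
  \<comment> \<open>The cut-off covers e for the pairing on the left and k + d on the right, where
    \<open>D k\<close> lowers degrees by k.\<close>
  let ?S = "xtrunc (k + d + e) S"
  have S: "?S \<in> LambdaZ" using assms by simp
  have gt: "deg_gt (k + d + e) (S - ?S)" by (rule deg_gt_xtrunc)
  have "hall (hc (int k) * Q) S = hall (hc (int k) * Q) ?S"
    using assms e gt by (intro hall_cong_deg[where d = e]) (auto simp: deg_gt_def)
  also have "\<dots> = hall (D k ?S) Q"
    using hall_complete_hom_mult[OF S, of Q k] assms by (simp add: hall_commute)
  also have "\<dots> = hall Q (D k ?S)" by (rule hall_commute)
  also have "\<dots> = hall Q (D k S)"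
  proof (rule hall_cong_deg[symmetric, where d = d])
    show "deg_gt d (D k S - D k ?S)"
      using gt by (simp add: deg_gt_def del: xcoeff_simps flip: D_simps)
  qed (use assms d in auto)
  finally show ?thesis .
qed

section \<open>Skewing operators\<close>

definition is_skew :: "ser \<Rightarrow> ser \<Rightarrow> ser \<Rightarrow> bool"
  where "is_skew P Q T \<longleftrightarrow> T \<in> LambdaZ \<and> (\<forall>S\<in>LambdaZ. hall T S = hall Q (P * S))"

lemma skew_eqI: "is_skew P Q T \<Longrightarrow> skew P Q = T"
  unfolding skew_def is_skew_def by (rule the_equality) (auto intro!: hall_nondegenerate)

text \<open>For P = \<open>hl b\<close> the skew is obtained by applying \<open>D k\<close> for each
  entry k of b, and linearity extends this to all P of bounded degree. For P of unbounded degree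
  only the part up to the degree of Q can pair with Q.\<close>

lemma is_skew_exists:
  assumes "symmetric_series P" "Q \<in> LambdaZ"
  shows "\<exists>T. is_skew P Q T"
proof -
  have main: "\<exists>T. is_skew P Q T" if "P \<in> LambdaZ" "Q \<in> LambdaZ" for P Q
    using that(1)
  proof (induction P rule: LambdaZ_induct)
    case (add F G)
    then obtain T U where T: "is_skew F Q T" "is_skew G Q U" by blast
    have "is_skew (F + G) Q (T + U)"
      unfolding is_skew_def
    proof (intro conjI ballI)
      fix S assume "S \<in> LambdaZ"
      then have "hall (T + U) S = hall T S + hall U S"
        using T hall_add[of S T U] by (simp add: is_skew_def hall_commute)
      then show "hall (T + U) S = hall Q ((F + G) * S)"
        using T add \<open>S \<in> LambdaZ\<close> that(2) by (simp add: is_skew_def hall_linear distrib_right)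
    qed (use T in \<open>simp add: is_skew_def\<close>)
    then show ?case by blast
  next
    case (scale c F)
    then obtain T where T: "is_skew F Q T" by blast
    have "is_skew (xconst c * F) Q (xconst c * T)"
      unfolding is_skew_def
    proof (intro conjI ballI)
      fix S assume "S \<in> LambdaZ"
      then have "hall (xconst c * T) S = c * hall T S"
        using T hall_scale[of S T c] by (simp add: is_skew_def hall_commute)
      then show "hall (xconst c * T) S = hall Q (xconst c * F * S)"
        using T scale \<open>S \<in> LambdaZ\<close> that(2) by (simp add: is_skew_def hall_linear mult.assoc)
    qed (use T in \<open>simp add: is_skew_def\<close>)
    then show ?case by blast
  next
    case (hl b)
    show ?case
      using that(2)
    proof (induction b arbitrary: Q)
      case Nil
      then show ?case by (intro exI[of _ Q]) (simp add: is_skew_def)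
    next
      case (Cons k b)
      then obtain T where "is_skew (hl b) (D k Q) T" by fastforce
      then show ?case
        using Cons.prems
        by (intro exI[of _ T]) (simp add: is_skew_def mult.assoc hall_complete_hom_mult)
    qed
  qed
  obtain d where d: "deg_le d Q" using LambdaZ_deg[OF assms(2)] .
  obtain T where T: "is_skew (xtrunc d P) Q T" using main[of "xtrunc d P" Q] assms by auto
  have "is_skew P Q T"
    unfolding is_skew_def
  proof (intro conjI ballI)
    fix S assume S: "S \<in> LambdaZ"
    have "hall Q (P * S) = hall Q (xtrunc d P * S)"
      using assms d S deg_gt_mult(1)[OF deg_gt_xtrunc, of d P S]
      by (intro hall_cong_deg[where d = d]) (auto simp: left_diff_distrib)
    then show "hall T S = hall Q (P * S)" using T S by (simp add: is_skew_def)
  qed (use T in \<open>simp add: is_skew_def\<close>)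
  then show ?thesis by blast
qed

lemma is_skew_skew: "symmetric_series P \<Longrightarrow> Q \<in> LambdaZ \<Longrightarrow> is_skew P Q (skew P Q)"
  using is_skew_exists skew_eqI by metis

lemma skew_LambdaZ [simp]: "symmetric_series P \<Longrightarrow> Q \<in> LambdaZ \<Longrightarrow> skew P Q \<in> LambdaZ"
  using is_skew_skew by (simp add: is_skew_def)

text \<open>The definition tests \<open>skew P Q\<close> only against S of bounded degree.
  Truncating S far enough extends adjointness to all symmetric series, as is required when one
  skewing follows another.\<close>

lemma hall_skew:
  assumes "symmetric_series P" "Q \<in> LambdaZ" "symmetric_series S"
  shows "hall (skew P Q) S = hall Q (P * S)"
proof -
  obtain d where d: "deg_le d Q" using LambdaZ_deg[OF assms(2)] .
  obtain e where e: "deg_le e (skew P Q)" using LambdaZ_deg[of "skew P Q"] assms by auto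
  let ?S = "xtrunc (d + e) S"
  have gt: "deg_gt (d + e) (S - ?S)" by (rule deg_gt_xtrunc)
  have "hall (skew P Q) S = hall (skew P Q) ?S"
    using assms e gt by (intro hall_cong_deg[where d = e]) (auto simp: deg_gt_def)
  also have "\<dots> = hall Q (P * ?S)"
    using is_skew_skew[OF assms(1,2)] assms(3) by (simp add: is_skew_def)
  also have "\<dots> = hall Q (P * S)"
  proof (rule hall_cong_deg[symmetric, where d = d])
    have "deg_gt (d + e) (P * (S - ?S))" using gt by (rule deg_gt_mult)
    then show "deg_gt d (P * S - P * ?S)" by (auto simp: deg_gt_def right_diff_distrib)
  qed (use assms d in auto)
  finally show ?thesis .
qed

lemma xcoeff_skew:
  assumes "symmetric_series P" "Q \<in> LambdaZ"
  shows "xcoeff (skew P Q) (ml b) = hall Q (P * hl b)"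
  using hall_skew[OF assms, of "hl b"] hall_hl[of "skew P Q" b] assms by simp

lemma skew_mult:
  assumes "symmetric_series P" "symmetric_series P'" "Q \<in> LambdaZ"
  shows "skew (P * P') Q = skew P (skew P' Q)"
  using assms
  by (intro skew_eqI) (simp add: is_skew_def hall_skew mult.assoc mult.left_commute)

lemma skew_eqI_xcoeff:
  assumes "symmetric_series P" "Q \<in> LambdaZ" "\<And>b. xcoeff T (ml b) = hall Q (P * hl b)"
  shows "skew P Q = T"
proof (rule xseries_eqI)
  fix m
  obtain b where "m = ml b" by (rule ml_surj)
  then show "xcoeff (skew P Q) m = xcoeff T m"
    using assms by (simp add: xcoeff_skew)
qed

lemma skew_add_left:
  assumes "symmetric_series P" "symmetric_series P'" "Q \<in> LambdaZ"
  shows "skew (P + P') Q = skew P Q + skew P' Q"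
  by (rule skew_eqI_xcoeff) (use assms in \<open>simp_all add: xcoeff_skew hall_linear distrib_right\<close>)

lemma skew_scale_left:
  assumes "symmetric_series P" "Q \<in> LambdaZ"
  shows "skew (xconst c * P) Q = xconst c * skew P Q"
  by (rule skew_eqI_xcoeff) (use assms in \<open>simp_all add: xcoeff_skew hall_linear mult.assoc\<close>)

lemma skew_0_left: "Q \<in> LambdaZ \<Longrightarrow> skew 0 Q = 0"
  using skew_scale_left[of 0 Q 0] by (simp add: xconst_hom)

lemma skew_sum_left:
  assumes "\<And>i. i \<in> I \<Longrightarrow> symmetric_series (P i)" "Q \<in> LambdaZ"
  shows "skew (\<Sum>i\<in>I. P i) Q = (\<Sum>i\<in>I. skew (P i) Q)"
  using assms by (induction I rule: infinite_finite_induct) (auto simp: skew_0_left skew_add_left)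

lemma hall_add_left:
  assumes "Q \<in> LambdaZ" "R \<in> LambdaZ" "symmetric_series P"
  shows "hall (Q + R) P = hall Q P + hall R P"
proof -
  obtain d e where "deg_le d Q" "deg_le e R" using LambdaZ_deg assms by metis
  then have d: "deg_le (d + e) Q" "deg_le (d + e) R"
    by (auto intro: deg_le_mono)
  then have "deg_le (d + e) (Q + R)"
    by (rule deg_le_add)
  then show ?thesis
    using assms d by (simp add: hall_eq_sum[where d = "d + e"] scoef_linear sum.distrib distrib_right)
qed

lemma hall_scale_left:
  assumes "Q \<in> LambdaZ" "symmetric_series P"
  shows "hall (xconst c * Q) P = c * hall Q P"
proof -
  obtain d where d: "deg_le d Q" using LambdaZ_deg[OF assms(1)] .
  then have "deg_le d (xconst c * Q)"
    using deg_le_mult[of 0 "xconst c" d Q] by simp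
  then show ?thesis
    using assms d
    by (simp add: hall_eq_sum[where d = d] scoef_linear sum_distrib_left mult.assoc)
qed

lemma skew_add_right:
  assumes "symmetric_series P" "Q \<in> LambdaZ" "R \<in> LambdaZ"
  shows "skew P (Q + R) = skew P Q + skew P R"
  by (rule skew_eqI_xcoeff) (use assms in \<open>simp_all add: xcoeff_skew hall_add_left hall_scale_left\<close>)

lemma skew_scale_right:
  assumes "symmetric_series P" "Q \<in> LambdaZ"
  shows "skew P (xconst c * Q) = xconst c * skew P Q"
  by (rule skew_eqI_xcoeff) (use assms in \<open>simp_all add: xcoeff_skew hall_add_left hall_scale_left\<close>)

lemma skew_sum_right:
  assumes "\<And>i. i \<in> I \<Longrightarrow> Q i \<in> LambdaZ" "symmetric_series P"
  shows "skew P (\<Sum>i\<in>I. Q i) = (\<Sum>i\<in>I. skew P (Q i))"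
proof -
  have "skew P 0 = 0"
    using skew_scale_right[of P 0 0] assms(2) by (simp add: xconst_hom)
  then show ?thesis
    using assms by (induction I rule: infinite_finite_induct) (auto simp: skew_add_right)
qed

lemma skew_deg_gt:
  assumes "symmetric_series P" "Q \<in> LambdaZ" "deg_le d Q" "deg_gt d P"
  shows "skew P Q = 0"
  using assms by (intro skew_eqI_xcoeff) (auto simp: hall_deg_gt deg_gt_mult)

lemma skew_deg_le:
  assumes "symmetric_series P" "Q \<in> LambdaZ" "deg_le d Q"
  shows "deg_le d (skew P Q)"
  unfolding deg_le_def
proof (intro allI impI, rule ccontr)
  fix m assume m: "xcoeff (skew P Q) m \<noteq> 0" "\<not> xdeg m \<le> d"
  obtain b where b: "m = ml b" by (rule ml_surj)
  have "deg_gt d (hl b)"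
    using homog_hl[of b] m(2) by (auto simp: b xdeg_ml deg_gt_def homog_def)
  then have "hall Q (P * hl b) = 0"
    using assms by (intro hall_deg_gt[where d = d]) (auto intro: deg_gt_mult)
  then show False using m(1) assms by (simp add: b xcoeff_skew)
qed

text \<open>On the other side of the pairing the complete function becomes \<open>D l\<close>, and
  the product rule applies to P S. In generating form this reads P^perp Omega[tX] = Omega[tX]
  (P[X + t])^perp.\<close>

theorem skew_complete_hom_mult:
  assumes "symmetric_series P" "G \<in> LambdaZ"
  shows "skew P (hc (int l) * G) = (\<Sum>j\<le>l. hc (int l - int j) * skew (D j P) G)"
proof (rule skew_eqI, unfold is_skew_def, intro conjI ballI)
  show "(\<Sum>j\<le>l. hc (int l - int j) * skew (D j P) G) \<in> LambdaZ"
    using assms by simp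
  fix S assume S: "S \<in> LambdaZ"
  have lin: "hall S (\<Sum>j\<in>J. F j) = (\<Sum>j\<in>J. hall S (F j))"
    if "\<And>j. j \<in> J \<Longrightarrow> symmetric_series (F j)" "S \<in> LambdaZ" for J :: "nat set" and F S
    using that by (induction J rule: infinite_finite_induct) (auto simp: hall_linear)
  have "hall (\<Sum>j\<le>l. hc (int l - int j) * skew (D j P) G) S
      = (\<Sum>j\<le>l. hall (hc (int l - int j) * skew (D j P) G) S)"
    unfolding hall_commute[of _ S] using assms S by (intro lin) auto
  also have "\<dots> = (\<Sum>j\<le>l. hall G (D j P * D (l - j) S))"
  proof (rule sum.cong[OF refl])
    fix j assume "j \<in> {..l}"
    then have "int l - int j = int (l - j)" by simp
    then show "hall (hc (int l - int j) * skew (D j P) G) S = hall G (D j P * D (l - j) S)"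
      using assms S by (simp only: hall_complete_hom_mult' hall_skew LambdaZ_symmetric
          symmetric_series_D skew_LambdaZ)
  qed
  also have "\<dots> = hall G (D l (P * S))"
    unfolding D_mult using assms S by (intro lin[symmetric]) auto
  also have "\<dots> = hall (hc (int l) * G) (P * S)"
    using assms S by (simp add: hall_complete_hom_mult')
  finally show "hall (\<Sum>j\<le>l. hc (int l - int j) * skew (D j P) G) S
      = hall (hc (int l) * G) (P * S)" .
qed


section \<open>Coefficients involving only some of the indeterminates\<close>

text \<open>Tracking the indices that may occur lets the extraction of powers of \<open>z_q\<close>
  pass over everything built from other indeterminates. The empty set gives rational
  coefficients.\<close>

definition lover :: "nat set \<Rightarrow> laurent set"
  where "lover A = {c. \<forall>a\<in>keys c. keys a \<subseteq> A}"

definition over :: "nat set \<Rightarrow> ser \<Rightarrow> bool"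
  where "over A F \<longleftrightarrow> (\<forall>m. xcoeff F m \<in> lover A)"

lemma lover_simps [simp]:
  "0 \<in> lover A" "1 \<in> lover A" "c \<in> lover A \<Longrightarrow> - c \<in> lover A"
  by (auto simp: lover_def)

lemma lover_add [simp]: "c \<in> lover A \<Longrightarrow> d \<in> lover A \<Longrightarrow> c + d \<in> lover A"
  using keys_add[of c d] by (fastforce simp: lover_def)

lemma lover_diff [simp]: "c \<in> lover A \<Longrightarrow> d \<in> lover A \<Longrightarrow> c - d \<in> lover A"
  using lover_add[of c A "- d"] by simp

lemma lover_mult [simp]:
  assumes "c \<in> lover A" "d \<in> lover A"
  shows "c * d \<in> lover A"
  unfolding lover_def
proof (clarify)
  fix a i assume "a \<in> keys (c * d)" and i: "i \<in> keys a"
  then obtain u v where "a = u + v" "u \<in> keys c" "v \<in> keys d"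
    using keys_mult[of c d] by blast
  then show "i \<in> A" using i assms keys_add[of u v] by (fastforce simp: lover_def)
qed

lemma lover_sum [simp]: "(\<And>i. i \<in> I \<Longrightarrow> c i \<in> lover A) \<Longrightarrow> (\<Sum>i\<in>I. c i) \<in> lover A"
  by (induction I rule: infinite_finite_induct) auto

lemma lover_of_int [simp]: "of_int z \<in> lover A"
proof -
  have "of_nat k \<in> lover A" for k by (induction k) auto
  then show ?thesis by (cases z rule: int_cases2) auto
qed

lemma lover_single [simp]: "single a r \<in> lover A \<longleftrightarrow> r = 0 \<or> keys a \<subseteq> A"
  by (auto simp: lover_def)

lemma over_simps [simp]:
  "over A 0" "over A F \<Longrightarrow> over A (- F)" "over A (xconst c) \<longleftrightarrow> c \<in> lover A"
  "over A F \<Longrightarrow> over A G \<Longrightarrow> over A (F + G)" "over A F \<Longrightarrow> over A G \<Longrightarrow> over A (F - G)"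
  "over A (hc l)" "over A F \<Longrightarrow> over A (D k F)"
  by (auto simp: over_def xcoeff_xconst)

lemma over_1 [simp]: "over A 1"
  by (simp add: over_def xcoeff_one)

lemma over_mult [simp]: "over A F \<Longrightarrow> over A G \<Longrightarrow> over A (F * G)"
  by (auto simp: over_def xcoeff_mult intro!: lover_sum)

lemma over_sum [simp]: "(\<And>i. i \<in> I \<Longrightarrow> over A (F i)) \<Longrightarrow> over A (\<Sum>i\<in>I. F i)"
  by (induction I rule: infinite_finite_induct) auto

lemma over_prod [simp]: "(\<And>i. i \<in> I \<Longrightarrow> over A (F i)) \<Longrightarrow> over A (\<Prod>i\<in>I. F i)"
  by (induction I rule: infinite_finite_induct) auto

lemma over_power [simp]: "over A F \<Longrightarrow> over A (F ^ k)"
  by (induction k) auto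

lemma over_mono: "over A F \<Longrightarrow> A \<subseteq> B \<Longrightarrow> over B F"
  by (fastforce simp: over_def lover_def)

lemma over_hl [simp]: "over A (hl b)"
  by (induction b) auto

lemma scoef_lover: "over A F \<Longrightarrow> scoef F la \<in> lover A"
  unfolding scoef_def phi_expand by (auto simp: over_def intro!: lover_sum lover_mult)

lemma over_skew:
  assumes "symmetric_series P" "Q \<in> LambdaZ" "over A P" "over A Q"
  shows "over A (skew P Q)"
  unfolding over_def
proof
  fix m
  obtain b where b: "m = ml b" by (rule ml_surj)
  obtain d where d: "deg_le d Q" using LambdaZ_deg[OF assms(2)] .
  have "hall Q (P * hl b) \<in> lover A"
    using assms d by (auto simp: hall_eq_sum[where d = d] intro!: lover_sum lover_mult scoef_lover)
  then show "xcoeff (skew P Q) m \<in> lover A"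
    using assms by (simp add: b xcoeff_skew)
qed

lemma Lambda_iff: "F \<in> Lambda \<longleftrightarrow> F \<in> LambdaZ \<and> over {} F"
  unfolding Lambda_def over_def lover_def by (auto simp: subset_iff)


section \<open>Adams operations and weights\<close>

abbreviation coef :: "ser \<Rightarrow> xmon \<Rightarrow> zmon \<Rightarrow> rat"
  where "coef F m a \<equiv> lookup (xcoeff F m) a"

lemma ser_eqI: "(\<And>m a. coef F m a = coef G m a) \<Longrightarrow> F = G"
  by (auto intro!: xseries_eqI poly_mapping_eqI)

lemma coef_mult_nonzero:
  assumes "coef (F * G) m a \<noteq> 0"
  obtains m1 m2 a1 a2 where "m = m1 + m2" "a = a1 + a2" "coef F m1 a1 \<noteq> 0" "coef G m2 a2 \<noteq> 0"
proof -
  have "\<exists>p\<in>{(u, v). u + v = m}. lookup (xcoeff F (fst p) * xcoeff G (snd p)) a \<noteq> 0"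
  proof (rule ccontr)
    assume "\<not> ?thesis"
    then have "coef (F * G) m a = 0"
      by (auto simp: xcoeff_mult lookup_sum intro!: sum.neutral)
    then show False using assms by simp
  qed
  then obtain m1 m2 where m: "m = m1 + m2" "a \<in> keys (xcoeff F m1 * xcoeff G m2)"
    by (auto simp: in_keys_iff)
  then obtain a1 a2 where "a = a1 + a2" "a1 \<in> keys (xcoeff F m1)" "a2 \<in> keys (xcoeff G m2)"
    using keys_mult by blast
  then show ?thesis using that m by (auto simp: in_keys_iff)
qed

lemma lookup_single_mult:
  fixes c :: laurent
  shows "lookup (single a r * c) b = r * lookup c (b - a)"
proof -
  have eq: "(b = a + q) = (q = b - a)" for q :: zmon
    by (auto simp: algebra_simps)
  show ?thesis
    by (simp add: lookup_mult lookup_single when_mult eq)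
qed

lemma coef_zmonom_mult [simp]: "coef (zmonom a * F) m b = coef F m (b - a)"
  by (simp add: zmonom_def lookup_single_mult)

lemma zmonom_add: "zmonom (a + b) = zmonom a * zmonom b"
  by (simp add: zmonom_def mult_single xconst_hom(6)[symmetric])

lemma zmonom_0: "zmonom 0 = 1"
  by (simp add: zmonom_def xconst_hom)

lemma zmonom_power: "zmonom a ^ k = zmonom (of_nat k * a)"
  by (induction k) (simp_all add: zmonom_0 zmonom_add algebra_simps)

lemma ratc_hom:
  "ratc 0 = 0" "ratc 1 = 1" "ratc (c + d) = ratc c + ratc d" "ratc (c * d) = ratc c * ratc d"
  by (simp_all add: ratc_def xconst_hom(1-3) single_add mult_single xconst_hom(6)[symmetric])

interpretation ratc: comm_ring_hom ratc
  by unfold_locales (simp_all add: ratc_hom)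

lemma coef_ratc_mult [simp]: "coef (ratc c * F) m a = c * coef F m a"
  using lookup_single_mult[of 0 c "xcoeff F m" a] by (simp add: ratc_def)

definition kx :: "nat \<Rightarrow> xmon \<Rightarrow> xmon"
  where "kx k m = Poly_Mapping.map (\<lambda>e. k * e) m"

definition kz :: "nat \<Rightarrow> zmon \<Rightarrow> zmon"
  where "kz k a = Poly_Mapping.map (\<lambda>e. int k * e) a"

lemma lookup_kx [simp]: "lookup (kx k m) i = k * lookup m i"
  and lookup_kz [simp]: "lookup (kz k a) i = int k * lookup a i"
  by (auto simp: kx_def kz_def map.rep_eq when_def)

lemma kx_add: "kx k (m + m') = kx k m + kx k m'"
  and kz_add: "kz k (a + b) = kz k a + kz k b"
  and kz_diff: "kz k (a - b) = kz k a - kz k b"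
  and kx_0 [simp]: "kx k 0 = 0"
  and kz_0 [simp]: "kz k 0 = 0"
  and kx_xcons: "kx k (xcons i m) = xcons (k * i) (kx k m)"
  by (auto intro!: poly_mapping_eqI simp: lookup_add lookup_minus algebra_simps lookup_xcons split: nat.splits)

lemma kx_inject [simp]: "k > 0 \<Longrightarrow> kx k m = kx k m' \<longleftrightarrow> m = m'"
  and kz_inject [simp]: "k > 0 \<Longrightarrow> kz k a = kz k b \<longleftrightarrow> a = b"
  by (auto simp: poly_mapping_eq_iff fun_eq_iff)

lemma zpower_eq: "zpower k c = (\<Sum>a\<in>keys c. single (kz k a) (lookup c a))"
  by (simp add: zpower_def kz_def)

lemma lookup_zpower: "k > 0 \<Longrightarrow> lookup (zpower k c) (kz k a) = lookup c a"
proof -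
  assume "k > 0"
  then have "lookup (zpower k c) (kz k a) = (\<Sum>b\<in>keys c. if b = a then lookup c b else 0)"
    unfolding zpower_eq lookup_sum by (intro sum.cong) (auto simp: lookup_single)
  then show ?thesis by (auto simp: in_keys_iff)
qed

lemma lookup_zpower_nonzero:
  assumes "lookup (zpower k c) b \<noteq> 0"
  obtains a where "b = kz k a" "lookup c a \<noteq> 0"
proof -
  obtain a where "a \<in> keys c" "lookup (single (kz k a) (lookup c a)) b \<noteq> 0"
    using assms unfolding zpower_eq lookup_sum by (meson sum.neutral)
  then show ?thesis
    using that by (auto simp: lookup_single when_def split: if_splits)
qed

lemma xcoeff_p_at: "xcoeff (p_at k A) m = (\<Sum>m' | kx k m' = m. zpower k (xcoeff A m'))"
  by (simp add: p_at_def kx_def)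

lemma xcoeff_p_at_kx: "k > 0 \<Longrightarrow> xcoeff (p_at k A) (kx k m) = zpower k (xcoeff A m)"
  by (simp add: xcoeff_p_at)

lemma coef_p_at: "k > 0 \<Longrightarrow> coef (p_at k A) (kx k m) (kz k a) = coef A m a"
  by (simp add: xcoeff_p_at_kx lookup_zpower)

lemma coef_p_at_nonzero:
  assumes "coef (p_at k A) m a \<noteq> 0"
  obtains m' a' where "m = kx k m'" "a = kz k a'" "coef A m' a' \<noteq> 0"
proof -
  obtain m' where "kx k m' = m" "lookup (zpower k (xcoeff A m')) a \<noteq> 0"
    using assms unfolding xcoeff_p_at lookup_sum by (metis (mono_tags, lifting) mem_Collect_eq sum.neutral)
  then show ?thesis
    using that by (metis lookup_zpower_nonzero)
qed

abbreviation kform :: "nat \<Rightarrow> xmon \<Rightarrow> zmon \<Rightarrow> bool"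
  where "kform k m a \<equiv> (\<exists>m'. m = kx k m') \<and> (\<exists>a'. a = kz k a')"

lemma p_at_eqI:
  assumes "k > 0" "\<And>m a. coef B (kx k m) (kz k a) = coef A m a"
    and "\<And>m a. coef B m a \<noteq> 0 \<Longrightarrow> kform k m a"
  shows "p_at k A = B"
proof (rule ser_eqI)
  fix m a
  show "coef (p_at k A) m a = coef B m a"
  proof (cases "kform k m a")
    case True
    then show ?thesis using assms(1,2) by (auto simp: coef_p_at)
  next
    case False
    then show ?thesis using assms(3) coef_p_at_nonzero[of k A m a] by metis
  qed
qed

lemma p_at_form: "coef (p_at k A) m a \<noteq> 0 \<Longrightarrow> kform k m a"
  by (metis coef_p_at_nonzero)

lemma p_at_add: "k > 0 \<Longrightarrow> p_at k (A + B) = p_at k A + p_at k B"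
proof (rule p_at_eqI)
  fix m a assume "coef (p_at k A + p_at k B) m a \<noteq> 0"
  then have "coef (p_at k A) m a \<noteq> 0 \<or> coef (p_at k B) m a \<noteq> 0"
    by (auto simp: lookup_add)
  then show "kform k m a"
    using p_at_form by blast
qed (auto simp: coef_p_at lookup_add)

lemma p_at_uminus: "k > 0 \<Longrightarrow> p_at k (- A) = - p_at k A"
proof (rule p_at_eqI)
  fix m a assume "coef (- p_at k A) m a \<noteq> 0"
  then have "coef (p_at k A) m a \<noteq> 0" by simp
  then show "kform k m a" by (rule p_at_form)
qed (simp_all add: coef_p_at)

lemma p_at_0: "k > 0 \<Longrightarrow> p_at k 0 = 0"
  by (rule p_at_eqI) auto

lemma p_at_sum: "k > 0 \<Longrightarrow> p_at k (\<Sum>i\<in>I. A i) = (\<Sum>i\<in>I. p_at k (A i))"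
  by (induction I rule: infinite_finite_induct) (auto simp: p_at_0 p_at_add)

lemma p_at_zmonom_mult: "k > 0 \<Longrightarrow> p_at k (zmonom a * A) = zmonom (kz k a) * p_at k A"
proof (rule p_at_eqI)
  fix m b assume "coef (zmonom (kz k a) * p_at k A) m b \<noteq> 0"
  then obtain m' b' where "m = kx k m'" "b - kz k a = kz k b'"
    using p_at_form[of k A m "b - kz k a"] by auto
  then show "kform k m b"
    by (metis add.commute diff_add_cancel kz_add)
qed (auto simp: coef_p_at simp flip: kz_diff)

lemma p_at_1: "k > 0 \<Longrightarrow> p_at k 1 = 1"
proof (rule p_at_eqI)
  assume k: "k > 0"
  have kx0: "kx k m = 0 \<longleftrightarrow> m = 0" for m using kx_inject[OF k, of m 0] by simp
  have kz0: "kz k a = 0 \<longleftrightarrow> a = 0" for a using kz_inject[OF k, of a 0] by simp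
  show "coef 1 (kx k m) (kz k a) = coef 1 m a" for m a
    by (simp add: xcoeff_one lookup_one kx0 kz0)
  show "kform k m a" if "coef 1 m a \<noteq> 0" for m a
  proof -
    have "m = kx k 0" "a = kz k 0"
      using that by (auto simp: xcoeff_one lookup_one when_def split: if_splits)
    then show ?thesis by blast
  qed
qed simp

lemma p_at_zmonom: "k > 0 \<Longrightarrow> p_at k (zmonom a) = zmonom (kz k a)"
  using p_at_zmonom_mult[of k a 1] by (simp add: p_at_1)

lemma kz_eq: "kz k a = of_nat k * a"
proof (induction k)
  case (Suc k)
  have "kz (Suc k) a = a + kz k a"
    by (rule poly_mapping_eqI) (simp add: lookup_add algebra_simps)
  then show ?case by (simp add: Suc algebra_simps)
qed (auto intro: poly_mapping_eqI)

lemma p_at_zmonom_power: "k > 0 \<Longrightarrow> p_at k (zmonom a) = zmonom a ^ k"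
  by (simp add: p_at_zmonom zmonom_power kz_eq)

lemma xdeg_kx [simp]: "xdeg (kx k m) = k * xdeg m"
  by (subst xdeg_eq_sum[of "keys m"]) (auto simp: xdeg_def sum_distrib_left in_keys_iff)

lemma p_at_bdeg [simp]: "bdeg A \<Longrightarrow> bdeg (p_at k A)"
proof -
  assume "bdeg A"
  then obtain d where d: "deg_le d A" by (auto simp: bdeg_def)
  have "deg_le (k * d) (p_at k A)"
    unfolding deg_le_def
  proof (intro allI impI)
    fix m assume "xcoeff (p_at k A) m \<noteq> 0"
    then obtain a where "coef (p_at k A) m a \<noteq> 0"
      by (metis poly_mapping_eqI lookup_zero)
    then obtain m' a' where "m = kx k m'" "coef A m' a' \<noteq> 0" by (rule coef_p_at_nonzero)
    then show "xdeg m \<le> k * d" using d by (force simp: deg_le_def)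
  qed
  then show ?thesis by (auto simp: bdeg_def)
qed

lemma p_at_over [simp]: "over S A \<Longrightarrow> over S (p_at k A)"
  unfolding over_def lover_def
proof (clarify)
  fix m a i assume A: "\<forall>m. xcoeff A m \<in> {c. \<forall>a\<in>keys c. keys a \<subseteq> S}"
    and a: "a \<in> keys (xcoeff (p_at k A) m)" and i: "i \<in> keys a"
  obtain m' a' where "a = kz k a'" "coef A m' a' \<noteq> 0"
    using a by (auto simp: in_keys_iff elim: coef_p_at_nonzero)
  then have "i \<in> keys a'" "a' \<in> keys (xcoeff A m')" using i by (auto simp: in_keys_iff)
  then show "i \<in> S" using A by blast
qed

lemma p_at_symmetric [simp]:
  assumes "symmetric_series A" "k > 0"
  shows "symmetric_series (p_at k A)"
  unfolding symmetric_series_def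
proof (intro allI impI)
  fix \<pi> :: "nat \<Rightarrow> nat" and m :: xmon
  assume pi: "bij \<pi>"
  have comm: "map_key \<pi> (kx k m') = kx k (map_key \<pi> m')"
    if "bij \<pi>" for \<pi> :: "nat \<Rightarrow> nat" and m'
    by (rule poly_mapping_eqI) (simp add: map_key.rep_eq bij_is_inj[OF that])
  show "xcoeff (p_at k A) (map_key \<pi> m) = xcoeff (p_at k A) m"
  proof (cases "\<exists>m'. m = kx k m'")
    case True
    then show ?thesis
      using assms pi by (auto simp: comm xcoeff_p_at_kx symmetric_seriesD)
  next
    case False
    have "\<nexists>m'. map_key \<pi> m = kx k m'"
    proof
      assume "\<exists>m'. map_key \<pi> m = kx k m'"
      then obtain m' where "map_key \<pi> m = kx k m'" by blast
      then have "m = kx k (map_key (inv_into UNIV \<pi>) m')"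
        using map_key_inv(2)[OF pi, of m] comm[OF bij_imp_bij_inv[OF pi], of m'] by simp
      then show False using False by blast
    qed
    then have "{m'. kx k m' = m} = {}" "{m'. kx k m' = map_key \<pi> m} = {}"
      using False by auto metis
    then show ?thesis by (simp add: xcoeff_p_at)
  qed
qed

text \<open>The k-th Adams operation raises \<open>x_0\<close> to the k-th power together with
  everything else, so only exponents divisible by k survive.\<close>

lemma D_p_at:
  assumes "k > 0"
  shows "D j (p_at k A) = (if k dvd j then p_at k (D (j div k) A) else 0)"
proof (cases "k dvd j")
  case True
  then obtain i where i: "j = k * i" by blast
  have "p_at k (D i A) = D j (p_at k A)"
  proof (rule p_at_eqI[OF assms])
    show "coef (D j (p_at k A)) (kx k m) (kz k a) = coef (D i A) m a" for m a
      using coef_p_at[OF assms, of A "xcons i m" a] by (simp add: i kx_xcons)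
    fix m a assume "coef (D j (p_at k A)) m a \<noteq> 0"
    then obtain m' a' where m: "xcons j m = kx k m'" "a = kz k a'"
      using p_at_form by fastforce
    obtain l m'' where "m' = xcons l m''" by (rule xcons_cases)
    then show "kform k m a"
      using m by (auto simp: kx_xcons)
  qed
  then show ?thesis using i assms by simp
next
  case False
  have "D j (p_at k A) = 0"
  proof (rule ser_eqI, rule ccontr)
    fix m a assume "coef (D j (p_at k A)) m a \<noteq> coef 0 m a"
    then obtain m' where "xcons j m = kx k m'"
      using p_at_form by fastforce
    then have "j = k * lookup m' 0" by (metis lookup_kx lookup_xcons_simps(1))
    then show False using False by simp
  qed
  then show ?thesis using False by simp
qed


section \<open>Convergence of the exponential\<close>

text \<open>
  Coefficientwise convergence does not pass to products, since a Laurent monomial has infinitely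
  many factorizations; convergence with respect to the filtration \<open>W\<close> does.
\<close>

locale weight =
  fixes w :: "xmon \<Rightarrow> zmon \<Rightarrow> int"
  assumes w_add: "w (m + m') (a + a') = w m a + w m' a'"
    and w_scale: "w (kx k m) (kz k a) = int k * w m a"
begin

definition W :: "nat \<Rightarrow> ser \<Rightarrow> bool"
  where "W d F \<longleftrightarrow> (\<forall>m a. coef F m a \<noteq> 0 \<longrightarrow> int d \<le> w m a)"

lemma w_0 [simp]: "w 0 0 = 0"
  using w_add[of 0 0 0 0] by simp

lemma W_mono: "W d F \<Longrightarrow> e \<le> d \<Longrightarrow> W e F"
  by (fastforce simp: W_def)

lemma W_0 [simp]: "W d 0"
  by (simp add: W_def)

lemma W_1 [simp]: "W 0 1"
  by (simp add: W_def xcoeff_one lookup_one)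

lemma W_add: "W d F \<Longrightarrow> W d G \<Longrightarrow> W d (F + G)"
  unfolding W_def xcoeff_simps lookup_add by (metis add.right_neutral)

lemma W_uminus: "W d F \<Longrightarrow> W d (- F)"
  by (simp add: W_def)

lemma W_diff: "W d F \<Longrightarrow> W d G \<Longrightarrow> W d (F - G)"
  using W_add[OF _ W_uminus, of d F G] by simp

lemma W_diff_swap: "W d (F - G) \<Longrightarrow> W d (G - F)"
  using W_uminus[of d "F - G"] by simp

lemma W_mult: "W d F \<Longrightarrow> W e G \<Longrightarrow> W (d + e) (F * G)"
  unfolding W_def[of "d + e"]
proof (intro allI impI)
  fix m a assume FG: "W d F" "W e G" and "coef (F * G) m a \<noteq> 0"
  then obtain m1 m2 a1 a2 where "m = m1 + m2" "a = a1 + a2" "coef F m1 a1 \<noteq> 0" "coef G m2 a2 \<noteq> 0"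
    by (blast elim: coef_mult_nonzero)
  then show "int (d + e) \<le> w m a"
    using FG by (auto simp: W_def w_add add_mono)
qed

lemma W_mult_left: "W d F \<Longrightarrow> W 0 G \<Longrightarrow> W d (F * G)"
  and W_mult_right: "W 0 F \<Longrightarrow> W d G \<Longrightarrow> W d (F * G)"
  using W_mult[of d F 0 G] W_mult[of 0 F d G] by auto

lemma W_ratc_mult: "W d F \<Longrightarrow> W d (ratc c * F)"
  by (simp add: W_def)

lemma W_sum: "(\<And>i. i \<in> I \<Longrightarrow> W d (F i)) \<Longrightarrow> W d (\<Sum>i\<in>I. F i)"
  by (induction I rule: infinite_finite_induct) (auto intro: W_add)

lemma W_power: "W 1 F \<Longrightarrow> W r (F ^ r)"
  by (induction r) (auto dest: W_mult)

lemma W_p_at: "W 1 A \<Longrightarrow> W k (p_at k A)"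
  unfolding W_def[of k]
proof (intro allI impI)
  fix m a assume A: "W 1 A" and "coef (p_at k A) m a \<noteq> 0"
  then obtain m' a' where "m = kx k m'" "a = kz k a'" "coef A m' a' \<noteq> 0"
    by (blast elim: coef_p_at_nonzero)
  moreover from this A have "1 \<le> w m' a'" by (auto simp: W_def)
  ultimately show "int k \<le> w m a"
    by (simp add: w_scale mult_left_mono[of 1 _ "int k", simplified])
qed

definition expo :: "nat \<Rightarrow> ser \<Rightarrow> ser"
  where "expo N A = (\<Sum>k=1..N. ratc (1 / of_nat k) * p_at k A)"

lemma Omega_trunc_eq: "Omega_trunc N A = (\<Sum>r\<le>N. ratc (1 / fact r) * expo N A ^ r)"
  by (simp add: Omega_trunc_def expo_def)

lemma W_expo: "W 1 A \<Longrightarrow> W 1 (expo N A)"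
  unfolding expo_def by (intro W_sum W_ratc_mult) (auto intro: W_mono[OF W_p_at])

lemma W_Omega_trunc: "W 1 A \<Longrightarrow> W 0 (Omega_trunc N A)"
  unfolding Omega_trunc_eq by (intro W_sum W_ratc_mult W_mono[OF W_power[OF W_expo]]) auto

lemma W_power_diff:
  assumes "W 0 F" "W 0 G" "W d (F - G)"
  shows "W d (F ^ r - G ^ r)"
proof (induction r)
  case (Suc r)
  have "W 0 (G ^ r)" using assms(2) by (induction r) (auto intro: W_mult_left)
  moreover have "F ^ Suc r - G ^ Suc r = F * (F ^ r - G ^ r) + (F - G) * G ^ r"
    by (simp add: algebra_simps)
  ultimately show ?case
    using W_add[OF W_mult_right[OF assms(1) Suc] W_mult_left[OF assms(3), of "G ^ r"]] by simp
qed simp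

text \<open>Since p_k[A] has weight at least k and an r-th power weight at least r, every change
  after stage N has weight above N.\<close>

lemma Omega_trunc_cauchy:
  assumes A: "W 1 A" and "N \<le> N'"
  shows "W (Suc N) (Omega_trunc N' A - Omega_trunc N A)"
proof -
  have "W (Suc N) (\<Sum>k\<in>{1..N'} - {1..N}. ratc (1 / of_nat k) * p_at k A)"
    by (intro W_sum W_ratc_mult W_mono[OF W_p_at[OF A]]) auto
  moreover have "expo N' A - expo N A = (\<Sum>k\<in>{1..N'} - {1..N}. ratc (1 / of_nat k) * p_at k A)"
    unfolding expo_def using \<open>N \<le> N'\<close> by (subst sum_diff) auto
  ultimately have e: "W (Suc N) (expo N' A - expo N A)" by simp
  have W0: "W 0 (expo M A)" for M using W_mono[OF W_expo[OF A]] by blast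
  have "Omega_trunc N' A - Omega_trunc N A =
      (\<Sum>r\<in>{..N'} - {..N}. ratc (1 / fact r) * expo N' A ^ r)
      + (\<Sum>r\<le>N. ratc (1 / fact r) * (expo N' A ^ r - expo N A ^ r))"
    unfolding Omega_trunc_eq using \<open>N \<le> N'\<close>
    by (subst sum_diff) (auto simp: sum_subtractf algebra_simps)
  moreover have "W (Suc N) (\<Sum>r\<in>{..N'} - {..N}. ratc (1 / fact r) * expo N' A ^ r)"
    by (intro W_sum W_ratc_mult W_mono[OF W_power[OF W_expo[OF A]]]) auto
  moreover have "W (Suc N) (\<Sum>r\<le>N. ratc (1 / fact r) * (expo N' A ^ r - expo N A ^ r))"
    by (intro W_sum W_ratc_mult W_power_diff W0 e)
  ultimately show ?thesis by (simp add: W_add)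
qed

text \<open>Convergence in the weight filtration with a fixed rate: stage N is correct below weight
  N + 1. It implies the coefficientwise limit in \<open>Omega\<close> and, unlike it, is stable
  under products.\<close>

definition omega :: "ser \<Rightarrow> ser \<Rightarrow> bool"
  where "omega A F \<longleftrightarrow> W 1 A \<and> (\<forall>N. W (Suc N) (Omega_trunc N A - F))"

lemma coef_eq_if_W: "W d (F - G) \<Longrightarrow> w m a < int d \<Longrightarrow> coef F m a = coef G m a"
  by (force simp: W_def lookup_minus)

lemma omega_limit:
  assumes "omega A F"
  shows "\<forall>\<^sub>F N in sequentially. coef (Omega_trunc N A) m a = coef F m a"
proof -
  have "coef (Omega_trunc N A) m a = coef F m a" if "N \<ge> nat (w m a)" for N
    using assms that by (intro coef_eq_if_W[of "Suc N"]) (auto simp: omega_def)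
  then show ?thesis by (auto simp: eventually_sequentially)
qed

lemma Omega_eqI:
  assumes "omega A F"
  shows "Omega A = F"
  unfolding Omega_def
proof (rule the_equality)
  show lim: "\<forall>m a. \<forall>\<^sub>F N in sequentially. coef (Omega_trunc N A) m a = coef F m a"
    using omega_limit[OF assms] by blast
  fix G assume "\<forall>m a. \<forall>\<^sub>F N in sequentially. coef (Omega_trunc N A) m a = coef G m a"
  then have G: "\<forall>\<^sub>F N in sequentially. coef (Omega_trunc N A) m a = coef G m a" for m a
    by blast
  have "\<forall>\<^sub>F N in sequentially. coef G m a = coef F m a" for m a
    using omega_limit[OF assms, of m a] G[of m a] by eventually_elim simp
  then show "G = F" by (auto intro!: ser_eqI)
qed

lemma omega_W0: assumes "omega A F" shows "W 0 F"
proof -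
  have "W 0 (Omega_trunc 0 A)" using assms by (simp add: omega_def W_Omega_trunc)
  moreover have "W 0 (Omega_trunc 0 A - F)"
    using assms W_mono[of "Suc 0" "Omega_trunc 0 A - F" 0] by (simp add: omega_def)
  ultimately have "W 0 (Omega_trunc 0 A - (Omega_trunc 0 A - F))" by (rule W_diff)
  then show ?thesis by simp
qed

text \<open>By the binomial theorem the truncation at A + B sums over the triangle i + j \<le> N,
  the product over a square; the terms in between have weight at least i + j, above N.\<close>

lemma Omega_trunc_add:
  assumes "W 1 A" "W 1 B"
  shows "W (Suc N) (Omega_trunc N (A + B) - Omega_trunc N A * Omega_trunc N B)"
proof -
  let ?u = "expo N A" and ?v = "expo N B"
  define f where "f i j = ratc (1 / fact i) * ?u ^ i * (ratc (1 / fact j) * ?v ^ j)" for i j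
  have "expo N (A + B) = ?u + ?v"
    by (auto simp: expo_def p_at_add distrib_left sum.distrib[symmetric] intro!: sum.cong)
  then have "Omega_trunc N (A + B) = (\<Sum>r\<le>N. ratc (1 / fact r) * (?u + ?v) ^ r)"
    by (simp add: Omega_trunc_eq)
  also have "\<dots> = (\<Sum>r\<le>N. \<Sum>i\<le>r. f i (r - i))"
  proof -
    have key: "ratc (1 / fact r) * of_nat (r choose i) = ratc (1 / fact i) * ratc (1 / fact (r - i))"
      if "i \<le> r" for i r
    proof -
      have "(1 / fact r) * of_nat (r choose i) = (1 / fact i * (1 / fact (r - i)) :: rat)"
        using that by (simp add: binomial_fact field_simps)
      then show ?thesis by (metis ratc.hom_mult ratc.hom_of_nat)
    qed
    have "ratc (1 / fact r) * (of_nat (r choose i) * ?u ^ i * ?v ^ (r - i)) = f i (r - i)"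
      if "i \<le> r" for i r
    proof -
      have "ratc (1 / fact r) * (of_nat (r choose i) * ?u ^ i * ?v ^ (r - i)) =
          ratc (1 / fact r) * of_nat (r choose i) * (?u ^ i * ?v ^ (r - i))"
        by (simp only: mult.assoc)
      also have "\<dots> = f i (r - i)"
        unfolding key[OF that] by (simp add: f_def mult_ac)
      finally show ?thesis .
    qed
    then have "ratc (1 / fact r) * (?u + ?v) ^ r = (\<Sum>i\<le>r. f i (r - i))" for r
      unfolding binomial_ring sum_distrib_left by (auto intro!: sum.cong)
    then show ?thesis by simp
  qed
  also have "\<dots> = (\<Sum>(i, j) | i + j \<le> N. f i j)"
    by (rule sum.triangle_reindex_eq[symmetric])
  finally have 1: "Omega_trunc N (A + B) = (\<Sum>(i, j) | i + j \<le> N. f i j)" .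
  have 2: "Omega_trunc N A * Omega_trunc N B = (\<Sum>(i, j)\<in>{..N} \<times> {..N}. f i j)"
    unfolding Omega_trunc_eq sum_product sum.cartesian_product f_def by simp
  have sub: "{(i, j). i + j \<le> N} \<subseteq> {..N} \<times> {..N}" by auto
  have "W (Suc N) (\<Sum>(i, j)\<in>{..N} \<times> {..N} - {(i, j). i + j \<le> N}. f i j)"
  proof (rule W_sum)
    fix p assume "p \<in> {..N} \<times> {..N} - {(i, j). i + j \<le> N}"
    then obtain i j where p: "p = (i, j)" "\<not> i + j \<le> N" by auto
    moreover have "W (i + j) (f i j)"
      unfolding f_def by (intro W_mult W_ratc_mult W_power W_expo assms)
    ultimately show "W (Suc N) (case p of (i, j) \<Rightarrow> f i j)" by (auto elim: W_mono)
  qed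
  moreover have "(\<Sum>(i, j)\<in>{..N} \<times> {..N} - {(i, j). i + j \<le> N}. f i j) =
      Omega_trunc N A * Omega_trunc N B - Omega_trunc N (A + B)"
    unfolding 1 2 by (rule sum_diff) (use sub in auto)
  ultimately show ?thesis using W_diff_swap by metis
qed

lemma omega_add:
  assumes A: "omega A F" and B: "omega B G"
  shows "omega (A + B) (F * G)"
  unfolding omega_def
proof (intro conjI allI)
  show "W 1 (A + B)" using A B by (auto simp: omega_def intro: W_add)
  fix N
  have "Omega_trunc N (A + B) - F * G = (Omega_trunc N (A + B) - Omega_trunc N A * Omega_trunc N B)
      + (Omega_trunc N A - F) * Omega_trunc N B + F * (Omega_trunc N B - G)"
    by (simp add: algebra_simps)
  moreover have "W (Suc N) \<dots>"
    using A B omega_W0[OF A]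
    by (intro W_add Omega_trunc_add W_mult_left W_mult_right W_Omega_trunc) (auto simp: omega_def)
  ultimately show "W (Suc N) (Omega_trunc N (A + B) - F * G)" by (simp only:)
qed

lemma omega_0: "omega 0 1"
proof -
  have "Omega_trunc N 0 = 1" for N
  proof -
    have "expo N 0 = 0" by (simp add: expo_def p_at_0)
    then have "Omega_trunc N 0 = (\<Sum>r\<le>N. if r = 0 then 1 else 0)"
      unfolding Omega_trunc_eq by (intro sum.cong) (auto simp: ratc_hom power_0_left)
    then show ?thesis by simp
  qed
  then show ?thesis by (simp add: omega_def)
qed

lemma omega_sum:
  "finite I \<Longrightarrow> (\<And>i. i \<in> I \<Longrightarrow> omega (A i) (F i)) \<Longrightarrow> omega (\<Sum>i\<in>I. A i) (\<Prod>i\<in>I. F i)"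
  by (induction I rule: finite_induct) (auto simp: omega_0 omega_add)

text \<open>The truncations at A and -A multiply to 1 up to weight N, while F and G do so exactly.
  Hence an inverse without negative weights of a known exponential is the exponential of the
  opposite alphabet.\<close>

lemma omega_uminus:
  assumes A: "omega A F" and FG: "F * G = 1" and G: "W 0 G"
  shows "omega (- A) G"
  unfolding omega_def
proof (intro conjI allI)
  show mA: "W 1 (- A)" using A by (auto simp: omega_def intro: W_uminus)
  fix N
  let ?T = "Omega_trunc N"
  have "W (Suc N) (?T (A + - A) - ?T A * ?T (- A))"
    using A mA by (intro Omega_trunc_add) (auto simp: omega_def)
  moreover have "?T (A + - A) = ?T 0" by simp
  moreover have "W (Suc N) (?T 0 - 1)" using omega_0 by (simp add: omega_def)
  ultimately have 1: "W (Suc N) (?T A * ?T (- A) - 1)"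
    using W_diff[of "Suc N" "?T 0 - 1" "?T 0 - ?T A * ?T (- A)"] by simp
  have "?T (- A) - G = ?T (- A) * (F * G) - G" by (simp add: FG)
  also have "\<dots> = (?T A * ?T (- A) - 1) * G - (?T A - F) * (?T (- A) * G)"
    by (simp add: algebra_simps)
  also have "W (Suc N) \<dots>"
  proof (rule W_diff)
    show "W (Suc N) ((?T A * ?T (- A) - 1) * G)" using 1 G by (rule W_mult_left)
    have "W 0 (?T (- A) * G)" using W_Omega_trunc[OF mA] G by (rule W_mult_left)
    then show "W (Suc N) ((?T A - F) * (?T (- A) * G))"
      using A by (intro W_mult_left[of _ _ "?T (- A) * G"]) (auto simp: omega_def)
  qed
  finally show "W (Suc N) (?T (- A) - G)" .
qed

end

text \<open>$\exp(\log(1 - t)) = 1 - t$ modulo $t^{N+1}$.\<close>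

lemma exp_log_trunc:
  fixes N :: nat
  defines "q \<equiv> - (\<Sum>k=1..N. monom (1 / of_nat k) k) :: rat poly"
  assumes "n \<le> N"
  shows "coeff (\<Sum>r\<le>N. [:1 / fact r:] * q ^ r) n = coeff [:1, - 1:] n"
proof -
  define L :: "rat fps" where "L = fps_ln 1 oo - fps_X"
  have L0: "fps_nth L 0 = 0" by (simp add: L_def)
  have Ln: "fps_nth L k = (if k = 0 then 0 else - (1 / of_nat k))" for k
  proof -
    have "fps_nth L k = (- 1) ^ k * fps_nth (fps_ln 1) k"
      unfolding L_def using fps_compose_linear[of "fps_ln 1" "- 1 :: rat"]
      by (metis (no_types, lifting) fps_compose_linear fps_const_neg fps_const_1_eq_1 mult_minus1 Abs_fps_inverse UNIV_I fps_nth_Abs_fps)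
    then show ?thesis
      by (cases k) (simp_all add: fps_ln_nth power_mult_distrib flip: power_add mult_2)
  qed
  have "(fps_exp 1 - 1) oo fps_ln 1 = (fps_X :: rat fps)"
    unfolding fps_ln_fps_exp_inv[of "1 :: rat", simplified] by (rule fps_inv_right) auto
  then have "(fps_exp 1 - 1) oo L = fps_X oo - (fps_X :: rat fps)"
    unfolding L_def by (subst fps_compose_assoc) auto
  then have "fps_exp 1 oo L = 1 - (fps_X :: rat fps)"
    by (simp add: fps_compose_sub_distrib diff_eq_eq)
  then have "fps_nth (1 - fps_X) n = (\<Sum>r\<le>n. (1 / fact r) * fps_nth (L ^ r) n)"
    using fps_compose_nth[of "fps_exp 1" L n] by (simp add: atLeast0AtMost)
  also have "\<dots> = (\<Sum>r\<le>N. (1 / fact r) * fps_nth (L ^ r) n)"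
    using \<open>n \<le> N\<close> L0 by (intro sum.mono_neutral_left) (auto simp: startsby_zero_power_prefix)
  also have "\<dots> = (\<Sum>r\<le>N. (1 / fact r) * coeff (q ^ r) n)"
  proof -
    have q: "coeff q k = fps_nth L k" if "k \<le> N" for k
      using that by (auto simp: q_def coeff_sum Ln)
    have "coeff (q ^ r) k = fps_nth (L ^ r) k" if "k \<le> N" for r k
      using that
    proof (induction r arbitrary: k)
      case (Suc r)
      then show ?case by (auto simp: coeff_mult fps_mult_nth atLeast0AtMost q intro!: sum.cong)
    qed (simp add: coeff_1)
    then show ?thesis using \<open>n \<le> N\<close> by simp
  qed
  also have "\<dots> = coeff (\<Sum>r\<le>N. [:1 / fact r:] * q ^ r) n"
    by (simp add: coeff_sum)
  finally show ?thesis
    by (auto simp: coeff_pCons split: nat.splits)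
qed

context weight
begin

text \<open>The truncated identity exp(log(1 - t)) = 1 - t is evaluated at t = b, where the Adams
  operations are powers. The error polynomial has no terms of degree up to N, and higher powers of b
  have weight above N.\<close>

lemma omega_monomial:
  assumes "W 1 b" and p: "\<And>k. k > 0 \<Longrightarrow> p_at k b = b ^ k"
  shows "omega (- b) (1 - b)"
  unfolding omega_def
proof (intro conjI allI)
  show "W 1 (- b)" using assms(1) by (rule W_uminus)
  fix N
  define q :: "rat poly" where "q = - (\<Sum>k=1..N. monom (1 / of_nat k) k)"
  define E where "E = (\<Sum>r\<le>N. [:1 / fact r:] * q ^ r) - [:1, - 1:]"
  interpret rp: map_poly_comm_ring_hom ratc ..
  have "poly (map_poly ratc q) b = expo N (- b)"
    by (auto simp: q_def expo_def rp.hom_uminus rp.hom_sum poly_sum poly_monom p_at_uminus p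
        sum_negf[symmetric] intro!: sum.cong)
  then have "poly (map_poly ratc E) b = Omega_trunc N (- b) - (1 - b)"
    by (simp add: E_def Omega_trunc_eq rp.hom_minus rp.hom_sum rp.hom_mult rp.hom_power poly_sum
        hom_distribs rp.hom_power ratc.hom_uminus)
  moreover have "W (Suc N) (poly (map_poly ratc E) b)"
    unfolding poly_altdef
  proof (rule W_sum)
    fix i
    show "W (Suc N) (coeff (map_poly ratc E) i * b ^ i)"
    proof (cases "i \<le> N")
      case True
      then have "coeff E i = 0"
        unfolding E_def q_def using exp_log_trunc[of i N] by simp
      then show ?thesis by simp
    next
      case False
      then show ?thesis
        using W_mono[OF W_power[OF assms(1)], of "Suc N" i] by (simp add: W_ratc_mult)
    qed
  qed
  ultimately show "W (Suc N) (Omega_trunc N (- b) - (1 - b))" by simp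
qed

end

interpretation xw: weight "\<lambda>m a. int (xdeg m)"
  by unfold_locales auto

lemma xw_W_iff: "xw.W (Suc d) F \<longleftrightarrow> deg_gt d F"
proof
  assume *: "xw.W (Suc d) F"
  show "deg_gt d F"
    unfolding deg_gt_def
  proof (intro allI impI)
    fix m assume "xdeg m \<le> d"
    then have "coef F m a = 0" for a using * by (force simp: xw.W_def)
    then show "xcoeff F m = 0" by (auto intro: poly_mapping_eqI)
  qed
next
  assume F: "deg_gt d F"
  show "xw.W (Suc d) F"
    unfolding xw.W_def
  proof (intro allI impI)
    fix m a assume "coef F m a \<noteq> 0"
    then have "\<not> xdeg m \<le> d" using F by (auto simp: deg_gt_def)
    then show "int (Suc d) \<le> int (xdeg m)" by simp
  qed
qed

context weight
begin

text \<open>Two filtrations cooperate. The weight w alone could produce infinitely many Laurent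
  monomials at one m in the limit; the degree in X makes the truncations at m constant from stage
  \<open>xdeg m\<close> on, so the limit has Laurent polynomials as coefficients. The weight then
  supplies the rate.\<close>

lemma omega_exists:
  assumes A: "W 1 A" "deg_gt 0 A"
  shows "omega A (Omega A)" and "xcoeff (Omega A) m = xcoeff (Omega_trunc (xdeg m) A) m"
proof -
  define F where "F = XSeries (\<lambda>m. xcoeff (Omega_trunc (xdeg m) A) m)"
  have gt: "deg_gt N (Omega_trunc N' A - Omega_trunc N A)" if "N \<le> N'" for N N'
    using xw.Omega_trunc_cauchy[OF _ that, of A] A(2) xw_W_iff[of 0 A] xw_W_iff by auto
  have "omega A F"
    unfolding omega_def
  proof (intro conjI allI)
    fix N
    show "W (Suc N) (Omega_trunc N A - F)"
      unfolding W_def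
    proof (intro allI impI, rule ccontr)
      fix m a
      assume nz: "coef (Omega_trunc N A - F) m a \<noteq> 0" and lt: "\<not> int (Suc N) \<le> w m a"
      let ?M = "max N (xdeg m)"
      have "coef (Omega_trunc ?M A) m a = coef (Omega_trunc N A) m a"
        using lt by (intro coef_eq_if_W[OF Omega_trunc_cauchy[OF A(1)], of N]) auto
      moreover have "xcoeff (Omega_trunc ?M A) m = xcoeff F m"
        using gt[of "xdeg m" ?M] by (simp add: deg_gt_def F_def)
      ultimately show False using nz by (simp add: lookup_minus)
    qed
  qed (fact A)
  then show "omega A (Omega A)" "xcoeff (Omega A) m = xcoeff (Omega_trunc (xdeg m) A) m"
    using Omega_eqI[of A F] by (auto simp: F_def)
qed

end

lemma ratc_simps [simp]: "bdeg (ratc c)" "over S (ratc c)" "symmetric_series (ratc c)"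
  by (simp_all add: ratc_def)

lemma bdeg_Omega_trunc [simp]: "bdeg A \<Longrightarrow> bdeg (Omega_trunc N A)"
  unfolding Omega_trunc_def by simp

lemma over_Omega_trunc [simp]: "over S A \<Longrightarrow> over S (Omega_trunc N A)"
  unfolding Omega_trunc_def by simp

lemma symmetric_series_Omega_trunc [simp]:
  "symmetric_series A \<Longrightarrow> symmetric_series (Omega_trunc N A)"
  unfolding Omega_trunc_def
  by (intro symmetric_series_sum symmetric_series_mult symmetric_series_power ratc_simps p_at_symmetric) auto


section \<open>Adding a variable to the alphabet\<close>

text \<open>\<open>tau q G\<close> is $G[X + z_q]$.\<close>

definition tau :: "nat \<Rightarrow> ser \<Rightarrow> ser"
  where "tau q G = (\<Sum>k | D k G \<noteq> 0. zpow q (int k) * D k G)"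

lemma zpow_add: "zpow i (e + f) = zpow i e * zpow i f"
  by (simp add: zpow_def single_add zmonom_add)

lemma zpow_0 [simp]: "zpow i 0 = 1"
  by (simp add: zpow_def zmonom_0)

lemma zpow_eq_xconst: "zpow i e = xconst (single (single i e) 1)"
  by (simp add: zpow_def zmonom_def)

lemma zpow_bdeg [simp]: "bdeg (zpow i e)"
  by (simp add: zpow_eq_xconst)

lemma over_zpow [simp]: "i \<in> A \<Longrightarrow> over A (zpow i e)"
  by (simp add: zpow_eq_xconst)

lemma tau_eq:
  assumes "\<And>k. k > B \<Longrightarrow> D k G = 0"
  shows "tau q G = (\<Sum>k\<le>B. zpow q (int k) * D k G)"
  unfolding tau_def
proof (rule sum.mono_neutral_left)
  show "{k. D k G \<noteq> 0} \<subseteq> {..B}"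
    using assms by (auto simp: not_less[symmetric])
qed auto

lemma tau_eq_deg: "deg_le B G \<Longrightarrow> tau q G = (\<Sum>k\<le>B. zpow q (int k) * D k G)"
  by (rule tau_eq) (rule D_eq_0_deg_le)

lemma bdeg_tau [simp]: "bdeg G \<Longrightarrow> bdeg (tau q G)"
  unfolding tau_def by simp

lemma tau_add:
  assumes "bdeg F" "bdeg G"
  shows "tau q (F + G) = tau q F + tau q G"
proof -
  obtain d e where "deg_le d F" "deg_le e G" using assms by (auto simp: bdeg_def)
  then have d: "deg_le (d + e) F" "deg_le (d + e) G" by (auto intro: deg_le_mono)
  from d deg_le_add[OF d] show ?thesis
    by (simp add: tau_eq_deg[where B = "d + e"] distrib_left sum.distrib)
qed

lemma tau_mult:
  assumes "bdeg F" "bdeg G"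
  shows "tau q (F * G) = tau q F * tau q G"
proof -
  obtain d e where d: "deg_le d F" "deg_le e G" using assms by (auto simp: bdeg_def)
  define f where "f i j = zpow q (int i) * D i F * (zpow q (int j) * D j G)" for i j
  have "zpow q (int k) * D k (F * G) = (\<Sum>i\<le>k. f i (k - i))" for k
  proof -
    have "zpow q (int k) = zpow q (int i) * zpow q (int (k - i))" if "i \<le> k" for i
      using that by (simp add: of_nat_diff flip: zpow_add)
    then show ?thesis
      unfolding D_mult sum_distrib_left f_def by (intro sum.cong) (auto simp: mult_ac)
  qed
  then have "tau q (F * G) = (\<Sum>k\<le>d + e. \<Sum>i\<le>k. f i (k - i))"
    using deg_le_mult[OF d] by (simp add: tau_eq_deg)
  also have "\<dots> = (\<Sum>(i, j) | i + j \<le> d + e. f i j)"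
    by (rule sum.triangle_reindex_eq[symmetric])
  also have "\<dots> = (\<Sum>(i, j)\<in>{..d} \<times> {..e}. f i j)"
  proof (rule sum.mono_neutral_right)
    show "finite {(i, j). i + j \<le> d + e}"
      by (rule finite_subset[of _ "{..d + e} \<times> {..d + e}"]) auto
    show "\<forall>p\<in>{(i, j). i + j \<le> d + e} - {..d} \<times> {..e}. (case p of (i, j) \<Rightarrow> f i j) = 0"
    proof
      fix p assume p: "p \<in> {(i, j). i + j \<le> d + e} - {..d} \<times> {..e}"
      obtain i j where ij: "p = (i, j)" by (cases p)
      with p have "i > d \<or> j > e" by auto
      then show "(case p of (i, j) \<Rightarrow> f i j) = 0"
        using D_eq_0_deg_le[OF d(1), of i] D_eq_0_deg_le[OF d(2), of j] by (auto simp: ij f_def)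
    qed
  qed auto
  also have "\<dots> = tau q F * tau q G"
    unfolding tau_eq_deg[OF d(1)] tau_eq_deg[OF d(2)] sum_product sum.cartesian_product f_def by simp
  finally show ?thesis .
qed

lemma tau_xconst [simp]: "tau q (xconst c) = xconst c"
  using tau_eq_deg[of 0 "xconst c" q] by (simp add: D_xconst)

lemma tau_zpow [simp]: "tau q (zpow i e) = zpow i e"
  by (simp add: zpow_eq_xconst)

lemma bdeg_complete_hom [simp]: "bdeg (hc k)"
  using complete_hom_LambdaZ[of k] by (simp add: LambdaZ_iff)

lemma tau_ratc [simp]: "tau q (ratc c) = ratc c"
  by (simp add: ratc_def)

lemma tau_1 [simp]: "tau q 1 = 1"
  using tau_xconst[of q 1] by (simp add: xconst_hom)

lemma tau_0 [simp]: "tau q 0 = 0"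
  using tau_xconst[of q 0] by (simp add: xconst_hom)

lemma tau_uminus: "bdeg F \<Longrightarrow> tau q (- F) = - tau q F"
  using tau_add[of F "- F" q] by (simp add: eq_neg_iff_add_eq_0 add.commute)

lemma tau_power: "bdeg F \<Longrightarrow> tau q (F ^ k) = tau q F ^ k"
  by (induction k) (simp_all add: tau_mult)

lemma tau_sum: "(\<And>i. i \<in> I \<Longrightarrow> bdeg (F i)) \<Longrightarrow> tau q (\<Sum>i\<in>I. F i) = (\<Sum>i\<in>I. tau q (F i))"
  by (induction I rule: infinite_finite_induct) (auto simp: tau_add)

lemma tau_prod: "(\<And>i. i \<in> I \<Longrightarrow> bdeg (F i)) \<Longrightarrow> tau q (\<Prod>i\<in>I. F i) = (\<Prod>i\<in>I. tau q (F i))"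
  by (induction I rule: infinite_finite_induct) (auto simp: tau_mult)

lemma kz_single: "kz k (single q e) = single q (int k * e)"
  by (rule poly_mapping_eqI) (simp add: lookup_single when_def)

text \<open>The Adams operation raises the added variable to the k-th power on both sides: the
  exponents of \<open>x_0\<close> on the left are multiples k i, and \<open>z_q^(k i)\<close> is the
  image of \<open>z_q^i\<close>.\<close>

lemma tau_p_at:
  assumes "bdeg A" "k > 0"
  shows "tau q (p_at k A) = p_at k (tau q A)"
proof -
  obtain d where d: "deg_le d A" using assms by (auto simp: bdeg_def)
  have D0: "D j (p_at k A) = 0" if "j > k * d" for j
  proof (cases "k dvd j")
    case True
    then obtain i where i: "j = k * i" by blast
    with that have "i > d" by simp
    then show ?thesis
      using assms(2) D_eq_0_deg_le[OF d] by (simp add: D_p_at i p_at_0)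
  qed (simp add: D_p_at assms)
  have "tau q (p_at k A) = (\<Sum>j\<le>k * d. zpow q (int j) * D j (p_at k A))"
    by (rule tau_eq) (rule D0)
  also have "\<dots> = (\<Sum>j\<in>(\<lambda>i. k * i) ` {..d}. zpow q (int j) * D j (p_at k A))"
  proof (rule sum.mono_neutral_right)
    show "\<forall>j\<in>{..k * d} - (\<lambda>i. k * i) ` {..d}. zpow q (int j) * D j (p_at k A) = 0"
    proof
      fix j assume j: "j \<in> {..k * d} - (\<lambda>i. k * i) ` {..d}"
      have "\<not> k dvd j"
      proof
        assume "k dvd j"
        then obtain i where "j = k * i" by blast
        then show False using j assms(2) by auto
      qed
      then show "zpow q (int j) * D j (p_at k A) = 0" by (simp add: D_p_at assms(2))
    qed
  qed (use assms(2) in auto)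
  also have "\<dots> = (\<Sum>i\<le>d. zpow q (int (k * i)) * D (k * i) (p_at k A))"
    using assms(2) by (subst sum.reindex) (auto simp: inj_on_def)
  also have "\<dots> = (\<Sum>i\<le>d. p_at k (zpow q (int i) * D i A))"
    using assms(2) by (intro sum.cong) (simp_all add: D_p_at zpow_def p_at_zmonom_mult kz_single)
  also have "\<dots> = p_at k (tau q A)"
    using assms(2) by (simp add: tau_eq_deg[OF d] p_at_sum)
  finally show ?thesis .
qed

lemma tau_Omega_trunc:
  assumes "bdeg A"
  shows "tau q (Omega_trunc N A) = Omega_trunc N (tau q A)"
  unfolding Omega_trunc_def using assms
  by (simp add: tau_sum tau_mult tau_power tau_p_at)


section \<open>Extracting powers of one indeterminate\<close>

definition zextl :: "nat \<Rightarrow> int \<Rightarrow> laurent \<Rightarrow> laurent"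
  where "zextl q l c =
    Abs_poly_mapping (\<lambda>a. if lookup a q = 0 then lookup c (a + single q l) else 0)"

lemma lookup_zextl:
  "lookup (zextl q l c) a = (if lookup a q = 0 then lookup c (a + single q l) else 0)"
proof -
  have "{a. (if lookup a q = 0 then lookup c (a + single q l) else 0) \<noteq> 0}
      \<subseteq> (\<lambda>b. b - single q l) ` keys c"
  proof
    fix a assume "a \<in> {a. (if lookup a q = 0 then lookup c (a + single q l) else 0) \<noteq> 0}"
    then have "a + single q l \<in> keys c" by (auto simp: in_keys_iff split: if_splits)
    then show "a \<in> (\<lambda>b. b - single q l) ` keys c"
      by (intro image_eqI[of _ _ "a + single q l"]) simp_all
  qed
  then have "finite {a. (if lookup a q = 0 then lookup c (a + single q l) else 0) \<noteq> 0}"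
    by (rule finite_subset) simp
  then show ?thesis by (simp add: zextl_def)
qed

definition zext :: "nat \<Rightarrow> int \<Rightarrow> ser \<Rightarrow> ser"
  where "zext q l F = XSeries (\<lambda>m. zextl q l (xcoeff F m))"

lemma xcoeff_zext: "xcoeff (zext q l F) m = zextl q l (xcoeff F m)"
  by (simp add: zext_def)

lemma coef_zext:
  "coef (zext q l F) m a = (if lookup a q = 0 then coef F m (a + single q l) else 0)"
  by (simp add: xcoeff_zext lookup_zextl)

lemma zext_linear:
  "zext q l 0 = 0" "zext q l (F + G) = zext q l F + zext q l G" "zext q l (- F) = - zext q l F"
  "zext q l (F - G) = zext q l F - zext q l G"
  by (auto intro!: ser_eqI simp: coef_zext lookup_add lookup_minus)

lemma zext_sum: "zext q l (\<Sum>i\<in>I. F i) = (\<Sum>i\<in>I. zext q l (F i))"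
  by (induction I rule: infinite_finite_induct) (auto simp: zext_linear)

lemma zext_zpow_mult: "zext q l (zpow q s * F) = zext q (l - s) F"
proof (rule ser_eqI)
  fix m a
  show "coef (zext q l (zpow q s * F)) m a = coef (zext q (l - s) F) m a"
    by (simp add: coef_zext zpow_def add_diff_eq[symmetric] single_diff)
qed

lemma laurent_eq_sum: "(c :: laurent) = (\<Sum>a\<in>keys c. single a (lookup c a))"
proof (rule poly_mapping_eqI)
  fix b
  have "lookup (\<Sum>a\<in>keys c. single a (lookup c a)) b
      = (\<Sum>a\<in>keys c. if a = b then lookup c a else 0)"
    unfolding lookup_sum by (intro sum.cong) (auto simp: lookup_single)
  then show "lookup c b = lookup (\<Sum>a\<in>keys c. single a (lookup c a)) b"
    by (auto simp: in_keys_iff)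
qed

lemma zextl_linear: "zextl q l 0 = 0" "zextl q l (c + d) = zextl q l c + zextl q l d"
  by (auto intro!: poly_mapping_eqI simp: lookup_zextl lookup_add)

lemma zextl_sum: "zextl q l (\<Sum>i\<in>I. c i) = (\<Sum>i\<in>I. zextl q l (c i))"
  by (induction I rule: infinite_finite_induct) (auto simp: zextl_linear)

lemma zextl_mult:
  assumes "y \<in> lover (- {q})"
  shows "zextl q l (y * c) = y * zextl q l c"
proof -
  have "zextl q l (single b r * c) = single b r * zextl q l c"
    if "b \<in> keys y" for b r
  proof (rule poly_mapping_eqI)
    fix a
    have "lookup b q = 0"
      using that assms by (auto simp: lover_def in_keys_iff)
    then show "lookup (zextl q l (single b r * c)) a
        = lookup (single b r * zextl q l c) a"
      by (simp add: lookup_zextl lookup_single_mult lookup_minus diff_add_eq)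
  qed
  then have "zextl q l ((\<Sum>b\<in>keys y. single b (lookup y b)) * c)
      = (\<Sum>b\<in>keys y. single b (lookup y b)) * zextl q l c"
    by (simp add: sum_distrib_right zextl_sum)
  then show ?thesis using laurent_eq_sum[of y] by simp
qed

lemma zext_mult:
  assumes "over (- {q}) Y"
  shows "zext q l (Y * F) = Y * zext q l F"
proof (rule xseries_eqI)
  fix m
  show "xcoeff (zext q l (Y * F)) m = xcoeff (Y * zext q l F) m"
    unfolding xcoeff_zext xcoeff_mult zextl_sum
    using assms by (auto intro!: sum.cong simp: zextl_mult over_def)
qed

lemma zext_over:
  assumes "over (- {q}) Y"
  shows "zext q l Y = (if l = 0 then Y else 0)"
proof (rule ser_eqI)
  fix m a
  have *: "coef Y m b = 0" if "lookup b q \<noteq> 0" for b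
  proof (rule ccontr)
    assume "coef Y m b \<noteq> 0"
    then have "b \<in> keys (xcoeff Y m)" by (simp add: in_keys_iff)
    then have "keys b \<subseteq> - {q}" using assms by (auto simp: over_def lover_def)
    then show False using that by (auto simp: in_keys_iff)
  qed
  have "lookup (a + single q l) q = lookup a q + l"
    by (simp add: lookup_add)
  then show "coef (zext q l Y) m a = coef (if l = 0 then Y else 0) m a"
    using *[of a] *[of "a + single q l"] by (auto simp: coef_zext)
qed

text \<open>As G is free of \<open>z_q\<close>, that indeterminate records the power of the added
  variable and nothing else.\<close>

lemma zext_tau:
  assumes "over (- {q}) G" "bdeg G"
  shows "zext q (int k) (tau q G) = D k G"
proof -
  obtain d where d: "deg_le d G" using assms by (auto simp: bdeg_def)
  have "tau q G = (\<Sum>j\<le>max d k. zpow q (int j) * D j G)"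
    by (rule tau_eq_deg) (rule deg_le_mono[OF d], simp)
  then have "zext q (int k) (tau q G) = (\<Sum>j\<le>max d k. if j = k then D k G else 0)"
    using assms(1) by (auto simp: zext_sum zext_zpow_mult zext_over intro!: sum.cong)
  then show ?thesis by simp
qed


section \<open>Evaluation of exponentials\<close>

definition zsum :: "zmon \<Rightarrow> int"
  where "zsum a = (\<Sum>i\<in>keys a. lookup a i)"

lemma zsum_eq: "finite A \<Longrightarrow> keys a \<subseteq> A \<Longrightarrow> zsum a = (\<Sum>i\<in>A. lookup a i)"
  unfolding zsum_def by (rule sum.mono_neutral_left) (auto simp: in_keys_iff)

lemma zsum_add: "zsum (a + b) = zsum a + zsum b"
proof -
  have "zsum (a + b) = (\<Sum>i\<in>keys a \<union> keys b. lookup (a + b) i)"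
    using keys_add[of a b] by (intro zsum_eq) auto
  also have "\<dots> = zsum a + zsum b"
    by (simp add: lookup_add sum.distrib zsum_eq[of "keys a \<union> keys b"])
  finally show ?thesis .
qed

lemma zsum_kz: "zsum (kz k a) = int k * zsum a"
  by (subst zsum_eq[of "keys a"]) (auto simp: zsum_def sum_distrib_left in_keys_iff)

lemma zsum_single [simp]: "zsum (single i e) = e"
  by (simp add: zsum_def)

text \<open>
  The indeterminate \<open>z\<^sub>q\<close>, which plays the role of the added variable, has weight 2, so that
  the alphabets \<open>z\<^sub>i\<^sup>-\<^sup>1X\<close> and \<open>z\<^sub>i\<^sup>-\<^sup>1z\<^sub>q\<close> have positive weight.
\<close>

definition zwt :: "nat \<Rightarrow> xmon \<Rightarrow> zmon \<Rightarrow> int"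
  where "zwt q m a = 2 * int (xdeg m) + zsum a + lookup a q"

interpretation zw: weight "zwt q" for q
  by unfold_locales (simp_all add: zwt_def zsum_add lookup_add zsum_kz algebra_simps)

lemma zw_W_rational:
  assumes "over {} A" "deg_gt 0 A"
  shows "zw.W q 1 A"
  unfolding zw.W_def
proof (intro allI impI)
  fix m a assume nz: "coef A m a \<noteq> 0"
  then have "a \<in> keys (xcoeff A m)" by (simp add: in_keys_iff)
  then have "keys a = {}" using assms(1) by (auto simp: over_def lover_def)
  then have "a = 0" by simp
  then have "zwt q m a = 2 * int (xdeg m)" by (simp add: zwt_def zsum_def)
  moreover have "\<not> xdeg m \<le> 0" using assms(2) nz by (auto simp: deg_gt_def)
  ultimately show "int 1 \<le> zwt q m a" by linarith
qed

lemma zw_W_zmonom_mult: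
  assumes "zw.W q d F" "e \<le> d + zsum a + lookup a q" "e \<ge> 0"
  shows "zw.W q (nat e) (zmonom a * F)"
  unfolding zw.W_def
proof (intro allI impI)
  fix m b assume "coef (zmonom a * F) m b \<noteq> 0"
  then have "int d \<le> zwt q m (b - a)" using assms(1) by (simp add: zw.W_def)
  also have "zwt q m (b - a) = zwt q m b - zsum a - lookup a q"
    using zsum_add[of "b - a" a] by (simp add: zwt_def lookup_minus)
  finally show "int (nat e) \<le> zwt q m b" using assms(2,3) by simp
qed

lemma omega_uminus_zmonom:
  assumes "zsum a + lookup a q \<ge> 1"
  shows "zw.omega q (- zmonom a) (1 - zmonom a)"
proof (rule zw.omega_monomial)
  show "zw.W q 1 (zmonom a)"
    using zw_W_zmonom_mult[of q 0 1 1 a] assms by simp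
qed (rule p_at_zmonom_power)

text \<open>Formally Omega[A + B] = Omega[A] Omega[B], where A + B is A after adding
  \<open>z_q\<close>. Since \<open>tau\<close> is a finite sum it is applied to the truncations,
  which have bounded degree, and the coefficients are compared in the limit.\<close>

theorem D_Omega:
  assumes A: "over (- {q}) A" "bdeg A" "deg_gt 0 A" "zw.W q 1 A"
    and tau: "tau q A = A + B" and B: "zw.omega q B F"
  shows "D k (Omega A) = zext q (int k) (Omega A * F)"
proof (rule ser_eqI)
  fix m a
  let ?s = "single q (int k)"
  have om: "zw.omega q A (Omega A)" using A(4,3) by (rule zw.omega_exists)
  have "\<forall>\<^sub>F N in sequentially. coef (Omega_trunc N A) (xcons k m) a = coef (Omega A) (xcons k m) a"
    by (rule zw.omega_limit[OF om])
  moreover have "\<forall>\<^sub>F N in sequentially.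
      coef (Omega_trunc N (A + B)) m (a + ?s) = coef (Omega A * F) m (a + ?s)"
    by (rule zw.omega_limit[OF zw.omega_add[OF om B]])
  ultimately have "\<forall>\<^sub>F N in sequentially.
      coef (D k (Omega A)) m a = coef (zext q (int k) (Omega A * F)) m a"
  proof eventually_elim
    case (elim N)
    have "coef (D k (Omega_trunc N A)) m a = coef (zext q (int k) (Omega_trunc N (A + B))) m a"
      using zext_tau[of q "Omega_trunc N A" k] A by (simp add: tau_Omega_trunc tau)
    then show ?case using elim by (simp add: coef_zext)
  qed
  then show "coef (D k (Omega A)) m a = coef (zext q (int k) (Omega A * F)) m a" by simp
qed

lemma alphX_eq: "alphX = hc 1"
proof (rule xseries_eqI)
  fix m
  have "xdeg m = 1 \<longleftrightarrow> (\<exists>i. m = single i 1)"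
  proof
    assume m1: "xdeg m = 1"
    then have "m \<noteq> 0" by auto
    then obtain i where i: "lookup m i \<ge> 1"
      by (metis One_nat_def Suc_leI lookup_zero neq0_conv poly_mapping_eqI)
    define b where "b = m - single i 1"
    have m: "m = single i 1 + b"
      by (rule poly_mapping_eqI)
         (use i in \<open>auto simp: b_def lookup_add lookup_minus lookup_single when_def\<close>)
    have "xdeg b = 0" using m1 unfolding m by simp
    then show "\<exists>i. m = single i 1" using m by auto
  qed (auto simp: xdeg_single)
  then show "xcoeff alphX m = xcoeff (hc 1) m"
    by (auto simp: alphX_def)
qed

lemma tau_complete_hom: "tau q (hc (int l)) = (\<Sum>k\<le>l. zpow q (int k) * hc (int l - int k))"
  by (subst tau_eq[where B = l]) auto

lemma tau_complete_hom_1: "tau q (hc 1) = hc 1 + zpow q 1"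
  using tau_complete_hom[of q 1] by simp

lemma tau_complete_hom_2:
  "tau q (hc 2) = hc 2 + zpow q 1 * hc 1 + zpow q 2"
  using tau_complete_hom[of q 2] by (simp add: numeral_2_eq_2)

section \<open>Exponentials of X scaled by a monomial\<close>

definition cz :: "nat \<Rightarrow> int \<Rightarrow> laurent"
  where "cz i e = single (single i e) 1"

lemma xconst_cz: "xconst (cz i e) = zpow i e"
  by (simp add: cz_def zpow_eq_xconst)

lemma cz_power: "cz i e ^ k = cz i (int k * e)"
  by (induction k) (simp_all add: cz_def mult_single algebra_simps flip: single_add)

text \<open>For a monomial \<open>c\<close> in the \<open>z\<^sub>i\<close>, \<open>Hs c\<close> and \<open>Es c\<close> are $\Omega[cX]$ and $\Omega[-cX]$.\<close>

definition Hs :: "laurent \<Rightarrow> ser"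
  where "Hs c = XSeries (\<lambda>m. c ^ xdeg m)"

definition sqfree :: "xmon \<Rightarrow> bool"
  where "sqfree m \<longleftrightarrow> (\<forall>i. lookup m i \<le> 1)"

definition Es :: "laurent \<Rightarrow> ser"
  where "Es c = XSeries (\<lambda>m. if sqfree m then (- c) ^ xdeg m else 0)"

text \<open>The signed elementary symmetric function $(-1)^k e_k$.\<close>

definition es :: "nat \<Rightarrow> ser"
  where "es k = XSeries (\<lambda>m. if sqfree m \<and> xdeg m = k then (- 1) ^ k else 0)"

lemma xcoeff_Hs_Es [simp]:
  "xcoeff (Hs c) m = c ^ xdeg m" "xcoeff (Es c) m = (if sqfree m then (- c) ^ xdeg m else 0)"
  "xcoeff (es k) m = (if sqfree m \<and> xdeg m = k then (- 1) ^ k else 0)"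
  by (simp_all add: Hs_def Es_def es_def)

lemma coef_Hs_cz: "coef (Hs (cz i e)) m a = (if a = single i (int (xdeg m) * e) then 1 else 0)"
  unfolding xcoeff_Hs_Es cz_power by (simp add: cz_def lookup_single when_def eq_commute)

lemma coef_Es_cz:
  "coef (Es (cz i e)) m a =
    (if sqfree m \<and> a = single i (int (xdeg m) * e) then (- 1) ^ xdeg m else 0)"
proof -
  have "lookup ((- cz i e) ^ k) a = (if a = single i (int k * e) then (- 1) ^ k else 0)" for k
    unfolding power_minus[of "cz i e"] cz_power
    by (cases "even k") (auto simp: cz_def lookup_single when_def)
  then show ?thesis by (cases "sqfree m") simp_all
qed

lemma coef_es: "coef (es k) m a = (if sqfree m \<and> xdeg m = k \<and> a = 0 then (- 1) ^ k else 0)"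
  by (cases "even k") (auto simp: lookup_one when_def)

lemma sqfree_xcons: "sqfree (xcons k m) \<longleftrightarrow> k \<le> 1 \<and> sqfree m"
proof
  assume *: "sqfree (xcons k m)"
  have "k \<le> 1" using *[unfolded sqfree_def, rule_format, of 0] by simp
  moreover have "lookup m i \<le> 1" for i using *[unfolded sqfree_def, rule_format, of "Suc i"] by simp
  ultimately show "k \<le> 1 \<and> sqfree m" by (simp add: sqfree_def)
next
  assume "k \<le> 1 \<and> sqfree m"
  then show "sqfree (xcons k m)" by (auto simp: sqfree_def lookup_xcons split: nat.split)
qed

lemma sqfree_map_key: "bij \<pi> \<Longrightarrow> sqfree (map_key \<pi> m) \<longleftrightarrow> sqfree m"
proof -
  assume pi: "bij \<pi>"
  have "(\<forall>i. lookup m (\<pi> i) \<le> 1) \<longleftrightarrow> (\<forall>i. lookup m i \<le> 1)"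
    using bij_is_surj[OF pi] by (metis surj_def)
  then show ?thesis
    using bij_is_inj[OF pi] by (simp add: sqfree_def map_key.rep_eq)
qed

lemma symmetric_Hs_Es [simp]:
  "symmetric_series (Hs c)" "symmetric_series (Es c)" "symmetric_series (es k)"
  by (simp_all add: symmetric_series_def xdeg_map_key sqfree_map_key)

lemma sqfree_0 [simp]: "sqfree 0"
  by (simp add: sqfree_def)

lemma D_Hs: "D k (Hs c) = xconst (c ^ k) * Hs c"
  by (rule xseries_eqI) (simp add: power_add)

lemma D_Es: "D k (Es c) = (if k = 0 then Es c else if k = 1 then - (xconst c * Es c) else 0)"
  by (rule xseries_eqI) (auto simp: sqfree_xcons)

lemma toh_Es: "toh (Es c) = fps_const (Es c) * (1 - fps_const (xconst c) * fps_X)"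
proof (rule fps_ext)
  fix k
  show "fps_nth (toh (Es c)) k = fps_nth (fps_const (Es c) * (1 - fps_const (xconst c) * fps_X)) k"
    by (cases k) (auto simp: D_Es algebra_simps fps_X_nth)
qed

lemma toh_Hs: "toh (Hs c) = fps_const (Hs c) * Abs_fps (\<lambda>k. xconst c ^ k)"
  by (rule fps_ext) (simp add: D_Hs xconst_power mult.commute)

text \<open>Adding t to the alphabet multiplies the factors by 1 - ct and by its inverse geometric
  series. The product is therefore unaffected by added variables and equals its constant term
  1.\<close>

lemma Es_Hs: "Es c * Hs c = 1"
proof -
  have geo: "(1 - fps_const x * fps_X) * Abs_fps (\<lambda>k. x ^ k) = 1" for x :: ser
  proof (rule fps_ext)
    fix k show "fps_nth ((1 - fps_const x * fps_X) * Abs_fps (\<lambda>k. x ^ k)) k = fps_nth 1 k"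
      by (cases k) (auto simp: left_diff_distrib mult.assoc fps_X_mult_nth)
  qed
  have "toh (Es c * Hs c) = fps_const (Es c * Hs c) * ((1 - fps_const (xconst c) * fps_X) * Abs_fps (\<lambda>k. xconst c ^ k))"
    by (simp add: toh_hom toh_Es toh_Hs mult_ac flip: fps_const_mult)
  then have toh: "toh (Es c * Hs c) = fps_const (Es c * Hs c)" by (simp only: geo mult_1_right)
  show ?thesis
  proof (rule D_eqI)
    show "D k (Es c * Hs c) = D k 1" if "k > 0" for k
      using arg_cong[OF toh, of "\<lambda>f. fps_nth f k"] that by (simp add: D_one)
    show "D 0 (Es c * Hs c) = Es c * Hs c"
      using arg_cong[OF toh, of "\<lambda>f. fps_nth f 0"] by simp
  qed (simp_all add: xcoeff_mult_0 xcoeff_one D_one)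
qed

lemma zw_W_zX:
  assumes "e \<ge> -1" "q \<noteq> i \<or> e \<ge> 0"
  shows "zw.W q 1 (zpow i e * alphX)"
proof -
  have "zw.W q 2 alphX"
    unfolding zw.W_def
  proof (intro allI impI)
    fix m a assume "coef alphX m a \<noteq> 0"
    then have "xdeg m = 1" "a = 0" by (auto simp: alphX_eq lookup_one split: if_splits)
    then show "int 2 \<le> zwt q m a" by (simp add: zwt_def zsum_def)
  qed
  then show ?thesis
    using zw_W_zmonom_mult[of q 2 alphX 1 "single i e"] assms
    by (auto simp: zpow_def lookup_single when_def)
qed

lemma deg_gt_zX: "deg_gt 0 (zpow i e * alphX)"
  by (intro deg_gt_mult(2)) (auto simp: deg_gt_def alphX_eq)

lemma deg_gt_uminus: "deg_gt d F \<Longrightarrow> deg_gt d (- F)"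
  by (simp add: deg_gt_def)

lemma over_alphX [simp]: "over A alphX"
  and symmetric_alphX [simp]: "symmetric_series alphX"
  and bdeg_alphX [simp]: "bdeg alphX"
  using complete_hom_LambdaZ[of 1] by (auto simp: alphX_eq LambdaZ_iff)

text \<open>\<open>D_Omega\<close> with the added monomial \<open>z_i^e z_q\<close> gives the
  recursion \<open>D_Es\<close>, and both series have constant term 1, so all coefficients agree.
  The bound on e keeps the alphabet at positive weight, as each variable of X counts 2.\<close>

lemma Omega_uminus_zX:
  assumes e: "e \<ge> -1"
  shows "Omega (- (zpow i e * alphX)) = Es (cz i e)"
proof -
  \<comment> \<open>Any index other than i serves: the added variable must be distinct from
    \<open>z_i\<close>.\<close>
  define q where "q = Suc i"
  have q: "q \<noteq> i" by (simp add: q_def)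
  let ?A = "- (zpow i e * alphX)" and ?z = "single i e + single q 1"
  let ?O = "Omega ?A"
  have z: "zmonom ?z = zpow i e * zpow q 1"
    by (simp add: zpow_def zmonom_add)
  have tau: "tau q ?A = ?A + - zmonom ?z"
    unfolding alphX_eq z by (simp add: tau_uminus tau_mult tau_complete_hom_1 distrib_left)
  have W: "zw.W q 1 ?A" using zw_W_zX[OF e, of q i] q by (intro zw.W_uminus) simp
  have gt: "deg_gt 0 ?A" by (intro deg_gt_uminus deg_gt_zX)
  have over: "over (- {q}) ?A" using q by simp
  have om: "zw.omega q (- zmonom ?z) (1 - zmonom ?z)"
    using e q by (intro omega_uminus_zmonom) (simp add: zsum_add lookup_add lookup_single)
  have overO: "over (- {q}) ?O"
    unfolding over_def zw.omega_exists(2)[OF W gt] using over_Omega_trunc[OF over] by (simp add: over_def)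
  have "D k ?O = zext q (int k) (?O * (1 - zmonom ?z))" for k
    using over W gt tau om by (intro D_Omega) auto
  also have "?O * (1 - zmonom ?z) = ?O - zpow q 1 * (zpow i e * ?O)"
    by (simp add: z algebra_simps)
  also have "zext q (int k) \<dots> = (if k = 0 then ?O else if k = 1 then - (zpow i e * ?O) else 0)" for k
  proof -
    have "over (- {q}) (zpow i e * ?O)" using q overO by simp
    then show ?thesis using overO by (simp add: zext_linear zext_zpow_mult zext_over)
  qed
  finally have D: "D k ?O = (if k = 0 then ?O else if k = 1 then - (zpow i e * ?O) else 0)" for k .
  show ?thesis
  proof (rule xseries_eqI)
    fix m
    show "xcoeff ?O m = xcoeff (Es (cz i e)) m"
    proof (induction m rule: xmon_induct)
      case zero
      have "Omega_trunc 0 ?A = 1" by (simp add: Omega_trunc_def ratc_hom)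
      then show ?case using zw.omega_exists(2)[OF W gt, of 0] by (simp add: xcoeff_one)
    next
      case (xcons k m)
      have "xcoeff ?O (xcons k m) = xcoeff (D k ?O) m" by simp
      also have "\<dots> = xcoeff (D k (Es (cz i e))) m"
        unfolding D D_Es using xcons by (auto simp: xconst_cz[symmetric])
      finally show ?case by simp
    qed
  qed
qed

lemma omega_uminus_zX:
  assumes "e \<ge> -1" "q \<noteq> i \<or> e \<ge> 0"
  shows "zw.omega q (- (zpow i e * alphX)) (Es (cz i e))"
  using zw.omega_exists(1)[OF zw.W_uminus[OF zw_W_zX[OF assms]] deg_gt_uminus[OF deg_gt_zX]]
    Omega_uminus_zX[OF assms(1)] by simp

text \<open>Inverts the exponential of the opposite alphabet, already known to be \<open>Es\<close>;
  it remains to see that \<open>Hs\<close> has no negative weights.\<close>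

lemma omega_zX: "zw.omega q (zpow i 1 * alphX) (Hs (cz i 1))"
proof -
  have "zw.W q 0 (Hs (cz i 1))"
    unfolding zw.W_def
  proof (intro allI impI)
    fix m a assume "coef (Hs (cz i 1)) m a \<noteq> 0"
    then have "a = single i (int (xdeg m))"
      by (simp add: coef_Hs_cz del: xcoeff_Hs_Es split: if_splits)
    then show "int 0 \<le> zwt q m a" by (simp add: zwt_def lookup_single when_def)
  qed
  from zw.omega_uminus[OF omega_uminus_zX[of 1 q i] Es_Hs this] show ?thesis by simp
qed


section \<open>The plethystic alphabets of the three symbols\<close>

lemma schur_1: "schur [1] = hc 1" "schur [2] = hc 2"
  by (simp_all add: schur_def det_single)

lemma schur_11: "schur [1, 1] = hc 1 ^ 2 - hc 2"
proof -
  let ?A = "mat 2 2 (\<lambda>(i, j). hc (int ([1, 1] ! i) - int i + int j))"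
  have d: "mat_delete ?A 0 0 = mat 1 1 (\<lambda>_. hc 1)" "mat_delete ?A 0 1 = mat 1 1 (\<lambda>_. hc 0)"
    by (auto intro!: eq_matI simp: mat_delete_def)
  have "schur [1, 1] = det ?A"
    by (simp add: schur_def numeral_2_eq_2)
  also have "\<dots> = (\<Sum>j<2. ?A $$ (0, j) * cofactor ?A 0 j)"
    by (rule laplace_expansion_row) auto
  also have "\<dots> = hc 1 ^ 2 - hc 2"
    using d by (simp add: cofactor_def numeral_2_eq_2 det_single)
  finally show ?thesis .
qed

lemma f_sym_eq:
  "f_sym Cell = hc 1 + (hc 1 ^ 2 - hc 2)"
  "f_sym Hdom = hc 2" "f_sym Vdom = hc 1 ^ 2 - hc 2"
  by (simp_all only: f_sym.simps schur_1 schur_11)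

lemma f_sym_LambdaZ [simp]: "f_sym s \<in> LambdaZ"
  by (cases s) (simp_all add: f_sym_eq power2_eq_square del: f_sym.simps)

lemma bdeg_f_sym [simp]: "bdeg (f_sym s)"
  using f_sym_LambdaZ[of s] by (simp add: LambdaZ_iff)

lemma over_f_sym [simp]: "over A (f_sym s)"
  by (cases s) (simp_all add: f_sym_eq del: f_sym.simps)

lemma deg_gt_f_sym: "deg_gt 0 (f_sym s)"
  unfolding deg_gt_def
  by (cases s) (simp_all add: f_sym_eq power2_eq_square xcoeff_mult_0 del: f_sym.simps)

text \<open>Here $f[X + z_q] = f[X] + z_q X + f_1$; \<open>c1\<close> is $\Omega[-f_1]$, and \<open>c1f\<close> is \<open>c1\<close> with $z_q = t$.\<close>

fun f1 :: "symbol \<Rightarrow> nat \<Rightarrow> ser" where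
  "f1 Cell q = zpow q 1"
| "f1 Vdom q = 0"
| "f1 Hdom q = zpow q 2"

fun c1 :: "symbol \<Rightarrow> nat \<Rightarrow> ser" where
  "c1 Cell q = 1 - zpow q 1"
| "c1 Vdom q = 1"
| "c1 Hdom q = 1 - zpow q 2"

fun c1f :: "symbol \<Rightarrow> ser fps" where
  "c1f Cell = 1 - fps_X"
| "c1f Vdom = 1"
| "c1f Hdom = 1 - fps_X ^ 2"

lemma omega_f1: "zw.omega q (- f1 s i) (c1 s i)"
  by (cases s) (auto simp: zpow_def zw.omega_0 lookup_single when_def intro!: omega_uminus_zmonom)

lemma tau_f_sym: "tau q (f_sym s) = f_sym s + zpow q 1 * alphX + f1 s q"
proof -
  have h1: "tau q (hc 1) = hc 1 + zpow q 1" by (rule tau_complete_hom_1)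
  have h2: "tau q (hc 2) = hc 2 + zpow q 1 * hc 1 + zpow q 2"
    by (rule tau_complete_hom_2)
  have z2: "zpow q 2 = zpow q 1 ^ 2"
    using zpow_add[of q 1 1] by (simp add: power2_eq_square)
  have diff: "tau q (F - G) = tau q F - tau q G" if "bdeg F" "bdeg G" for F G
    using tau_add[of F "- G" q] tau_uminus[of G q] that by simp
  show ?thesis
    by (cases s)
      (simp_all add: f_sym_eq alphX_eq diff tau_add tau_mult h1 h2 z2 power2_eq_square
        algebra_simps del: f_sym.simps)
qed

definition fOm :: "symbol \<Rightarrow> ser"
  where "fOm s = Omega (- f_sym s)"

lemma omega_f_sym: "zw.omega q (- f_sym s) (fOm s)" "zw.omega q (f_sym s) (Omega (f_sym s))"
  unfolding fOm_def
  by (intro zw.omega_exists zw.W_uminus zw_W_rational deg_gt_uminus deg_gt_f_sym, simp)+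

lemma fOm_mult: "fOm s * Omega (f_sym s) = 1"
proof -
  have "zw.omega 0 0 (fOm s * Omega (f_sym s))"
    using zw.omega_add[OF omega_f_sym[of 0 s]] by simp
  then show ?thesis
    using zw.Omega_eqI[OF zw.omega_0] zw.Omega_eqI by metis
qed

lemma Omega_rational_closed:
  assumes "symmetric_series A" "over {} A" "deg_gt 0 A"
  shows "symmetric_series (Omega A)" "over {} (Omega A)"
proof -
  have x: "xcoeff (Omega A) m = xcoeff (Omega_trunc (xdeg m) A) m" for m
    using assms by (intro zw.omega_exists(2)[of 0] zw_W_rational)
  show "symmetric_series (Omega A)"
    using symmetric_series_Omega_trunc[OF assms(1)] by (simp add: symmetric_series_def x xdeg_map_key)
  show "over {} (Omega A)"
    using over_Omega_trunc[OF assms(2)] by (simp add: over_def x)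
qed

lemma Omega_f_sym_closed [simp]:
  "symmetric_series (fOm s)" "over {} (fOm s)" "symmetric_series (Omega (f_sym s))" "over {} (Omega (f_sym s))"
  unfolding fOm_def by (intro Omega_rational_closed deg_gt_uminus deg_gt_f_sym; simp)+

text \<open>\<open>gen q F K\<close>: the expansion of \<open>F\<close> in powers of \<open>z\<^sub>q\<close> is \<open>K\<close>.\<close>

definition gen :: "nat \<Rightarrow> ser \<Rightarrow> ser fps \<Rightarrow> bool"
  where "gen q F K \<longleftrightarrow> (\<forall>l. zext q l F = (if l < 0 then 0 else fps_nth K (nat l)))"

lemma gen_mult_linear:
  assumes "gen q F K" "over (- {q}) b"
  shows "gen q ((1 - b * zpow q (int p)) * F) ((1 - fps_const b * fps_X ^ p) * K)"
  unfolding gen_def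
proof
  fix l
  have "zext q l (b * zpow q (int p) * F) = b * zext q (l - int p) F"
    using assms(2) by (simp add: mult.assoc zext_mult zext_zpow_mult)
  also have "\<dots> = (if l < 0 then 0 else fps_nth (fps_const b * fps_X ^ p * K) (nat l))"
    using assms(1) by (auto simp: gen_def mult.assoc fps_X_power_mult_nth nat_diff_distrib)
  finally show "zext q l ((1 - b * zpow q (int p)) * F) =
      (if l < 0 then 0 else fps_nth ((1 - fps_const b * fps_X ^ p) * K) (nat l))"
    using assms(1) by (simp add: left_diff_distrib zext_linear gen_def)
qed

lemma gen_c1:
  assumes "gen q F K"
  shows "gen q (c1 s q * F) (c1f s * K)"
  using gen_mult_linear[OF assms, of 1 1] gen_mult_linear[OF assms, of 1 2] assms
  by (cases s) simp_all

definition Hf :: "ser fps"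
  where "Hf = Abs_fps (\<lambda>k. hc (int k))"

definition Ef :: "ser fps"
  where "Ef = Abs_fps es"

lemma single_eq_zmon: "lookup (a :: zmon) q = 0 \<Longrightarrow> a + single q l = single q k \<longleftrightarrow> a = 0 \<and> l = k"
proof
  assume 0: "lookup a q = 0" and eq: "a + single q l = single q k"
  have "l = k" using arg_cong[OF eq, of "\<lambda>b. lookup b q"] 0 by (simp add: lookup_add)
  then show "a = 0 \<and> l = k" using eq by simp
qed auto

lemma gen_Hs: "gen i (Hs (cz i 1)) Hf"
  unfolding gen_def
proof (intro allI ser_eqI)
  fix l m a
  show "coef (zext i l (Hs (cz i 1))) m a = coef (if l < 0 then 0 else fps_nth Hf (nat l)) m a"
    by (auto simp: coef_zext coef_Hs_cz single_eq_zmon Hf_def lookup_one when_def simp del: xcoeff_Hs_Es)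
qed

lemma gen_Es: "gen i (Es (cz i 1)) Ef"
  unfolding gen_def
proof (intro allI ser_eqI)
  fix l m a
  show "coef (zext i l (Es (cz i 1))) m a = coef (if l < 0 then 0 else fps_nth Ef (nat l)) m a"
    by (auto simp: coef_zext coef_Es_cz coef_es single_eq_zmon Ef_def simp del: xcoeff_Hs_Es)
qed

text \<open>\<open>D_Omega\<close> for the alphabet -f, with \<open>z_0\<close> as the added
  variable: the increment -z_0 X - f_1 has exponential \<open>Es\<close> times \<open>c1\<close>. As
  f involves no indeterminates, powers of \<open>z_0\<close> may be read as powers of t.\<close>

theorem toh_fOm: "toh (fOm s) = fps_const (fOm s) * (c1f s * Ef)"
proof (rule fps_ext)
  fix k
  have "zw.omega 0 (- (zpow 0 1 * alphX) + - f1 s 0) (Es (cz 0 1) * c1 s 0)"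
    by (intro zw.omega_add omega_uminus_zX omega_f1) auto
  moreover have "tau 0 (- f_sym s) = - f_sym s + (- (zpow 0 1 * alphX) + - f1 s 0)"
    by (simp add: tau_uminus tau_f_sym)
  ultimately have "D k (fOm s) = zext 0 (int k) (fOm s * (Es (cz 0 1) * c1 s 0))"
    unfolding fOm_def
    by (intro D_Omega zw.W_uminus zw_W_rational deg_gt_uminus deg_gt_f_sym) auto
  also have "\<dots> = fOm s * zext 0 (int k) (c1 s 0 * Es (cz 0 1))"
    by (subst zext_mult) (auto intro: over_mono[of "{}"] simp: mult.commute)
  also have "zext 0 (int k) (c1 s 0 * Es (cz 0 1)) = fps_nth (c1f s * Ef) k"
    using gen_c1[OF gen_Es[of 0], of s] by (simp add: gen_def)
  finally show "fps_nth (toh (fOm s)) k = fps_nth (fps_const (fOm s) * (c1f s * Ef)) k"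
    by simp
qed


section \<open>Plethysm\<close>

lemma power_sum_poly_superset:
  assumes "finite T" "keys F \<subseteq> T"
  shows "power_sum_poly F A = (\<Sum>t\<in>T. ratc (lookup F t) * (\<Prod>k\<in>keys t. p_at k A ^ lookup t k))"
  unfolding power_sum_poly_def
  by (rule sum.mono_neutral_left) (use assms in \<open>auto simp: in_keys_iff ratc_hom\<close>)

lemma power_sum_poly_add: "power_sum_poly (F + G) A = power_sum_poly F A + power_sum_poly G A"
  using keys_add[of F G] power_sum_poly_superset[of "keys F \<union> keys G" "F + G" A]
    power_sum_poly_superset[of "keys F \<union> keys G" F A] power_sum_poly_superset[of "keys F \<union> keys G" G A]
  by (simp add: lookup_add ratc_hom distrib_right sum.distrib)

lemma power_sum_poly_single:
  "power_sum_poly (single t c) A = ratc c * (\<Prod>k\<in>keys t. p_at k A ^ lookup t k)"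
  by (subst power_sum_poly_superset[of "{t}"]) auto

lemma p_at_one: "p_at 1 A = A"
proof (rule p_at_eqI)
  have id: "kx 1 m = m" "kz 1 a = a" for m a by (auto intro!: poly_mapping_eqI)
  show "coef A (kx 1 m) (kz 1 a) = coef A m a" for m a by (simp only: id)
  show "(\<exists>m'. m = kx 1 m') \<and> (\<exists>a'. a = kz 1 a')" for m a
    using id(1)[of m] id(2)[of a] by metis
qed simp

text \<open>Newton's identity for p_1 = h_1, p_2 and h_2. By \<open>D_eqI\<close> it reduces to
  comparing powers of \<open>x_0\<close>, of which only the first two positive ones occur.\<close>

lemma h1_squared: "hc 1 ^ 2 + p_at 2 (hc 1) = hc 2 + hc 2"
proof (rule D_eqI)
  fix k :: nat assume "k > 0"
  then consider "k = 1" | "k = 2" | "k \<ge> 3" by linarith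
  then have "D k (hc 1 ^ 2) + D k (p_at 2 (hc 1)) = D k (hc 2) + D k (hc 2)"
  proof cases
    case 3
    have "D i (hc 1) * D (k - i) (hc 1) = 0" if "i \<le> k" for i
      using that 3 by (cases "i \<le> 1") auto
    moreover have "D k (p_at 2 (hc 1)) = 0"
      using 3 by (auto simp: D_p_at p_at_0)
    ultimately show ?thesis
      using 3 by (simp add: power2_eq_square D_mult)
  qed (simp_all add: power2_eq_square D_mult D_p_at p_at_1 numeral_2_eq_2)
  then show "D k (hc 1 ^ 2 + p_at 2 (hc 1)) = D k (hc 2 + hc 2)"
    by (simp only: D_simps(2))
next
  show "D 0 (hc 1 ^ 2 + p_at 2 (hc 1)) = hc 1 ^ 2 + p_at 2 (hc 1)"
    by (rule symmetric_series_D0) auto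
  show "D 0 (hc 2 + hc 2) = hc 2 + hc 2"
    by (rule symmetric_series_D0) (intro symmetric_series_add LambdaZ_symmetric complete_hom_LambdaZ)
  have "xcoeff (p_at 2 (hc 1)) 0 = 0"
    using xcoeff_p_at_kx[of 2 "hc 1" 0] by (simp add: zpower_eq)
  then show "xcoeff (hc 1 ^ 2 + p_at 2 (hc 1)) 0 = xcoeff (hc 2 + hc 2) 0"
    by (simp add: power2_eq_square xcoeff_mult_0)
qed

text \<open>Provides the polynomial in power sums that \<open>plethysm\<close> presupposes, from h_2
  = (p_1^2 + p_2)/2 and e_2 = (p_1^2 - p_2)/2.\<close>

lemma power_sums_f_sym:
  obtains F where "\<forall>t\<in>keys F. 0 \<notin> keys t" "f_sym s = power_sum_poly F alphX"
proof -
  let ?t11 = "single (1 :: nat) (2 :: nat)" and ?t2 = "single (2 :: nat) (1 :: nat)"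
    and ?t1 = "single (1 :: nat) (1 :: nat)"
  have ps: "power_sum_poly (single ?t1 c) alphX = ratc c * hc 1"
    "power_sum_poly (single ?t11 c) alphX = ratc c * hc 1 ^ 2"
    "power_sum_poly (single ?t2 c) alphX = ratc c * p_at 2 (hc 1)" for c
    by (simp_all add: power_sum_poly_single alphX_eq p_at_one[unfolded One_nat_def])
  have half: "ratc (1/2) * F + ratc (1/2) * F = F" for F
    using ratc_hom(3)[of "1/2" "1/2"] by (simp add: ratc_hom flip: distrib_right)
  have h2: "hc 2 = ratc (1/2) * hc 1 ^ 2 + ratc (1/2) * p_at 2 (hc 1)"
    using half[of "hc 2"] by (simp add: h1_squared flip: distrib_left)
  have e2: "hc 1 ^ 2 - hc 2 =
      ratc (1/2) * hc 1 ^ 2 + ratc (- (1/2)) * p_at 2 (hc 1)"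
    using half[of "hc 1 ^ 2"] by (simp add: h2 ratc.hom_uminus algebra_simps)
  let ?F = "\<lambda>c. single ?t11 (1/2) + single ?t2 c :: (nat \<Rightarrow>\<^sub>0 nat) \<Rightarrow>\<^sub>0 rat"
  have keys: "keys (?F c) \<subseteq> {?t11, ?t2}" for c
    using keys_add[of "single ?t11 (1/2 :: rat)" "single ?t2 c"]
    by (auto split: if_splits)
  have keys1: "keys (single ?t1 1 + ?F c) \<subseteq> {?t1, ?t11, ?t2}" for c
    using keys_add[of "single ?t1 (1 :: rat)" "?F c"] keys[of c] by fastforce
  show ?thesis
  proof (cases s)
    case Cell
    show ?thesis
      by (rule that[of "single ?t1 1 + ?F (- (1/2))"])
         (use keys1[of "- (1/2)"] in \<open>auto simp: Cell f_sym_eq power_sum_poly_add ps[unfolded One_nat_def] e2 ratc_hom simp del: f_sym.simps\<close>)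
  next
    case Vdom
    show ?thesis
      by (rule that[of "?F (- (1/2))"])
         (use keys[of "- (1/2)"] in \<open>auto simp: Vdom f_sym_eq power_sum_poly_add ps[unfolded One_nat_def] e2 simp del: f_sym.simps\<close>)
  next
    case Hdom
    show ?thesis
      by (rule that[of "?F (1/2)"])
         (use keys[of "1/2"] h2 in \<open>auto simp: Hdom f_sym_eq power_sum_poly_add ps[unfolded One_nat_def] simp del: f_sym.simps\<close>)
  qed
qed

lemma tau_power_sum_poly:
  assumes "bdeg A" "\<forall>t\<in>keys F. 0 \<notin> keys t"
  shows "tau q (power_sum_poly F A) = power_sum_poly F (tau q A)"
proof -
  have "tau q (p_at k A) = p_at k (tau q A)" if "t \<in> keys F" "k \<in> keys t" for t k
    using that assms by (intro tau_p_at) (auto intro: gr0I)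
  then show ?thesis
    unfolding power_sum_poly_def using assms(1)
    by (simp add: tau_sum tau_mult tau_prod tau_power cong: sum.cong prod.cong)
qed

fun tauN :: "nat \<Rightarrow> ser \<Rightarrow> ser" where
  "tauN 0 G = G"
| "tauN (Suc n) G = tau (Suc n) (tauN n G)"

lemma bdeg_tauN [simp]: "bdeg G \<Longrightarrow> bdeg (tauN n G)"
  by (induction n) auto

lemma tauN_power_sum_poly:
  "bdeg A \<Longrightarrow> \<forall>t\<in>keys F. 0 \<notin> keys t \<Longrightarrow> tauN n (power_sum_poly F A) = power_sum_poly F (tauN n A)"
  by (induction n) (auto simp: tau_power_sum_poly)

text \<open>Evaluation at X = 0. Composed with \<open>tauN\<close>, which adds
  \<open>z_1, ..., z_n\<close> to the alphabet, it replaces X by Z.\<close>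

definition eps :: "ser \<Rightarrow> ser"
  where "eps F = xconst (xcoeff F 0)"

interpretation eps: comm_ring_hom eps
  by unfold_locales (simp_all add: eps_def xconst_hom xcoeff_mult_0 xcoeff_one)

lemma eps_xconst [simp]: "eps (xconst c) = xconst c"
  by (simp add: eps_def xcoeff_xconst)

lemma eps_p_at:
  assumes "k > 0"
  shows "eps (p_at k A) = p_at k (eps A)"
proof -
  have kx0: "kx k m = 0 \<longleftrightarrow> m = 0" for m using kx_inject[OF assms, of m 0] by simp
  have "p_at k (xconst c) = xconst (zpower k c)" for c
  proof (rule p_at_eqI[OF assms])
    show "coef (xconst (zpower k c)) (kx k m) (kz k a) = coef (xconst c) m a" for m a
      using assms by (simp add: xcoeff_xconst kx0 lookup_zpower)
    show "kform k m a" if "coef (xconst (zpower k c)) m a \<noteq> 0" for m a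
    proof -
      have "m = kx k 0" "lookup (zpower k c) a \<noteq> 0"
        using that by (auto simp: xcoeff_xconst split: if_splits)
      then show ?thesis by (blast elim: lookup_zpower_nonzero)
    qed
  qed
  then show ?thesis
    using xcoeff_p_at_kx[OF assms, of A 0] by (simp add: eps_def)
qed

lemma eps_ratc [simp]: "eps (ratc c) = ratc c"
  by (simp add: ratc_def)

lemma eps_power_sum_poly:
  assumes "\<forall>t\<in>keys F. 0 \<notin> keys t"
  shows "eps (power_sum_poly F A) = power_sum_poly F (eps A)"
proof -
  have "eps (p_at k A) = p_at k (eps A)" if "t \<in> keys F" "k \<in> keys t" for t k
    using that assms by (intro eps_p_at) (auto intro: gr0I)
  then show ?thesis
    unfolding power_sum_poly_def
    by (simp add: eps.hom_sum eps.hom_mult eps.hom_prod eps.hom_power cong: sum.cong prod.cong)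
qed

lemma alphZ_Suc: "alphZ (Suc n) = alphZ n + zpow (Suc n) 1"
  by (simp add: alphZ_def)

lemma alphZ_xconst: "\<exists>c. alphZ n = xconst c"
  by (auto simp: alphZ_def zpow_eq_xconst simp flip: xconst_sum)

lemma tauN_alphX: "tauN n alphX = alphX + alphZ n"
proof (induction n)
  case (Suc n)
  obtain c where "alphZ n = xconst c" using alphZ_xconst by blast
  then show ?case
    using tau_complete_hom_1[of "Suc n"]
    by (simp add: Suc tau_add alphZ_Suc alphX_eq[symmetric] add_ac)
qed (simp add: alphZ_def)

text \<open>
  Evaluating the alphabet \<open>X\<close> at the \<open>z\<^sub>i\<close> shows that the plethysm does not depend on the choice of
  the polynomial in the power sums.
\<close>

lemma plethysm_alphZ: "plethysm (f_sym s) (alphZ n) = eps (tauN n (f_sym s))"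
proof -
  have *: "power_sum_poly F (alphZ n) = eps (tauN n (power_sum_poly F alphX))"
    if "\<forall>t\<in>keys F. 0 \<notin> keys t" for F
  proof -
    obtain c where "alphZ n = xconst c" using alphZ_xconst by blast
    moreover have "eps alphX = 0" by (simp add: eps_def alphX_eq xconst_hom)
    ultimately show ?thesis
      using that by (simp add: tauN_power_sum_poly eps_power_sum_poly tauN_alphX eps.hom_add)
  qed
  obtain F where F: "\<forall>t\<in>keys F. 0 \<notin> keys t" "f_sym s = power_sum_poly F alphX"
    by (rule power_sums_f_sym)
  show ?thesis
    unfolding plethysm_def
  proof (rule the_equality)
    show "\<exists>F. (\<forall>t\<in>keys F. 0 \<notin> keys t) \<and> f_sym s = power_sum_poly F alphX \<and>
        eps (tauN n (f_sym s)) = power_sum_poly F (alphZ n)"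
      using F *[OF F(1)] by auto
  qed (auto simp: *)
qed

text \<open>\<open>fZ s n\<close> is $f[Z]$, and \<open>cZ s n\<close> is $\Omega[-f[Z]]$.\<close>

fun fZ :: "symbol \<Rightarrow> nat \<Rightarrow> ser" where
  "fZ s 0 = 0"
| "fZ s (Suc n) = fZ s n + f1 s (Suc n) + alphZ n * zpow (Suc n) 1"

lemma f1_xconst: "\<exists>c. f1 s n = xconst c"
proof (cases s)
  case Vdom
  then show ?thesis by (auto intro!: exI[of _ 0] simp: xconst_hom)
qed (auto simp: zpow_eq_xconst)

lemma fZ_xconst: "\<exists>c. fZ s n = xconst c"
proof (induction n)
  case 0
  show ?case by (rule exI[of _ 0]) (simp add: xconst_hom)
next
  case (Suc n)
  then obtain a where "fZ s n = xconst a" by blast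
  moreover obtain b where "alphZ n = xconst b" using alphZ_xconst by blast
  moreover obtain d where "f1 s (Suc n) = xconst d" using f1_xconst by blast
  ultimately show ?case
    by (auto simp: zpow_eq_xconst simp flip: xconst_hom(3) xconst_hom(6))
qed

lemma tauN_f_sym: "tauN n (f_sym s) = f_sym s + alphZ n * alphX + fZ s n"
proof (induction n)
  case (Suc n)
  obtain a where a: "fZ s n = xconst a" using fZ_xconst by blast
  obtain b where b: "alphZ n = xconst b" using alphZ_xconst by blast
  have "tau (Suc n) alphX = alphX + zpow (Suc n) 1"
    using tau_complete_hom_1[of "Suc n"] by (simp add: alphX_eq)
  then show ?case
    by (simp add: Suc a b tau_add tau_mult tau_f_sym alphZ_Suc del: f_sym.simps)
       (simp add: algebra_simps)
qed (simp add: alphZ_def)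

lemma plethysm_eq_fZ: "plethysm (f_sym s) (alphZ n) = fZ s n"
proof -
  obtain a where a: "fZ s n = xconst a" using fZ_xconst by blast
  have "xcoeff (f_sym s) 0 = 0" using deg_gt_f_sym[of s] by (simp add: deg_gt_def)
  then have "eps (f_sym s) = 0" "eps alphX = 0"
    by (simp_all add: eps_def xconst_hom alphX_eq)
  then show ?thesis
    by (simp add: plethysm_alphZ tauN_f_sym eps.hom_add eps.hom_mult a del: f_sym.simps)
qed

fun cZ :: "symbol \<Rightarrow> nat \<Rightarrow> ser" where
  "cZ s 0 = 1"
| "cZ s (Suc n) = cZ s n * c1 s (Suc n) * (\<Prod>i=1..n. 1 - zpow i 1 * zpow (Suc n) 1)"

lemma omega_fZ: "zw.omega 0 (- fZ s n) (cZ s n)"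
proof (induction n)
  case 0
  then show ?case by (simp add: zw.omega_0)
next
  case (Suc n)
  have "zw.omega 0 (\<Sum>i=1..n. - (zpow i 1 * zpow (Suc n) 1)) (\<Prod>i=1..n. 1 - zpow i 1 * zpow (Suc n) 1)"
  proof (rule zw.omega_sum)
    fix i assume "i \<in> {1..n}"
    then show "zw.omega 0 (- (zpow i 1 * zpow (Suc n) 1)) (1 - zpow i 1 * zpow (Suc n) 1)"
      unfolding zpow_def zmonom_add[symmetric]
      by (intro omega_uminus_zmonom) (simp add: zsum_add lookup_add lookup_single)
  qed simp
  from zw.omega_add[OF zw.omega_add[OF Suc omega_f1[of 0 s "Suc n"]] this] show ?case
    by (simp add: alphZ_def sum_distrib_right sum_negf)
qed

lemma Omega_plethysm: "Omega (- plethysm (f_sym s) (alphZ n)) = cZ s n"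
  unfolding plethysm_eq_fZ by (rule zw.Omega_eqI[OF omega_fZ])

lemma Omega_alphZ: "Omega (alphZ n * alphX) = (\<Prod>i=1..n. Hs (cz i 1))"
  unfolding alphZ_def sum_distrib_right
  by (intro zw.Omega_eqI[of 0] zw.omega_sum omega_zX) simp

lemma Omega_alphZ_alphZstar:
  "Omega (- ((alphZ n + alphZstar n) * alphX)) = (\<Prod>i=1..n. Es (cz i 1) * Es (cz i (- 1)))"
proof -
  have "- ((alphZ n + alphZstar n) * alphX) = (\<Sum>i=1..n. - (zpow i 1 * alphX) + - (zpow i (- 1) * alphX))"
    unfolding alphZ_def alphZstar_def distrib_right sum_distrib_right
    by (simp add: sum_negf sum_subtractf)
  then show ?thesis
    by (simp only:) (intro zw.Omega_eqI[of 0] zw.omega_sum zw.omega_add omega_uminus_zX, auto)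
qed


section \<open>Compositions of Bernstein operators\<close>

lemma coef_zcoeff: "coef (zcoeff a F) m b = (if b = 0 then coef F m a else 0)"
  by (auto simp: zcoeff_def lookup_single when_def)

lemma zcoeff_add_single:
  assumes "lookup a q = 0"
  shows "zcoeff (a + single q r) F = zcoeff a (zext q r F)"
  by (rule ser_eqI) (simp add: coef_zcoeff coef_zext assms)

lemma coef_over_eq_0: "over A F \<Longrightarrow> \<not> keys a \<subseteq> A \<Longrightarrow> coef F m a = 0"
  by (rule ccontr) (auto simp: over_def lover_def in_keys_iff)

lemma zcoeff_0_rational:
  assumes "over {} F"
  shows "zcoeff 0 F = F"
proof (rule ser_eqI)
  fix m b
  show "coef (zcoeff 0 F) m b = coef F m b"
    using coef_over_eq_0[OF assms, of b m] by (cases "b = 0") (simp_all add: coef_zcoeff)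
qed

lemma zcoeff_over_eq_0:
  assumes "over A F" "\<not> keys a \<subseteq> A"
  shows "zcoeff a F = 0"
  by (rule ser_eqI) (use coef_over_eq_0[OF assms] in \<open>simp add: coef_zcoeff\<close>)

lemma lover_power [simp]: "c \<in> lover A \<Longrightarrow> c ^ k \<in> lover A"
  by (induction k) auto

lemma lover_cz: "i \<in> A \<Longrightarrow> cz i e \<in> lover A"
  by (simp add: cz_def)

lemma over_Hs_Es:
  "c \<in> lover A \<Longrightarrow> over A (Hs c)" "c \<in> lover A \<Longrightarrow> over A (Es c)" "over A (es k)"
  by (auto simp: over_def)

section \<open>Bernstein operators through complete functions and skewing\<close>

definition fint :: "ser fps \<Rightarrow> int \<Rightarrow> ser"
  where "fint K l = (if l < 0 then 0 else fps_nth K (nat l))"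

lemma gen_fint: "gen q F K \<Longrightarrow> zext q l F = fint K l"
  by (simp add: gen_def fint_def)

lemma fint_Hf: "fint Hf l = hc l"
  by (simp add: fint_def Hf_def)

text \<open>The expansion of Omega[-cX] into the terms c^i (-1)^i e_i is infinite, but its part
  beyond the degree of T skews T to 0.\<close>

lemma skew_Es:
  assumes "T \<in> LambdaZ" "deg_le d T"
  shows "skew (Es c) T = (\<Sum>i\<le>d. xconst (c ^ i) * skew (es i) T)"
proof -
  let ?S = "\<Sum>i\<le>d. xconst (c ^ i) * es i"
  have "deg_gt d (Es c - ?S)"
    unfolding deg_gt_def
  proof (intro allI impI)
    fix m assume m: "xdeg m \<le> d"
    have "(\<Sum>i\<le>d. c ^ i * xcoeff (es i) m) =
        (\<Sum>i\<le>d. if i = xdeg m then (if sqfree m then c ^ i * (- 1) ^ i else 0) else 0)"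
      by (rule sum.cong) auto
    also have "\<dots> = xcoeff (Es c) m"
      using m by (simp add: power_minus[of c] mult.commute)
    finally show "xcoeff (Es c - ?S) m = 0" by simp
  qed
  then have "skew (Es c - ?S) T = 0"
    using assms by (intro skew_deg_gt) auto
  then have "skew (Es c) T = skew ?S T"
    using skew_add_left[of "Es c - ?S" ?S T] assms(1) by simp
  also have "\<dots> = (\<Sum>i\<le>d. xconst (c ^ i) * skew (es i) T)"
    using assms by (simp add: skew_sum_left skew_scale_left)
  finally show ?thesis .
qed

text \<open>The classical form of Bernstein's operator, the sum of (-1)^j h_(r+j) e_j^perp: the
  factor \<open>z_1^(-j)\<close> from skewing shifts the extracted power of Omega[z_1 X] from r to r
  + j.\<close>

lemma bernstein_eq:
  assumes "G \<in> Lambda" "deg_le d G"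
  shows "bernstein r G = (\<Sum>j\<le>d. hc (r + int j) * skew (es j) G)"
proof -
  have G: "G \<in> LambdaZ" "over {} G" using assms(1) by (auto simp: Lambda_iff)
  have ov: "over A (skew (es j) G)" for A j
    using over_skew[of "es j" G "{}"] G over_Hs_Es(3) over_mono by (metis empty_subsetI symmetric_Hs_Es(3))
  have "bernstein r G = zcoeff (0 + single 1 r)
      (\<Sum>j\<le>d. skew (es j) G * (zpow 1 (- int j) * Hs (cz 1 1)))"
    unfolding bernstein_def op_coeff_def zw.Omega_eqI[OF omega_zX] Omega_uminus_zX[OF order.refl]
      skew_Es[OF G(1) assms(2)] sum_distrib_left
    by (simp add: cz_power xconst_cz mult_ac)
  also have "\<dots> = zcoeff 0 (\<Sum>j\<le>d. hc (r + int j) * skew (es j) G)"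
  proof -
    have "zext 1 r (skew (es j) G * (zpow 1 (- int j) * Hs (cz 1 1))) = hc (r + int j) * skew (es j) G" for j
      unfolding zext_mult[OF ov] zext_zpow_mult gen_fint[OF gen_Hs] fint_Hf by (simp add: mult.commute)
    then show ?thesis
      unfolding zcoeff_add_single[of 0 1 r, OF lookup_zero] zext_sum by simp
  qed
  also have "\<dots> = (\<Sum>j\<le>d. hc (r + int j) * skew (es j) G)"
    by (rule zcoeff_0_rational) (simp add: ov)
  finally show ?thesis .
qed

text \<open>All Bernstein operators are defined with the same indeterminate \<open>z_1\<close>.
  Since they preserve rational coefficients, they compose without clash.\<close>

lemma bernstein_Lambda:
  assumes "G \<in> Lambda"
  shows "bernstein r G \<in> Lambda"
proof -
  have G: "G \<in> LambdaZ" "over {} G" using assms by (auto simp: Lambda_iff)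
  obtain d where "deg_le d G" using LambdaZ_deg[OF G(1)] .
  then show ?thesis
    using bernstein_eq[OF assms] G by (simp add: Lambda_iff over_skew over_Hs_Es)
qed

text \<open>Coefficients free of X pass through skewing operators as scalars.\<close>

definition const_fps :: "ser fps \<Rightarrow> bool"
  where "const_fps K \<longleftrightarrow> (\<forall>k. \<exists>c. fps_nth K k = xconst c)"

lemma const_fps_mult:
  assumes "const_fps K" "const_fps L"
  shows "const_fps (K * L)"
proof -
  obtain c d where cd: "\<And>k. fps_nth K k = xconst (c k)" "\<And>k. fps_nth L k = xconst (d k)"
    using assms unfolding const_fps_def by metis
  have "fps_nth (K * L) k = xconst (\<Sum>i=0..k. c i * d (k - i))" for k
    by (simp add: fps_mult_nth cd xconst_sum xconst_hom)
  then show ?thesis by (auto simp: const_fps_def)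
qed

lemma const_fps_linear: "const_fps (1 - fps_const (xconst c) * fps_X ^ p)"
proof -
  have "fps_nth (1 - fps_const (xconst c) * fps_X ^ p) k =
      xconst ((if k = 0 then 1 else 0) - (if k = p then c else 0))" for k
    by (auto simp: fps_X_power_iff xconst_hom)
  then show ?thesis by (auto simp: const_fps_def)
qed

lemma const_fps_1: "const_fps 1"
proof -
  have "fps_nth 1 k = xconst (if k = 0 then 1 else 0)" for k
    by (simp add: xconst_hom)
  then show ?thesis unfolding const_fps_def by blast
qed

lemma const_fps_c1f: "const_fps (c1f s)"
  using const_fps_linear[of 1 1] const_fps_linear[of 1 2] const_fps_1
  by (cases s) (simp_all add: xconst_hom)

text \<open>
  Commuting \<open>skew P\<close> past multiplication by \<open>h\<^sub>l\<close>: the hypothesis says that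
  $P[X + t] = P[X]\,K(t)\,\Omega[-tX]$.
\<close>

lemma skew_complete_hom_mult_toh:
  assumes P: "symmetric_series P" "toh P = fps_const P * (K * Ef)" "const_fps K"
    and G: "G \<in> LambdaZ" "deg_le d G"
  shows "skew P (hc l * G) = (\<Sum>i\<le>d. fint (K * Hf) (l - int i) * skew (es i) (skew P G))"
proof (cases "l < 0")
  case True
  then have "skew P (hc l * G) = 0"
    using skew_scale_right[of P 0 0] P by (simp add: xconst_hom)
  then show ?thesis using True by (simp add: fint_def)
next
  case False
  define n where "n = nat l"
  have n: "l = int n" using False by (simp add: n_def)
  define S where "S i = skew (es i) (skew P G)" for i
  obtain c where c: "\<And>k. fps_nth K k = xconst (c k)"
    using P(3) unfolding const_fps_def by metis
  have T: "skew P G \<in> LambdaZ" "deg_le d (skew P G)"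
    using P G by (auto intro: skew_deg_le)
  have S0: "S i = 0" if "i > d" for i
    unfolding S_def using T that
    by (intro skew_deg_gt[where d = d]) (auto simp: deg_gt_def)
  have DP: "skew (D j P) G = fps_nth (K * Abs_fps S) j" for j
  proof -
    have "D j P = fps_nth (toh P) j" by simp
    also have "\<dots> = P * fps_nth (K * Ef) j"
      unfolding P(2) by simp
    also have "\<dots> = (\<Sum>i=0..j. xconst (c i) * (es (j - i) * P))"
      unfolding fps_mult_nth[of K Ef] by (simp add: Ef_def c sum_distrib_left mult_ac)
    finally have "skew (D j P) G = skew (\<Sum>i=0..j. xconst (c i) * (es (j - i) * P)) G" by simp
    also have "\<dots> = (\<Sum>i=0..j. xconst (c i) * S (j - i))"
      using P(1) G by (simp add: skew_sum_left skew_scale_left S_def flip: skew_mult)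
    finally show ?thesis by (simp add: fps_mult_nth c)
  qed
  have "skew P (hc l * G) = (\<Sum>j\<le>n. hc (int (n - j)) * skew (D j P) G)"
    using skew_complete_hom_mult[OF P(1) G(1), of n] by (simp add: n of_nat_diff)
  also have "\<dots> = fps_nth (K * Abs_fps S * Hf) n"
    unfolding fps_mult_nth[of "K * Abs_fps S" Hf] DP
    by (simp only: Hf_def fps_nth_Abs_fps atLeast0AtMost mult.commute)
  also have "K * Abs_fps S * Hf = Abs_fps S * (K * Hf)"
    by (simp only: mult_ac)
  also have "fps_nth \<dots> n = (\<Sum>i\<le>n. S i * fps_nth (K * Hf) (n - i))"
    by (simp add: fps_mult_nth[of "Abs_fps S"] atLeast0AtMost)
  also have "\<dots> = (\<Sum>i\<le>n. fint (K * Hf) (l - int i) * S i)"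
    by (rule sum.cong) (auto simp: fint_def n nat_diff_distrib mult.commute)
  also have "\<dots> = (\<Sum>i\<le>max n d. fint (K * Hf) (l - int i) * S i)"
    by (rule sum.mono_neutral_left) (auto simp: fint_def n)
  also have "\<dots> = (\<Sum>i\<le>d. fint (K * Hf) (l - int i) * S i)"
    by (rule sum.mono_neutral_right) (auto simp: S0)
  finally show ?thesis by (simp add: S_def)
qed

text \<open>\<open>Pn s n\<close> is $\Omega[-f - (Z + Z^*)X]$, and \<open>kap s n\<close> its series $K(t)$ in the above sense.\<close>

definition Pn :: "symbol \<Rightarrow> nat \<Rightarrow> ser"
  where "Pn s n = fOm s * (\<Prod>i=1..n. Es (cz i 1) * Es (cz i (- 1)))"

definition kap :: "symbol \<Rightarrow> nat \<Rightarrow> ser fps"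
  where "kap s n = c1f s *
    (\<Prod>i=1..n. (1 - fps_const (zpow i 1) * fps_X) * (1 - fps_const (zpow i (- 1)) * fps_X))"

definition An :: "symbol \<Rightarrow> nat \<Rightarrow> ser"
  where "An s n = R_factor n * cZ s n * (\<Prod>i=1..n. Hs (cz i 1))"

lemma symmetric_Pn [simp]: "symmetric_series (Pn s n)"
  by (simp add: Pn_def)

lemma Pn_Suc: "Pn s (Suc n) = Es (cz (Suc n) 1) * (Es (cz (Suc n) (- 1)) * Pn s n)"
  by (simp add: Pn_def mult_ac)

lemma kap_Suc: "kap s (Suc n) =
    (1 - fps_const (zpow (Suc n) 1) * fps_X) * ((1 - fps_const (zpow (Suc n) (- 1)) * fps_X) * kap s n)"
  by (simp add: kap_def mult_ac)

lemma toh_Pn: "toh (Pn s n) = fps_const (Pn s n) * (kap s n * Ef)"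
proof (induction n)
  case 0
  then show ?case by (simp add: Pn_def kap_def toh_fOm)
next
  case (Suc n)
  then show ?case
    unfolding Pn_Suc kap_Suc toh_hom toh_Es xconst_cz
    by (simp add: mult_ac flip: fps_const_mult)
qed

lemma const_fps_kap: "const_fps (kap s n)"
proof (induction n)
  case 0
  then show ?case by (simp add: kap_def const_fps_c1f)
next
  case (Suc n)
  have "const_fps (1 - fps_const (zpow i e) * fps_X)" for i e
    using const_fps_linear[of "cz i e" 1] by (simp add: xconst_cz)
  then show ?case unfolding kap_Suc by (intro const_fps_mult Suc)
qed

lemma R_factor_Suc:
  "R_factor (Suc n) = R_factor n * (\<Prod>i=1..n. 1 - zpow (Suc n) 1 * zpow i (- 1))"
proof -
  let ?S = "\<lambda>n :: nat. {(i, j). 1 \<le> i \<and> i < j \<and> j \<le> n}"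
  have fin: "finite (?S n)" for n
    by (rule finite_subset[of _ "{1..n} \<times> {1..n}"]) auto
  have "?S (Suc n) = ?S n \<union> (\<lambda>i. (i, Suc n)) ` {1..n}"
    by (auto simp: le_Suc_eq)
  moreover have "?S n \<inter> (\<lambda>i. (i, Suc n)) ` {1..n} = {}" by auto
  ultimately show ?thesis
    unfolding R_factor_def using fin[of n]
    by (simp add: prod.union_disjoint prod.reindex inj_on_def)
qed

text \<open>What the prefactor gains with \<open>z_q\<close>: the factors 1 - z_i z_q together with
  \<open>c1\<close> extend Omega[-f[Z]], the factors 1 - z_q/z_i extend R(Z), and \<open>Hs\<close>
  extends Omega[ZX].\<close>

definition Kn :: "symbol \<Rightarrow> nat \<Rightarrow> nat \<Rightarrow> ser"
  where "Kn s n q = (\<Prod>i=1..n. (1 - zpow i 1 * zpow q 1) * (1 - zpow i (- 1) * zpow q 1))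
    * (c1 s q * Hs (cz q 1))"

lemma An_Suc: "An s (Suc n) = An s n * Kn s n (Suc n)"
  by (simp add: An_def Kn_def R_factor_Suc prod.distrib mult_ac)

text \<open>The linear factors of \<open>Kn\<close> are those of \<open>kap\<close> at t =
  \<open>z_q\<close>, and q > n keeps their coefficients free of \<open>z_q\<close>. So
  \<open>Kn\<close> is K(t) Omega[tX] at t = \<open>z_q\<close>.\<close>

lemma gen_Kn:
  assumes "q > n"
  shows "gen q (Kn s n q) (kap s n * Hf)"
proof -
  define F where "F n = (\<Prod>i=1..n. (1 - zpow i 1 * zpow q 1) * (1 - zpow i (- 1) * zpow q 1))
    * (c1 s q * Hs (cz q 1))" for n
  have "gen q (F n) (kap s n * Hf)"
    using assms
  proof (induction n)
    case 0
    then show ?case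
      using gen_c1[OF gen_Hs[of q], of s] by (simp add: F_def kap_def)
  next
    case (Suc n)
    have ov: "over (- {q}) (zpow (Suc n) e)" for e using Suc.prems by simp
    have F: "F (Suc n) = (1 - zpow (Suc n) 1 * zpow q (int 1)) *
        ((1 - zpow (Suc n) (- 1) * zpow q (int 1)) * F n)"
      by (simp add: F_def mult_ac)
    have K: "kap s (Suc n) * Hf = (1 - fps_const (zpow (Suc n) 1) * fps_X ^ 1) *
        ((1 - fps_const (zpow (Suc n) (- 1)) * fps_X ^ 1) * (kap s n * Hf))"
      unfolding kap_Suc by (simp add: mult_ac)
    show ?case
      unfolding F K using Suc by (intro gen_mult_linear ov) simp
  qed
  then show ?thesis by (simp add: F_def Kn_def)
qed

lemma over_c1: "i \<in> A \<Longrightarrow> over A (c1 s i)"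
  by (cases s) auto

lemma over_cZ: "over {1..n} (cZ s n)"
proof (induction n)
  case (Suc n)
  have "over {1..Suc n} (cZ s n)" using Suc by (rule over_mono) auto
  then show ?case
    by (auto intro!: over_mult over_prod over_simps over_c1 over_zpow)
qed simp

lemma over_An: "over {1..n} (An s n)"
proof -
  have "over {1..n} (R_factor n)"
    unfolding R_factor_def by (rule over_prod) (auto intro!: over_simps over_mult)
  then show ?thesis
    unfolding An_def by (intro over_mult over_prod over_cZ over_Hs_Es lover_cz) auto
qed

lemma over_Pn: "over {1..n} (Pn s n)"
  unfolding Pn_def
  by (intro over_mult over_prod over_Hs_Es lover_cz) (auto intro: over_mono[of "{}"])

text \<open>The claimed right-hand side with the skewing by Omega[-f] still contained in
  \<open>Pn\<close>; this keeps the induction uniform, and Omega[f] cancels it at the end.\<close>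

definition Fn :: "symbol \<Rightarrow> nat \<Rightarrow> ser \<Rightarrow> ser"
  where "Fn s n G = An s n * skew (Pn s n) G"

text \<open>Each term h_(r+j) e_j^perp of the operator, up to sign, is commuted with
  \<open>Pn\<close>, which yields further e_i^perp and coefficients of \<open>kap\<close> times the
  complete series. The indices j and i are those of the expansions of Omega[-X/z_q]^perp and
  Omega[-z_q X]^perp, which the double sum reassembles.\<close>

lemma Fn_bernstein:
  assumes "G \<in> Lambda"
  shows "Fn s n (bernstein r G) = zext (Suc n) r (Fn s (Suc n) G)"
proof -
  let ?q = "Suc n"
  have G: "G \<in> LambdaZ" "over {} G" using assms by (auto simp: Lambda_iff)
  obtain d where d: "deg_le d G" using LambdaZ_deg[OF G(1)] .
  define T where "T = skew (Pn s n) G"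
  define U where "U i j = skew (es i) (skew (es j) T)" for i j
  have T: "T \<in> LambdaZ" "deg_le d T"
    unfolding T_def using G d by (auto intro: skew_deg_le)
  have overT: "over (- {?q}) T"
    unfolding T_def
    by (intro over_skew G) (auto intro: over_mono[OF over_Pn] over_mono[OF G(2)])
  have overU: "over (- {?q}) (U i j)" for i j
    unfolding U_def using T overT by (auto intro!: over_skew over_Hs_Es)
  have overA: "over (- {?q}) (An s n)"
    by (rule over_mono[OF over_An]) auto
  have comm: "skew (Pn s n) (skew (es j) G) = skew (es j) T" for j
    unfolding T_def using G skew_mult[of "Pn s n" "es j" G] skew_mult[of "es j" "Pn s n" G]
    by (simp add: mult.commute)
  have "Fn s n (bernstein r G) =
      An s n * (\<Sum>j\<le>d. skew (Pn s n) (hc (r + int j) * skew (es j) G))"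
    unfolding Fn_def bernstein_eq[OF assms d] using G by (simp add: skew_sum_right)
  also have "\<dots> = An s n * (\<Sum>j\<le>d. \<Sum>i\<le>d. fint (kap s n * Hf) (r + int j - int i) * U i j)"
  proof -
    have "skew (Pn s n) (hc (r + int j) * skew (es j) G) =
        (\<Sum>i\<le>d. fint (kap s n * Hf) (r + int j - int i) * U i j)" for j
      using G d skew_complete_hom_mult_toh[OF symmetric_Pn toh_Pn const_fps_kap, of "skew (es j) G" d s n]
      by (simp add: comm U_def skew_deg_le)
    then show ?thesis by simp
  qed
  \<comment> \<open>The exponent i - j collects \<open>z_q^i\<close> from the commutation and
    \<open>z_q^(-j)\<close> from the operator; extracting \<open>z_q^r\<close> then leaves the
    coefficient of \<open>Kn\<close> at r + j - i.\<close>
  also have "\<dots> = zext ?q r (\<Sum>j\<le>d. \<Sum>i\<le>d. An s n * (U i j * (zpow ?q (int i - int j) * Kn s n ?q)))"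
  proof -
    have "zext ?q r (An s n * (U i j * (zpow ?q (int i - int j) * Kn s n ?q))) =
        An s n * (fint (kap s n * Hf) (r + int j - int i) * U i j)" for i j
      unfolding zext_mult[OF overA] zext_mult[OF overU] zext_zpow_mult gen_fint[OF gen_Kn[OF lessI]]
      by (simp add: mult.commute diff_diff_eq2)
    then show ?thesis by (simp add: zext_sum sum_distrib_left)
  qed
  also have "(\<Sum>j\<le>d. \<Sum>i\<le>d. An s n * (U i j * (zpow ?q (int i - int j) * Kn s n ?q))) = Fn s ?q G"
  proof -
    have "skew (Pn s ?q) G = skew (Es (cz ?q 1)) (skew (Es (cz ?q (- 1))) T)"
      unfolding Pn_Suc T_def using G by (simp add: skew_mult)
    also have "\<dots> = (\<Sum>j\<le>d. \<Sum>i\<le>d. xconst (cz ?q (- 1) ^ j) * (xconst (cz ?q 1 ^ i) * U i j))"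
      using T
      by (simp add: skew_Es[OF T] skew_sum_right skew_scale_right skew_Es[where d = d] skew_deg_le
          U_def sum_distrib_left)
    also have "\<dots> = (\<Sum>j\<le>d. \<Sum>i\<le>d. zpow ?q (int i - int j) * U i j)"
    proof -
      have "zpow ?q (int i - int j) = zpow ?q (- int j) * zpow ?q (int i)" for i j
        using zpow_add[of ?q "- int j" "int i"] by simp
      then show ?thesis by (simp add: cz_power xconst_cz mult.assoc)
    qed
    finally show ?thesis
      unfolding Fn_def An_Suc by (simp add: sum_distrib_left mult_ac)
  qed
  finally show ?thesis .
qed

lemma bernstein_comp_Suc:
  "bernstein_comp (Suc n) \<nu> G = bernstein_comp n \<nu> (bernstein (lookup \<nu> (Suc n)) G)"
proof -
  have "foldr (\<lambda>i F. bernstein (lookup \<nu> i) \<circ> F) xs H = foldr (\<lambda>i F. bernstein (lookup \<nu> i) \<circ> F) xs id \<circ> H"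
    for xs H
    by (induction xs) (simp_all add: comp_assoc)
  from this[of "[1..<Suc n]" "bernstein (lookup \<nu> (Suc n))"] show ?thesis
    by (simp add: bernstein_comp_def)
qed

lemma bernstein_comp_cong:
  assumes "\<And>i. i \<in> {1..n} \<Longrightarrow> lookup \<nu> i = lookup \<mu> i"
  shows "bernstein_comp n \<nu> = bernstein_comp n \<mu>"
  unfolding bernstein_comp_def by (rule foldr_cong) (auto simp: assms)

text \<open>The last operator of the composition acts first, so it is absorbed into the argument.
  The induction hypothesis applies to its image, which is again rational, and
  \<open>Fn_bernstein\<close> converts it into extracting a power of the last indeterminate.\<close>

theorem skew_bernstein_comp:
  assumes "G \<in> Lambda" "keys \<nu> \<subseteq> {1..n}"
  shows "skew (fOm s) (bernstein_comp n \<nu> G) = zcoeff \<nu> (Fn s n G)"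
  using assms
proof (induction n arbitrary: G \<nu>)
  case 0
  then have G: "G \<in> LambdaZ" "over {} G" by (auto simp: Lambda_iff)
  have "{(i, j). 1 \<le> i \<and> i < j \<and> j \<le> (0 :: nat)} = {}" by auto
  then have "R_factor 0 = 1" unfolding R_factor_def by (simp only: prod.empty)
  then have "Fn s 0 G = skew (fOm s) G" by (simp add: Fn_def An_def Pn_def)
  moreover have "over {} (skew (fOm s) G)" using G by (intro over_skew) auto
  ultimately show ?case
    using 0 by (simp add: bernstein_comp_def zcoeff_0_rational)
next
  case (Suc n)
  let ?r = "lookup \<nu> (Suc n)"
  define \<mu> where "\<mu> = \<nu> - single (Suc n) ?r"
  have mu: "lookup \<mu> i = (if i = Suc n then 0 else lookup \<nu> i)" for i
    by (simp add: \<mu>_def lookup_minus lookup_single when_def)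
  have keys: "keys \<mu> \<subseteq> {1..n}"
  proof
    fix i assume "i \<in> keys \<mu>"
    then have "i \<noteq> Suc n" "i \<in> keys \<nu>" by (auto simp: in_keys_iff mu split: if_splits)
    then show "i \<in> {1..n}" using Suc.prems(2) by (auto simp: le_Suc_eq)
  qed
  have "bernstein_comp (Suc n) \<nu> G = bernstein_comp n \<nu> (bernstein ?r G)"
    by (rule bernstein_comp_Suc)
  also have "bernstein_comp n \<nu> = bernstein_comp n \<mu>"
    by (rule bernstein_comp_cong) (simp add: mu)
  finally have "skew (fOm s) (bernstein_comp (Suc n) \<nu> G) = zcoeff \<mu> (Fn s n (bernstein ?r G))"
    using Suc.IH[OF bernstein_Lambda[OF Suc.prems(1)] keys] by simp
  also have "\<dots> = zcoeff \<mu> (zext (Suc n) ?r (Fn s (Suc n) G))"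
    by (simp only: Fn_bernstein[OF Suc.prems(1)])
  also have "\<dots> = zcoeff (\<mu> + single (Suc n) ?r) (Fn s (Suc n) G)"
    by (rule zcoeff_add_single[symmetric]) (simp add: mu)
  also have "\<mu> + single (Suc n) ?r = \<nu>"
    by (simp add: \<mu>_def)
  finally show ?case .
qed

theorem proposition11:
  fixes s :: symbol and n :: nat and \<nu> :: zmon and P :: ser
  assumes "n \<ge> 1" and "P \<in> Lambda"
  shows "deformed_bernstein_series s n \<nu> P =
    op_coeff (\<lambda>P. R_factor n * Omega (- plethysm (f_sym s) (alphZ n)) * Omega (alphZ n * alphX)
                    * skew (Omega (- ((alphZ n + alphZstar n) * alphX))) P) \<nu> P"
proof -
  let ?E = "\<Prod>i=1..n. Es (cz i 1) * Es (cz i (- 1))"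
  have P: "P \<in> LambdaZ" "over {} P" using assms(2) by (auto simp: Lambda_iff)
  have rhs: "op_coeff (\<lambda>P. R_factor n * Omega (- plethysm (f_sym s) (alphZ n)) * Omega (alphZ n * alphX)
      * skew (Omega (- ((alphZ n + alphZstar n) * alphX))) P) \<nu> P = zcoeff \<nu> (An s n * skew ?E P)"
    unfolding op_coeff_def Omega_plethysm Omega_alphZ Omega_alphZ_alphZstar An_def ..
  show ?thesis
  proof (cases "keys \<nu> \<subseteq> {1..n}")
    case True
    have G: "skew (Omega (f_sym s)) P \<in> Lambda"
      using P by (simp add: Lambda_iff over_skew)
    \<comment> \<open>The factor Omega[-f] inside \<open>Pn\<close> cancels against the skewing by
      Omega[f] that acts first.\<close>
    have "Pn s n * Omega (f_sym s) = fOm s * Omega (f_sym s) * ?E"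
      unfolding Pn_def by (simp only: mult_ac)
    also have "\<dots> = ?E" by (simp add: fOm_mult)
    finally have "Pn s n * Omega (f_sym s) = ?E" .
    then have "skew (Pn s n) (skew (Omega (f_sym s)) P) = skew ?E P"
      using skew_mult[of "Pn s n" "Omega (f_sym s)" P] P by simp
    then show ?thesis
      using skew_bernstein_comp[OF G True, of s] True
      by (simp add: rhs deformed_bernstein_series_def deformed_bernstein_def fOm_def[symmetric] Fn_def)
  next
    case False
    \<comment> \<open>For an exponent outside \<open>z_1, ..., z_n\<close> the left side is 0 by
      definition, and the right side involves no other indeterminates.\<close>
    have "over {1..n} (An s n * skew ?E P)"
      using P by (intro over_mult over_An over_skew over_prod over_Hs_Es lover_cz)
        (auto intro: over_mono[of "{}"])
    then show ?thesis
      using False zcoeff_over_eq_0 by (simp add: rhs deformed_bernstein_series_def)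
  qed
qed

end
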